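(* For any shifted skew diagram $D$ and any finite sets of positive integers $X,Y$, the ideals $I(G^{\mathrm{bip}}_{X,Y}(D))$ and $I(G^{\mathrm{nonbip}}_{X}(D))$ have multigraded Betti numbers independent of the coefficient field $k$: for all $i$ and all $X'\subseteq X$, $Y'\subseteq Y$ (with $X'\sqcup Y'\neq\varnothing$ in the first formula and $X'\ne\varnothing$ in the second), $$\beta_{i,X'\sqcup Y'}(I(G^{\mathrm{bip}}_{X,Y}(D)))=\begin{cases}1&\text{if } D^{\mathrm{bip}}_{X',Y'}\text{ is spherical with }\mathrm{rect}(D^{\mathrm{bip}}_{X',Y'})=|X'\sqcup Y'|-i-1,\\0&\text{otherwise,}\end{cases}$$ $$\beta_{i,X'}(I(G^{\mathrm{nonbip}}_X(D)))=\begin{cases}s&\text{if } D^{\mathrm{nonbip}}_{X'}\text{ has no empty rectangles, has }\mathrm{rect}(D^{\mathrm{nonbip}}_{X'})=|X'|-i-1,\\&\quad\text{and has } s\text{ non-excess staircase cells},\\0&\text{otherwise.}\end{cases}$$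
   Context: **Shifted skew diagrams.** Given integers $\lambda_1>\dots>\lambda_\ell>0$ and $\mu_1>\dots>\mu_r>0$ with $0\le r\le \ell$ and $\mu_i<\lambda_i$ for $1\le i\le \ell$ (where $\mu_i:=0$ for $i>r$), the associated shifted skew diagram is $D=\{(i,j)\in\mathbb Z^2: 1\le i\le \ell,\ i+\mu_i+1\le j\le i+\lambda_i\}$. Its elements are called cells; $i$ is the row index (increasing downwards), $j$ the column index (increasing to the right). All cells satisfy $i<j$. **Restricted diagrams, graphs, ideals.** For finite sets of positive integers $X=\{x_1<\dots<x_m\}$, $Y=\{y_1<\dots<y_n\}$, $D^{\mathrm{bip}}_{X,Y}$ is the diagram with rows indexed by $X$ and columns indexed by $Y$, having a cell in position $(x_i,y_j)$ iff $(x_i,y_j)\in D$; and $D^{\mathrm{nonbip}}_X:=D^{\mathrm{bip}}_{X,X}$. The bipartite graph $G^{\mathrm{bip}}_{X,Y}(D)$ has vertex set the disjoint union $X\sqcup Y$ (even if $X,Y$ share integers) with an edge $\{x_i,y_j\}$ for every cell $(x_i,y_j)$ of $D^{\mathrm{bip}}_{X,Y}$. The graph $G^{\mathrm{nonbip}}_X(D)$ has vertex set $X$ with an edge $\{x_i,x_j\}$ for every cell $(x_i,x_j)$ of $D^{\mathrm{nonbip}}_X$. For a field $k$ and a graph $G$ on vertex set $V$, the edge ideal $I(G)\subset k[V]$ (polynomial ring with one variable per vertex) is generated by the monomials $uv$ for edges $\{u,v\}$. For $V'\subseteq V$, $\beta_{i,V'}(I)=\dim_k \mathrm{Tor}_i^{k[V]}(I,k)_{V'}$,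 the component in the $\mathbb Z^{V}$-multidegree that is the indicator vector of $V'$. The staircase cells of $D^{\mathrm{nonbip}}_X$ are its cells in positions of the form $(x_i,x_{i+1})$ (and similarly for $D^{\mathrm{nonbip}}_{X'}$, with respect to consecutive elements of $X'$). **Rectangular decomposition of $D^{\mathrm{bip}}_{X,Y}$** ($X\sqcup Y\ne\varnothing$, one of $X,Y$ possibly empty). The following is iterated, with $X=\{x_1<\dots<x_m\}$, $Y=\{y_1<\dots<y_n\}$ denoting the current row and column sets, until $X\sqcup Y$ is empty or a pedestal is found. The set of excess cells is initially empty. The top cell is the cell in position $(x_1,y_n)$, if $X,Y$ are both nonempty and that cell is present. Case 1: no top cell. Let $X'$ be the maximal initial segment of $X$ whose rows contain no cells of $D^{\mathrm{bip}}_{X,Y}$, and $Y'$ the maximal final segment of $Y$ whose columns contain no cells of $D^{\mathrm{bip}}_{X,Y}$ (then $X'\sqcup Y'\neq\varnothing$, but one of them may be empty). Call $D^{\mathrm{bip}}_{X',Y'}$ an empty rectangle of the decomposition. Replace $(X,Y)$ by $(X\setminus X',Y\setminus Y')$ and continue. Case 2: there is a top cell. Let $m'$ be maximal such that $(x_{m'},y_n)$ is a cell, and $n'$ minimal such that $(x_1,y_{n'})$ is a cell; put $X'=\{x_1,\dots,x_{m'}\}$, $Y'=\{y_{n'},\dots,y_n\}$. - Subcase 2a: $(x_{m'},y_{n'})$ is a cell. Then call $D^{\mathrm{bip}}_{X',Y'}$ a full rectangle of the decomposition; add all cells of $D^{\mathrm{bip}}_{X\setminus X',Y'}$ and of $D^{\mathrm{bip}}_{X',Y\setminus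 Y'}$ to the excess cells; replace $(X,Y)$ by $(X\setminus X',Y\setminus Y')$ and continue. - Subcase 2b: $(x_{m'},y_{n'})$ is not a cell. Then call $D^{\mathrm{bip}}_{X',Y'}$ the pedestal of the decomposition; add all cells of $D^{\mathrm{bip}}_{X\setminus X',Y'}$ and of $D^{\mathrm{bip}}_{X',Y\setminus Y'}$ to the excess cells; terminate. The rectangular decomposition of $D^{\mathrm{nonbip}}_X$ is produced by the same algorithm, viewing it as $D^{\mathrm{bip}}_{X,Y}$ with $Y=X$; the only difference is that if a pedestal occurs, it is viewed as a diagram in the shifted plane, so that certain of its cells are distinguished as staircase cells. $D^{\mathrm{bip}}_{X,Y}$ is spherical if its rectangular decomposition has only full rectangles and possibly some excess cells, but no empty rectangles and no pedestal. The rectangularity $\mathrm{rect}(E)$ of $E=D^{\mathrm{bip}}_{X,Y}$ or $E=D^{\mathrm{nonbip}}_X$ is the number of full rectangles plus the number of pedestals ($0$ or $1$) in its rectangular decomposition.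
   Formalization: In the second formula, "no empty rectangles" ignores empty rectangles whose nonempty row and column sets lie strictly below the diagonal; read literally the formula fails for D={(1,2)}, X={1,2}, where it gives 0 but β_{0,{1,2}}=1. *)

theory Defs
  imports
    "HOL-Algebra.Ideal"
    "HOL-Library.Poly_Mapping"
    "HOL-Library.Function_Algebras"
    "HOL-Library.Indicator_Function"
begin

section \<open>Shifted skew diagrams\<close>

definition shifted_skew_diagram :: "(nat \<times> nat) set \<Rightarrow> bool" where
  "shifted_skew_diagram D \<longleftrightarrow>
     (\<exists>(l::nat) (r::nat) (lam::nat \<Rightarrow> nat) (mu::nat \<Rightarrow> nat).
        r \<le> l \<and>
        (\<forall>i\<in>{1..l}. 0 < lam i) \<and> (\<forall>i\<in>{1..<l}. lam (Suc i) < lam i) \<and>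
        (\<forall>i\<in>{1..r}. 0 < mu i) \<and> (\<forall>i\<in>{1..<r}. mu (Suc i) < mu i) \<and>
        (\<forall>i>r. mu i = 0) \<and>
        (\<forall>i\<in>{1..l}. mu i < lam i) \<and>
        D = {(i, j). 1 \<le> i \<and> i \<le> l \<and> i + mu i + 1 \<le> j \<and> j \<le> i + lam i})"

text \<open>The diagram with row set \<open>X\<close> and column set \<open>Y\<close> is represented by the triple
  \<open>D\<close>, \<open>X\<close>, \<open>Y\<close> (empty rows and columns matter); its cells are the following.\<close>

definition cells :: "(nat \<times> nat) set \<Rightarrow> nat set \<Rightarrow> nat set \<Rightarrow> (nat \<times> nat) set" where
  "cells D X Y = D \<inter> (X \<times> Y)"

definition bip_edges :: "(nat \<times> nat) set \<Rightarrow> nat set \<Rightarrow> nat set \<Rightarrow> (nat + nat) set set" where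
  "bip_edges D X Y = {{Inl x, Inr y} | x y. (x, y) \<in> cells D X Y}"

definition nonbip_edges :: "(nat \<times> nat) set \<Rightarrow> nat set \<Rightarrow> nat set set" where
  "nonbip_edges D X = {{x, y} | x y. (x, y) \<in> cells D X X}"

definition staircase_cells :: "(nat \<times> nat) set \<Rightarrow> nat set \<Rightarrow> (nat \<times> nat) set" where
  "staircase_cells D X = {(x, y) \<in> cells D X X. x < y \<and> (\<forall>z\<in>X. \<not> (x < z \<and> z < y))}"


section \<open>Rectangular decomposition\<close>

datatype block =
    is_empty_rect: Empty_Rect (block_rows: "nat set") (block_cols: "nat set")
  | is_full_rect: Full_Rect (block_rows: "nat set") (block_cols: "nat set")
  | is_pedestal: Pedestal (block_rows: "nat set") (block_cols: "nat set")

text \<open>The result is the list of blocks, in order of construction, and the set of excess cells.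
  For a shifted skew diagram and finite \<open>X\<close>, \<open>Y\<close> the two early exits other than
  \<open>X = {} \<and> Y = {}\<close> (an infinite index set; nothing to remove in the case without top cell)
  never occur; they only make the recursion total for arbitrary \<open>D\<close>.\<close>

function rect_decomp ::
  "(nat \<times> nat) set \<Rightarrow> nat set \<Rightarrow> nat set \<Rightarrow> block list \<times> (nat \<times> nat) set" where
  "rect_decomp D X Y =
    (if infinite X \<or> infinite Y \<or> (X = {} \<and> Y = {}) then ([], {})
     else if X \<noteq> {} \<and> Y \<noteq> {} \<and> (Min X, Max Y) \<in> D then
       let m' = Max {x\<in>X. (x, Max Y) \<in> D};
           n' = Min {y\<in>Y. (Min X, y) \<in> D};
           X' = {x\<in>X. x \<le> m'};
           Y' = {y\<in>Y. n' \<le> y};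
           ex = cells D (X - X') Y' \<union> cells D X' (Y - Y')
       in if (m', n') \<in> D
          then let R = rect_decomp D (X - X') (Y - Y')
               in (Full_Rect X' Y' # fst R, ex \<union> snd R)
          else ([Pedestal X' Y'], ex)
     else
       let X' = {x\<in>X. cells D {z\<in>X. z \<le> x} Y = {}};
           Y' = {y\<in>Y. cells D X {z\<in>Y. y \<le> z} = {}}
       in if X' = {} \<and> Y' = {} then ([], {})
          else let R = rect_decomp D (X - X') (Y - Y')
               in (Empty_Rect X' Y' # fst R, snd R))"
  by pat_completeness auto
termination
proof (relation "measure (\<lambda>(D, X, Y). card X + card Y)", goal_cases)
  case 1
  show ?case by simp
next
  case (2 D X Y m' n' X' Y' ex)
  then have fin: "finite X" "finite Y" and ne: "X \<noteq> {}" and top: "(Min X, Max Y) \<in> D"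
    by auto
  have "Min X \<in> {x\<in>X. (x, Max Y) \<in> D}" using fin ne top by simp
  then have "Min X \<le> m'" unfolding 2 using fin by (intro Max_ge) auto
  then have "Min X \<in> X'" using 2 fin ne by simp
  then have "X - X' \<subset> X" using fin ne Min_in[of X] by blast
  then have "card (X - X') < card X" using fin by (intro psubset_card_mono)
  moreover have "card (Y - Y') \<le> card Y" using fin by (intro card_mono) auto
  ultimately show ?case by simp
next
  case (3 D X Y X' Y')
  then have fin: "finite X" "finite Y" by auto
  have sub: "X' \<subseteq> X" "Y' \<subseteq> Y" unfolding 3 by auto
  have le: "card (X - X') \<le> card X" "card (Y - Y') \<le> card Y"
    using fin by (auto intro: card_mono)
  show ?case
  proof (cases "X' = {}")
    case True
    then have "Y - Y' \<subset> Y" using 3 sub by blast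
    then have "card (Y - Y') < card Y" using fin by (intro psubset_card_mono)
    then show ?thesis using le by simp
  next
    case False
    then have "X - X' \<subset> X" using sub by blast
    then have "card (X - X') < card X" using fin by (intro psubset_card_mono)
    then show ?thesis using le by simp
  qed
qed

declare rect_decomp.simps [simp del]

definition blocks :: "(nat \<times> nat) set \<Rightarrow> nat set \<Rightarrow> nat set \<Rightarrow> block set" where
  "blocks D X Y = set (fst (rect_decomp D X Y))"

definition excess_cells :: "(nat \<times> nat) set \<Rightarrow> nat set \<Rightarrow> nat set \<Rightarrow> (nat \<times> nat) set" where
  "excess_cells D X Y = snd (rect_decomp D X Y)"

definition rect :: "(nat \<times> nat) set \<Rightarrow> nat set \<Rightarrow> nat set \<Rightarrow> nat" where
  "rect D X Y =
     length (filter (\<lambda>b. is_full_rect b \<or> is_pedestal b) (fst (rect_decomp D X Y)))"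

definition spherical :: "(nat \<times> nat) set \<Rightarrow> nat set \<Rightarrow> nat set \<Rightarrow> bool" where
  "spherical D X Y \<longleftrightarrow> (\<forall>b\<in>blocks D X Y. is_full_rect b)"

text \<open>The decomposition of the non-bipartite diagram on \<open>X\<close> is \<open>rect_decomp D X X\<close>, viewed
  in the shifted plane.  A block of row and column sets \<open>A\<close>, \<open>B\<close> lying strictly below the
  diagonal has no positions in the shifted plane and is not a rectangle there.  Such a block can
  only arise at the end, once the earlier blocks have used up all vertices: for \<open>X = {1, 2}\<close>
  and the single cell \<open>(1, 2)\<close>, the full rectangle \<open>{1} \<times> {2}\<close> leaves row \<open>2\<close> and
  column \<open>1\<close>.  If it counted as an empty rectangle, the Betti number formula would already fail
  for this graph, which is a single edge.\<close>

definition strictly_below_diagonal :: "nat set \<Rightarrow> nat set \<Rightarrow> bool" where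
  "strictly_below_diagonal A B \<longleftrightarrow> A \<noteq> {} \<and> B \<noteq> {} \<and> (\<forall>a\<in>A. \<forall>b\<in>B. b < a)"

definition nonbip_no_empty_rectangles :: "(nat \<times> nat) set \<Rightarrow> nat set \<Rightarrow> bool" where
  "nonbip_no_empty_rectangles D X \<longleftrightarrow>
     (\<forall>b\<in>blocks D X X. is_empty_rect b \<longrightarrow>
        strictly_below_diagonal (block_rows b) (block_cols b))"


section \<open>Polynomial rings and edge ideals\<close>

type_synonym ('v, 'k) mpoly = "('v \<Rightarrow>\<^sub>0 nat) \<Rightarrow>\<^sub>0 'k"

definition mpoly_ring :: "'v set \<Rightarrow> ('v, 'k::field) mpoly ring" where
  "mpoly_ring V =
     \<lparr>carrier = {p. \<forall>m\<in>Poly_Mapping.keys p. Poly_Mapping.keys m \<subseteq> V},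
      monoid.mult = (*), one = 1, zero = 0, add = (+)\<rparr>"

definition var :: "'v \<Rightarrow> ('v, 'k::field) mpoly" where
  "var v = Poly_Mapping.single (Poly_Mapping.single v 1) 1"

definition edge_ideal :: "'v set \<Rightarrow> 'v set set \<Rightarrow> ('v, 'k::field) mpoly set" where
  "edge_ideal V E = Idl\<^bsub>mpoly_ring V\<^esub> {var u * var v | u v. {u, v} \<in> E}"

definition homogeneous :: "('v \<Rightarrow> int) \<Rightarrow> ('v, 'k::field) mpoly \<Rightarrow> bool" where
  "homogeneous \<alpha> p \<longleftrightarrow> (\<forall>m\<in>Poly_Mapping.keys p. \<forall>v. int (Poly_Mapping.lookup m v) = \<alpha> v)"


section \<open>Multigraded free resolutions and Betti numbers\<close>

text \<open>With \<open>S = k[V]\<close>, the free module on a finite set \<open>B\<close> is represented by the functions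
  that take values in \<open>S\<close> and vanish outside \<open>B\<close>.  In an augmented complex
  \<open>\<dots> \<rightarrow> F\<^sub>1 \<rightarrow> F\<^sub>0 \<rightarrow> S\<close>, the module \<open>F\<^sub>i\<close> has the basis \<open>gens F i\<close>, whose element \<open>b\<close> sits in
  multidegree \<open>mdeg F i b\<close>; \<open>bd F i a b\<close> is the coefficient of \<open>a \<in> gens F i\<close> in the image of
  \<open>b \<in> gens F (Suc i)\<close>, and \<open>aug F b\<close> is the image of \<open>b \<in> gens F 0\<close>.\<close>

record (overloaded) ('b, 'v, 'k) free_complex =
  gens :: "nat \<Rightarrow> 'b set"
  mdeg :: "nat \<Rightarrow> 'b \<Rightarrow> 'v \<Rightarrow> int"
  bd :: "nat \<Rightarrow> 'b \<Rightarrow> 'b \<Rightarrow> ('v, 'k) mpoly"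
  aug :: "'b \<Rightarrow> ('v, 'k) mpoly"

definition free_module :: "'v set \<Rightarrow> 'b set \<Rightarrow> ('b \<Rightarrow> ('v, 'k::field) mpoly) set" where
  "free_module V B = {x. (\<forall>b\<in>B. x b \<in> carrier (mpoly_ring V)) \<and> (\<forall>b. b \<notin> B \<longrightarrow> x b = 0)}"

definition apply_matrix ::
  "'b set \<Rightarrow> 'b set \<Rightarrow> ('b \<Rightarrow> 'b \<Rightarrow> 'r::comm_ring_1) \<Rightarrow> ('b \<Rightarrow> 'r) \<Rightarrow> 'b \<Rightarrow> 'r" where
  "apply_matrix A B M x = (\<lambda>a. if a \<in> A then (\<Sum>b\<in>B. M a b * x b) else 0)"

definition free_bd ::
  "('b, 'v, 'k::field) free_complex \<Rightarrow> nat \<Rightarrow> ('b \<Rightarrow> ('v, 'k) mpoly) \<Rightarrow> 'b \<Rightarrow> ('v, 'k) mpoly" where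
  "free_bd F i = apply_matrix (gens F i) (gens F (Suc i)) (bd F i)"

definition free_aug ::
  "('b, 'v, 'k::field) free_complex \<Rightarrow> ('b \<Rightarrow> ('v, 'k) mpoly) \<Rightarrow> ('v, 'k) mpoly" where
  "free_aug F x = (\<Sum>b\<in>gens F 0. aug F b * x b)"

definition graded_free_resolution ::
  "'v set \<Rightarrow> ('v, 'k::field) mpoly set \<Rightarrow> ('b, 'v, 'k) free_complex \<Rightarrow> bool" where
  "graded_free_resolution V I F \<longleftrightarrow>
     (\<forall>i. finite (gens F i)) \<and>
     (\<forall>i. \<forall>b\<in>gens F i. \<forall>v. v \<notin> V \<longrightarrow> mdeg F i b v = 0) \<and>
     (\<forall>b\<in>gens F 0. aug F b \<in> carrier (mpoly_ring V) \<and> homogeneous (mdeg F 0 b) (aug F b)) \<and>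
     (\<forall>i. \<forall>a\<in>gens F i. \<forall>b\<in>gens F (Suc i).
        bd F i a b \<in> carrier (mpoly_ring V) \<and>
        homogeneous (\<lambda>v. mdeg F (Suc i) b v - mdeg F i a v) (bd F i a b)) \<and>
     free_aug F ` free_module V (gens F 0) = I \<and>
     {x \<in> free_module V (gens F 0). free_aug F x = 0} =
       free_bd F 0 ` free_module V (gens F 1) \<and>
     (\<forall>i. {x \<in> free_module V (gens F (Suc i)). free_bd F i x = 0} =
        free_bd F (Suc i) ` free_module V (gens F (Suc (Suc i))))"

text \<open>The complex \<open>F \<otimes>\<^sub>S k\<close>, where \<open>k = S/(v | v \<in> V)\<close>: tensoring replaces \<open>S\<close> by \<open>k\<close>
  in each free module and each matrix entry by its constant coefficient.  Multidegree \<open>\<alpha>\<close> of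
  \<open>F\<^sub>i \<otimes>\<^sub>S k\<close> has as basis the basis elements of \<open>F\<^sub>i\<close> of multidegree \<open>\<alpha>\<close>.\<close>

definition tensor_chains ::
  "('b, 'v, 'k::field) free_complex \<Rightarrow> nat \<Rightarrow> ('v \<Rightarrow> int) \<Rightarrow> ('b \<Rightarrow> 'k) set" where
  "tensor_chains F i \<alpha> = {x. \<forall>b. x b \<noteq> 0 \<longrightarrow> b \<in> gens F i \<and> mdeg F i b = \<alpha>}"

definition tensor_bd ::
  "('b, 'v, 'k::field) free_complex \<Rightarrow> nat \<Rightarrow> ('b \<Rightarrow> 'k) \<Rightarrow> 'b \<Rightarrow> 'k" where
  "tensor_bd F i = apply_matrix (gens F i) (gens F (Suc i)) (\<lambda>a b. Poly_Mapping.lookup (bd F i a b) 0)"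

definition tensor_cycles ::
  "('b, 'v, 'k::field) free_complex \<Rightarrow> nat \<Rightarrow> ('v \<Rightarrow> int) \<Rightarrow> ('b \<Rightarrow> 'k) set" where
  "tensor_cycles F i \<alpha> =
     {x \<in> tensor_chains F i \<alpha>. case i of 0 \<Rightarrow> True | Suc j \<Rightarrow> tensor_bd F j x = 0}"

definition tensor_boundaries ::
  "('b, 'v, 'k::field) free_complex \<Rightarrow> nat \<Rightarrow> ('v \<Rightarrow> int) \<Rightarrow> ('b \<Rightarrow> 'k) set" where
  "tensor_boundaries F i \<alpha> = tensor_bd F i ` tensor_chains F (Suc i) \<alpha>"

definition fun_dim :: "('b \<Rightarrow> 'k::field) set \<Rightarrow> nat" where
  "fun_dim = vector_space.dim (\<lambda>c x b. c * x b)"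

text \<open>The dimension of \<open>H\<^sub>i(F \<otimes>\<^sub>S k)\<^sub>\<alpha>\<close>; all spaces involved are finite-dimensional, and
  boundaries are cycles.\<close>

definition tor_dim ::
  "('b, 'v, 'k::field) free_complex \<Rightarrow> nat \<Rightarrow> ('v \<Rightarrow> int) \<Rightarrow> nat" where
  "tor_dim F i \<alpha> = fun_dim (tensor_cycles F i \<alpha>) - fun_dim (tensor_boundaries F i \<alpha>)"

text \<open>\<open>dim Tor\<^sub>i(I, k)\<^sub>\<alpha>\<close> over \<open>k[V]\<close>, computed from any multigraded resolution of \<open>I\<close> by free
  modules of finite rank.  Bases indexed by natural numbers are no restriction.\<close>

definition betti :: "'v set \<Rightarrow> ('v, 'k::field) mpoly set \<Rightarrow> nat \<Rightarrow> ('v \<Rightarrow> int) \<Rightarrow> nat" where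
  "betti V I i \<alpha> =
     (THE n. \<exists>F :: (nat, 'v, 'k) free_complex.
        graded_free_resolution V I F \<and> n = tor_dim F i \<alpha>)"

end

theory Submission
  imports Defs "HOL-Library.Nat_Bijection"
begin

text \<open>For an arbitrary resolution \<open>F\<close> of an edge ideal, the parts of the augmented complex
  \<open>F \<rightarrow> S\<close> in which prescribed exponents are fixed and the others bounded fit into short exact
  sequences, one for each vertex.  If all exponents are merely bounded by a vertex set \<open>T\<close>, the
  part has homology \<open>k\<close> in degree 0 if \<open>T\<close> is independent and is acyclic otherwise.  The long
  exact sequences therefore give \<open>dim Tor\<close> directly from \<open>F\<close>, without passing through
  simplicial complexes or a comparison of resolutions, and yield the usual reductions: isolated vertices
  make the groups vanish, a vertex whose neighbourhood contains that of another one may be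
  deleted, and an isolated edge shifts the degree.  A full rectangle of the decomposition folds
  to an isolated edge; a pedestal folds to a graph with an isolated vertex in the bipartite case
  and to a complete graph in the nonbipartite case.\<close>

section \<open>Ranks and homology of finite complexes of vector spaces\<close>

text \<open>\<open>betti\<close> is a definite description: it needs one resolution and the same
  value for all of them. As the computation starts from an arbitrary \<open>F\<close>, the second
  point comes for free, and for the first any resolution will do, minimal or not.

  Fixing the exponents at \<open>S\<close> means dividing the complex by the variables in
  \<open>S\<close>, so the exact sequence of a vertex comes from multiplication by its variable.
  With no exponent fixed, exactness of \<open>F\<close> gives the homology; with all of them fixed,
  the homology is Tor. Only dimensions are tracked: the maps of the long exact sequences survive as
  ranks, and an isomorphism is always deduced from the vanishing of a third term.

  The obstacle in the nonbipartite case is that the decomposition treats rows and columns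
  separately. A full rectangle with rows \<open>P\<close> and columns \<open>Q\<close> leaves the
  rows \<open>Q\<close> and the columns \<open>P\<close> behind, although these vertices have left
  the graph. The induction therefore has to carry rows and columns of used vertices along, and at
  its end a block of such rows and columns remains.\<close>

interpretation fun_space: vector_space "\<lambda>(c::'k::field) (x::'b \<Rightarrow> 'k) b. c * x b"
  by unfold_locales (auto simp: fun_eq_iff algebra_simps)

interpretation fun_space_pair: vector_space_pair
  "\<lambda>(c::'k::field) (x::'b \<Rightarrow> 'k) b. c * x b" "\<lambda>(c::'k::field) (x::'b \<Rightarrow> 'k) b. c * x b"
  by unfold_locales

abbreviation fun_subspace :: "('b \<Rightarrow> 'k::field) set \<Rightarrow> bool" where
  "fun_subspace \<equiv> module.subspace (\<lambda>c x b. c * x b)"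

abbreviation fun_linear :: "(('b \<Rightarrow> 'k::field) \<Rightarrow> 'b \<Rightarrow> 'k) \<Rightarrow> bool" where
  "fun_linear \<equiv> Vector_Spaces.linear (\<lambda>c x b. c * x b) (\<lambda>c x b. c * x b)"

definition supported :: "'b set \<Rightarrow> ('b \<Rightarrow> 'k::zero) set" where
  "supported N = {x. \<forall>b. x b \<noteq> 0 \<longrightarrow> b \<in> N}"

lemma supportedD: "x \<in> supported N \<Longrightarrow> b \<notin> N \<Longrightarrow> x b = 0"
  by (auto simp: supported_def)

lemma fun_linearI:
  assumes "\<And>x y. f (x + y) = f x + f y" "\<And>c x. f (\<lambda>b. c * x b) = (\<lambda>b. c * f x b)"
  shows "fun_linear f"
  unfolding Vector_Spaces.linear_iff
  using fun_space.vector_space_axioms assms by (intro conjI allI) assumption+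

lemma fun_subspace_supported: "fun_subspace (supported N :: ('b \<Rightarrow> 'k::field) set)"
  by (rule fun_space.subspaceI; force simp: supported_def)

definition unit_fun :: "'b \<Rightarrow> 'b \<Rightarrow> 'k::field" where
  "unit_fun b = (\<lambda>c. if c = b then 1 else 0)"

lemma sum_fun_apply: "(sum f A :: 'b \<Rightarrow> 'k::comm_monoid_add) x = (\<Sum>a\<in>A. f a x)"
  by (induction A rule: infinite_finite_induct) auto

lemma supported_expand:
  assumes "finite N" "x \<in> supported N"
  shows "x = (\<Sum>b\<in>N. (\<lambda>c. x b * (unit_fun b c :: 'k::field)))"
proof
  fix c
  have "(\<Sum>b\<in>N. x b * (unit_fun b c :: 'k)) = (\<Sum>b\<in>N. if c = b then x b else 0)"
    by (intro sum.cong) (auto simp: unit_fun_def)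
  also have "\<dots> = x c" using assms supportedD[OF assms(2), of c] by (simp add: sum.delta')
  finally show "x c = (\<Sum>b\<in>N. (\<lambda>c. x b * (unit_fun b c :: 'k))) c" by (simp add: sum_fun_apply)
qed

lemma supported_subset_span:
  assumes "finite N"
  shows "supported N \<subseteq> fun_space.span (unit_fun ` N :: ('b \<Rightarrow> 'k::field) set)"
proof
  fix x :: "'b \<Rightarrow> 'k" assume x: "x \<in> supported N"
  have "(\<Sum>b\<in>N. (\<lambda>c. x b * (unit_fun b c :: 'k))) \<in> fun_space.span (unit_fun ` N)"
    by (intro fun_space.span_sum fun_space.span_scale fun_space.span_base) auto
  then show "x \<in> fun_space.span (unit_fun ` N)" using supported_expand[OF assms x] by simp
qed

lemma independent_unit_fun:
  "fun_space.independent (unit_fun ` N :: ('b \<Rightarrow> 'k::field) set)"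
proof (clarsimp simp: fun_space.dependent_def)
  fix b assume b: "b \<in> N"
    and sp: "unit_fun b \<in> fun_space.span (unit_fun ` N - {unit_fun b :: 'b \<Rightarrow> 'k})"
  have "fun_space.span (unit_fun ` N - {unit_fun b :: 'b \<Rightarrow> 'k}) \<subseteq> {x. x b = 0}"
    by (rule fun_space.span_minimal) (auto simp: fun_space.subspace_def unit_fun_def)
  then show False using sp by (auto simp: unit_fun_def)
qed

lemma inj_unit_fun: "inj (unit_fun :: 'b \<Rightarrow> 'b \<Rightarrow> 'k::field)"
proof (rule injI)
  fix b c :: 'b assume "unit_fun b = (unit_fun c :: 'b \<Rightarrow> 'k)"
  then have "unit_fun b b = (unit_fun c b :: 'k)" by simp
  then show "b = c" by (simp add: unit_fun_def split: if_splits)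
qed

lemma fun_dim_supported:
  assumes "finite N"
  shows "fun_dim (supported N :: ('b \<Rightarrow> 'k::field) set) = card N"
  unfolding fun_dim_def
proof (rule fun_space.dim_unique)
  show "unit_fun ` N \<subseteq> (supported N :: ('b \<Rightarrow> 'k) set)"
    by (auto simp: supported_def unit_fun_def split: if_splits)
  show "card (unit_fun ` N :: ('b \<Rightarrow> 'k) set) = card N"
    by (intro card_image inj_on_subset[OF inj_unit_fun]) auto
qed (use assms supported_subset_span independent_unit_fun in auto)

lemma finite_independent_supported:
  assumes "finite N" "B \<subseteq> supported N" "fun_space.independent (B :: ('b \<Rightarrow> 'k::field) set)"
  shows "finite B"
proof -
  have "B \<subseteq> fun_space.span (unit_fun ` N)"
    using supported_subset_span[OF assms(1)] assms(2) by (rule order_trans[rotated])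
  then show ?thesis
    using fun_space.independent_span_bound[of "unit_fun ` N" B] assms by simp
qed

lemma fun_dim_mono:
  fixes U U' :: "('b \<Rightarrow> 'k::field) set"
  assumes "finite N" "U \<subseteq> U'" "U' \<subseteq> supported N"
  shows "fun_dim U \<le> fun_dim U'"
proof -
  obtain B where B: "B \<subseteq> U'" "fun_space.independent B" "U' \<subseteq> fun_space.span B"
      "card B = fun_space.dim U'"
    by (rule fun_space.basis_exists)
  have "finite B" using finite_independent_supported[of N B] B assms by auto
  then show ?thesis
    using fun_space.dim_le_card[of U B] B assms by (auto simp: fun_dim_def)
qed

text \<open>Rank-nullity. The ambient function space may have infinite dimension; the finite set
  \<open>N\<close> keeps the bases involved finite.\<close>

lemma fun_dim_kernel_image:
  fixes f :: "('b \<Rightarrow> 'k::field) \<Rightarrow> 'b \<Rightarrow> 'k"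
  assumes f: "fun_linear f" and N: "finite N" and U: "fun_subspace U" "U \<subseteq> supported N"
  shows "fun_dim U = fun_dim {x \<in> U. f x = 0} + fun_dim (f ` U)"
proof -
  let ?K = "{x \<in> U. f x = 0}"
  have subK: "fun_subspace ?K"
    using fun_space.subspace_inter[OF U(1) fun_space_pair.linear_subspace_kernel[OF f]]
    by (simp add: Int_def)
  obtain B where B: "B \<subseteq> ?K" "fun_space.independent B" "?K \<subseteq> fun_space.span B"
      "card B = fun_space.dim ?K"
    by (rule fun_space.basis_exists)
  obtain C where C: "B \<subseteq> C" "C \<subseteq> U" "fun_space.independent C" "U \<subseteq> fun_space.span C"
    by (rule fun_space.maximal_independent_subset_extend[of B U]) (use B in auto)
  have fin: "finite C" using finite_independent_supported[of N C] C U N by auto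
  have inj: "inj_on f (fun_space.span (C - B))"
    unfolding fun_space_pair.linear_inj_on_iff_eq_0[OF f fun_space.subspace_span]
  proof (intro ballI impI)
    fix x assume x: "x \<in> fun_space.span (C - B)" "f x = 0"
    have "x \<in> U" using x C U fun_space.span_minimal[of "C - B" U] by auto
    then have xB: "x \<in> fun_space.span B" using x B by auto
    \<comment> \<open>The coordinates of \<open>x\<close> over \<open>C\<close> are supported in
      \<open>B\<close> and also in \<open>C - B\<close>, so all of them vanish.\<close>
    have "fun_space.representation C x = fun_space.representation B x"
      "fun_space.representation C x = fun_space.representation (C - B) x"
      using C xB x by (auto intro!: fun_space.representation_extend)
    then have "fun_space.representation B x b = 0" for b
      using fun_space.representation_ne_zero[of B x b]
        fun_space.representation_ne_zero[of "C - B" x b] by fastforce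
    then show "x = 0"
      using fun_space.sum_nonzero_representation_eq[OF B(2) xB] by simp
  qed
  have "fun_dim (f ` U) = card (f ` (C - B))"
    unfolding fun_dim_def
  proof (rule fun_space.dim_unique)
    show "f ` (C - B) \<subseteq> f ` U" using C by auto
    show "fun_space.independent (f ` (C - B))"
      using fun_space_pair.linear_independent_injective_image[OF f] inj C(3)
        fun_space.independent_mono[of C "C - B"] by blast
    show "f ` U \<subseteq> fun_space.span (f ` (C - B))"
    proof -
      have "f ` C \<subseteq> fun_space.span (f ` (C - B))"
      proof
        fix y assume "y \<in> f ` C"
        then obtain c where c: "c \<in> C" "y = f c" by auto
        show "y \<in> fun_space.span (f ` (C - B))"
        proof (cases "c \<in> B")
          case True
          then have "y = 0" using B c by auto
          then show ?thesis by (simp add: fun_space.span_zero)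
        next
          case False
          then show ?thesis using c by (auto intro: fun_space.span_base)
        qed
      qed
      then have "fun_space.span (f ` C) \<subseteq> fun_space.span (f ` (C - B))"
        by (intro fun_space.span_minimal) auto
      then show ?thesis using fun_space_pair.linear_spans_image[OF f C(4)] by auto
    qed
  qed simp
  also have "\<dots> = card (C - B)"
    by (intro card_image inj_on_subset[OF inj] fun_space.span_superset)
  also have "\<dots> = card C - card B" using C fin by (intro card_Diff_subset finite_subset[of B C]) auto
  finally have "fun_dim (f ` U) = card C - card B" .
  moreover have "card C = fun_dim U"
    using C unfolding fun_dim_def by (intro fun_space.basis_card_eq_dim)
  moreover have "card B \<le> card C" using C fin by (intro card_mono)
  ultimately show ?thesis using B by (simp add: fun_dim_def)
qed


section \<open>Ranks of matrices with a zero block\<close>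

definition mat_rank :: "'b set \<Rightarrow> 'b set \<Rightarrow> ('b \<Rightarrow> 'b \<Rightarrow> 'k::field) \<Rightarrow> nat" where
  "mat_rank A B M = fun_dim (apply_matrix A B M ` supported B)"

lemma apply_matrix_supported: "apply_matrix A B M x \<in> supported A"
  by (auto simp: apply_matrix_def supported_def)

lemma fun_linear_apply_matrix: "fun_linear (apply_matrix A B (M :: 'b \<Rightarrow> 'b \<Rightarrow> 'k::field))"
  by (rule fun_linearI)
    (auto simp: apply_matrix_def fun_eq_iff sum.distrib algebra_simps sum_distrib_left)

lemma fun_subspace_apply_matrix:
  "fun_subspace (apply_matrix A B (M :: 'b \<Rightarrow> 'b \<Rightarrow> 'k::field) ` supported C)"
  by (rule fun_space_pair.linear_subspace_image[OF fun_linear_apply_matrix fun_subspace_supported])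

lemma card_eq_kernel_plus_mat_rank:
  assumes "finite B"
  shows "card B = fun_dim {x \<in> supported B. apply_matrix A B M x = 0} + mat_rank A B M"
  using fun_dim_kernel_image[OF fun_linear_apply_matrix[of A B M] assms fun_subspace_supported subset_refl]
  unfolding fun_dim_supported[OF assms] mat_rank_def .

definition restrict_fun :: "'b set \<Rightarrow> ('b \<Rightarrow> 'k::field) \<Rightarrow> 'b \<Rightarrow> 'k" where
  "restrict_fun C x = (\<lambda>b. if b \<in> C then x b else 0)"

lemma fun_linear_restrict_fun: "fun_linear (restrict_fun C)"
  by (rule fun_linearI) (auto simp: restrict_fun_def fun_eq_iff)

lemma restrict_fun_supported: "restrict_fun C x \<in> supported C"
  by (auto simp: restrict_fun_def supported_def)

lemma restrict_fun_image_supported: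
  fixes B :: "'b set"
  assumes "C \<subseteq> B"
  shows "restrict_fun C ` supported B = (supported C :: ('b \<Rightarrow> 'k::field) set)"
proof
  show "(supported C :: ('b \<Rightarrow> 'k) set) \<subseteq> restrict_fun C ` supported B"
  proof
    fix x :: "'b \<Rightarrow> 'k" assume x: "x \<in> supported C"
    then have "x = restrict_fun C x" "x \<in> supported B"
      using assms by (auto simp: restrict_fun_def supported_def fun_eq_iff)
    then show "x \<in> restrict_fun C ` supported B" by (rule image_eqI)
  qed
qed (use restrict_fun_supported in auto)

text \<open>One differential of an extension of complexes: index 1 is the source and index 0 the
  target, \<open>A\<close> is the subcomplex and \<open>C\<close> the quotient. The zero block says
  that the subcomplex is mapped into itself.\<close>

locale block_triangular =
  fixes A0 C0 A1 C1 :: "'b set" and M :: "'b \<Rightarrow> 'b \<Rightarrow> 'k::field"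
  assumes fin: "finite A0" "finite C0" "finite A1" "finite C1"
    and disj: "A0 \<inter> C0 = {}" "A1 \<inter> C1 = {}"
    and tri: "\<And>a b. a \<in> C0 \<Longrightarrow> b \<in> A1 \<Longrightarrow> M a b = 0"
begin

abbreviation "whole \<equiv> apply_matrix (A0 \<union> C0) (A1 \<union> C1) M"

lemma whole_sub: 
  assumes "x \<in> supported A1"
  shows "whole x = apply_matrix A0 A1 M x"
proof
  fix a
  have "(\<Sum>b\<in>A1 \<union> C1. M a b * x b) = (\<Sum>b\<in>A1. M a b * x b)"
    using assms disj fin by (intro sum.mono_neutral_right) (auto simp: supported_def)
  then show "whole x a = apply_matrix A0 A1 M x a"
    using tri by (auto simp: apply_matrix_def intro!: sum.neutral)
qed

lemma restrict_whole:
  "restrict_fun C0 (whole x) = apply_matrix C0 C1 M (restrict_fun C1 x)"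
proof
  fix a
  have "(\<Sum>b\<in>A1 \<union> C1. M a b * x b) = (\<Sum>b\<in>C1. M a b * x b)" if "a \<in> C0"
    using tri that disj fin by (intro sum.mono_neutral_right) auto
  then show "restrict_fun C0 (whole x) a = apply_matrix C0 C1 M (restrict_fun C1 x) a"
    by (auto simp: apply_matrix_def restrict_fun_def)
qed

text \<open>Rank-nullity for the projection of the image of \<open>whole\<close> to
  \<open>C0\<close>. The excess of the second summand over the rank of the block on \<open>A\<close>
  is the rank of the connecting map.\<close>

lemma rank_whole:
  "mat_rank (A0 \<union> C0) (A1 \<union> C1) M =
     mat_rank C0 C1 M + fun_dim (whole ` supported (A1 \<union> C1) \<inter> supported A0)"
proof -
  let ?I = "whole ` supported (A1 \<union> C1)"
  have 1: "{y \<in> ?I. restrict_fun C0 y = 0} = ?I \<inter> supported A0"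
  proof -
    have "restrict_fun C0 y = 0 \<longleftrightarrow> y \<in> supported A0" if "y \<in> supported (A0 \<union> C0)" for y :: "'b \<Rightarrow> 'k"
      using that disj unfolding restrict_fun_def supported_def by (auto simp: fun_eq_iff)
    then show ?thesis using apply_matrix_supported[of "A0 \<union> C0" "A1 \<union> C1" M] by auto
  qed
  have "restrict_fun C0 ` ?I = apply_matrix C0 C1 M ` (restrict_fun C1 ` supported (A1 \<union> C1))"
    by (simp add: image_image restrict_whole)
  then have 2: "restrict_fun C0 ` ?I = apply_matrix C0 C1 M ` supported C1"
    by (simp add: restrict_fun_image_supported)
  have "fun_dim ?I = fun_dim {y \<in> ?I. restrict_fun C0 y = 0} + fun_dim (restrict_fun C0 ` ?I)"
    using fin apply_matrix_supported
    by (intro fun_dim_kernel_image[of _ "A0 \<union> C0"] fun_linear_restrict_fun fun_subspace_apply_matrix)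
      auto
  then show ?thesis unfolding 1 2 mat_rank_def by simp
qed

lemma rank_sum_le: "mat_rank A0 A1 M + mat_rank C0 C1 M \<le> mat_rank (A0 \<union> C0) (A1 \<union> C1) M"
proof -
  have "mat_rank A0 A1 M \<le> fun_dim (whole ` supported (A1 \<union> C1) \<inter> supported A0)"
    unfolding mat_rank_def
  proof (rule fun_dim_mono[OF fin(1)])
    show "apply_matrix A0 A1 M ` supported A1 \<subseteq> whole ` supported (A1 \<union> C1) \<inter> supported A0"
    proof (rule image_subsetI)
      fix x :: "'b \<Rightarrow> 'k" assume x: "x \<in> supported A1"
      then have "x \<in> supported (A1 \<union> C1)" by (auto simp: supported_def)
      then show "apply_matrix A0 A1 M x \<in> whole ` supported (A1 \<union> C1) \<inter> supported A0"
        using whole_sub[OF x, symmetric] apply_matrix_supported[of A0 A1 M x] by auto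
    qed
  qed auto
  then show ?thesis using rank_whole by simp
qed

text \<open>Boundaries of the whole complex that lie in the subcomplex are cycles of it;
  \<open>B\<close> is its basis one degree lower. This bounds the connecting map by the homology of
  the subcomplex.\<close>

lemma rank_le_sub_cycles:
  assumes "\<And>y. y \<in> whole ` supported (A1 \<union> C1) \<Longrightarrow> y \<in> supported A0 \<Longrightarrow> apply_matrix B A0 N y = 0"
  shows "mat_rank (A0 \<union> C0) (A1 \<union> C1) M + mat_rank B A0 N \<le> mat_rank C0 C1 M + card A0"
proof -
  have "fun_dim (whole ` supported (A1 \<union> C1) \<inter> supported A0)
      \<le> fun_dim {y \<in> supported A0. apply_matrix B A0 N y = 0}"
    using assms by (intro fun_dim_mono[OF fin(1)]) auto
  then show ?thesis
    using rank_whole card_eq_kernel_plus_mat_rank[OF fin(1), of B N] by simp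
qed

text \<open>Boundaries of the quotient lift to cycles of the whole complex; \<open>C2\<close> is the
  basis of the quotient one degree higher. Rank-nullity for the projection of the cycles then bounds
  the connecting map by the homology of the quotient.\<close>

lemma rank_le_quotient_cycles:
  assumes C2: "\<And>x. x \<in> supported C2 \<Longrightarrow>
    \<exists>y\<in>supported (A1 \<union> C1). whole y = 0 \<and> restrict_fun C1 y = apply_matrix C1 C2 N x"
  shows "mat_rank (A0 \<union> C0) (A1 \<union> C1) M + mat_rank C1 C2 N \<le> mat_rank A0 A1 M + card C1"
proof -
  let ?Z = "{x \<in> supported (A1 \<union> C1). whole x = 0}"
  have finG: "finite (A1 \<union> C1)" using fin by auto
  have subZ: "fun_subspace ?Z"
    using fun_space.subspace_inter[OF fun_subspace_supported[of "A1 \<union> C1"]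
        fun_space_pair.linear_subspace_kernel[OF fun_linear_apply_matrix[of "A0 \<union> C0" "A1 \<union> C1" M]]]
    by (simp add: Int_def)
  have 1: "{x \<in> ?Z. restrict_fun C1 x = 0} = {x \<in> supported A1. apply_matrix A0 A1 M x = 0}"
  proof -
    have "(x \<in> supported (A1 \<union> C1) \<and> restrict_fun C1 x = 0) \<longleftrightarrow> x \<in> supported A1" for x :: "'b \<Rightarrow> 'k"
      using disj unfolding restrict_fun_def supported_def by (auto simp: fun_eq_iff)
    then show ?thesis using whole_sub by (smt (verit, best) Collect_cong mem_Collect_eq)
  qed
  have "mat_rank C1 C2 N \<le> fun_dim (restrict_fun C1 ` ?Z)"
    unfolding mat_rank_def
  proof (rule fun_dim_mono[OF fin(4)])
    show "apply_matrix C1 C2 N ` supported C2 \<subseteq> restrict_fun C1 ` ?Z"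
    proof (rule image_subsetI)
      fix x :: "'b \<Rightarrow> 'k" assume "x \<in> supported C2"
      then obtain y where "y \<in> ?Z" "restrict_fun C1 y = apply_matrix C1 C2 N x" using C2 by blast
      then show "apply_matrix C1 C2 N x \<in> restrict_fun C1 ` ?Z" by (intro image_eqI[of _ _ y]) simp_all
    qed
  qed (use restrict_fun_supported in auto)
  moreover have "fun_dim ?Z = fun_dim {x \<in> ?Z. restrict_fun C1 x = 0} + fun_dim (restrict_fun C1 ` ?Z)"
    by (rule fun_dim_kernel_image[OF fun_linear_restrict_fun finG subZ]) (rule Collect_restrict)
  moreover have "card (A1 \<union> C1) = fun_dim ?Z + mat_rank (A0 \<union> C0) (A1 \<union> C1) M"
    using finG by (rule card_eq_kernel_plus_mat_rank)
  moreover have "card (A1 \<union> C1) = card A1 + card C1"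
    using fin disj by (intro card_Un_disjoint)
  moreover have "card A1 = fun_dim {x \<in> supported A1. apply_matrix A0 A1 M x = 0} + mat_rank A0 A1 M"
    using fin by (intro card_eq_kernel_plus_mat_rank)
  ultimately show ?thesis unfolding 1 by simp
qed

end

section \<open>Homology dimensions and the long exact sequence\<close>

definition chain_complex :: "(nat \<Rightarrow> 'b set) \<Rightarrow> (nat \<Rightarrow> 'b \<Rightarrow> 'b \<Rightarrow> 'k::field) \<Rightarrow> bool" where
  "chain_complex G c \<longleftrightarrow> (\<forall>n. finite (G n)) \<and>
     (\<forall>n. \<forall>a\<in>G n. \<forall>b\<in>G (Suc (Suc n)). (\<Sum>e\<in>G (Suc n). c n a e * c (Suc n) e b) = 0)"

definition out_rank :: "(nat \<Rightarrow> 'b set) \<Rightarrow> (nat \<Rightarrow> 'b \<Rightarrow> 'b \<Rightarrow> 'k::field) \<Rightarrow> nat \<Rightarrow> nat" where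
  "out_rank G c n = (case n of 0 \<Rightarrow> 0 | Suc m \<Rightarrow> mat_rank (G m) (G n) (c m))"

definition homology_dim :: "(nat \<Rightarrow> 'b set) \<Rightarrow> (nat \<Rightarrow> 'b \<Rightarrow> 'b \<Rightarrow> 'k::field) \<Rightarrow> nat \<Rightarrow> nat" where
  "homology_dim G c n = card (G n) - out_rank G c n - out_rank G c (Suc n)"

lemma chain_complex_apply:
  assumes "chain_complex G c"
  shows "apply_matrix (G n) (G (Suc n)) (c n) (apply_matrix (G (Suc n)) (G (Suc (Suc n))) (c (Suc n)) x) = 0"
proof
  fix a
  let ?H = "G (Suc n)" and ?K = "G (Suc (Suc n))"
  have "(\<Sum>e\<in>?H. c n a e * (\<Sum>b\<in>?K. c (Suc n) e b * x b)) =
      (\<Sum>b\<in>?K. (\<Sum>e\<in>?H. c n a e * c (Suc n) e b) * x b)"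
    by (simp add: sum_distrib_left sum_distrib_right mult.assoc) (rule sum.swap)
  also have "\<dots> = 0" if "a \<in> G n"
    using assms that by (intro sum.neutral) (auto simp: chain_complex_def)
  finally show "apply_matrix (G n) ?H (c n) (apply_matrix ?H ?K (c (Suc n)) x) a = 0 a"
    by (auto simp: apply_matrix_def)
qed

text \<open>Boundaries are cycles. In this form it ensures that the subtractions of natural numbers
  in \<open>homology_dim\<close> do not truncate.\<close>

lemma out_rank_le:
  fixes c :: "nat \<Rightarrow> 'b \<Rightarrow> 'b \<Rightarrow> 'k::field"
  assumes "chain_complex G c"
  shows "out_rank G c n + out_rank G c (Suc n) \<le> card (G n)"
proof -
  have fin: "finite (G m)" for m using assms by (auto simp: chain_complex_def)
  show ?thesis
  proof (cases n)
    case 0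
    have "mat_rank (G 0) (G 1) (c 0) \<le> fun_dim (supported (G 0) :: ('b \<Rightarrow> 'k) set)"
      unfolding mat_rank_def
      by (rule fun_dim_mono[OF fin[of 0]]) (use apply_matrix_supported in blast, rule subset_refl)
    then show ?thesis using 0 fin by (simp add: out_rank_def fun_dim_supported)
  next
    case (Suc m)
    have "mat_rank (G n) (G (Suc n)) (c n)
        \<le> fun_dim {x \<in> supported (G n). apply_matrix (G m) (G n) (c m) x = 0}"
      unfolding mat_rank_def
    proof (rule fun_dim_mono[OF fin[of n]])
      show "apply_matrix (G n) (G (Suc n)) (c n) ` supported (G (Suc n))
          \<subseteq> {x \<in> supported (G n). apply_matrix (G m) (G n) (c m) x = 0}"
        using chain_complex_apply[OF assms, of m] apply_matrix_supported Suc by blast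
    qed (rule Collect_restrict)
    then show ?thesis
      using card_eq_kernel_plus_mat_rank[OF fin[of n], of "G m" "c m"] Suc
      by (simp add: out_rank_def)
  qed
qed

text \<open>Dimension form of the long exact homology sequence of \<open>0 \<rightarrow> A \<rightarrow> A \<union> C \<rightarrow> C \<rightarrow> 0\<close>:
  \<open>i\<close>, \<open>p\<close> and \<open>d\<close> are the ranks of the maps induced by inclusion and projection and of
  the connecting map.\<close>

lemma long_exact_sequence_dims:
  fixes c :: "nat \<Rightarrow> 'b \<Rightarrow> 'b \<Rightarrow> 'k::field"
  assumes cA: "chain_complex A c" and cC: "chain_complex C c"
    and cG: "chain_complex (\<lambda>n. A n \<union> C n) c"
    and disj: "\<And>n. A n \<inter> C n = {}"
    and tri: "\<And>n a b. a \<in> C n \<Longrightarrow> b \<in> A (Suc n) \<Longrightarrow> c n a b = 0"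
  shows "\<exists>i p d :: nat \<Rightarrow> nat. d 0 = 0 \<and> (\<forall>n. homology_dim A c n = i n + d (Suc n) \<and>
    homology_dim (\<lambda>n. A n \<union> C n) c n = i n + p n \<and> homology_dim C c n = p n + d n)"
proof -
  define G where "G = (\<lambda>n. A n \<union> C n)"
  have fin: "finite (A n)" "finite (C n)" for n
    using cA cC by (auto simp: chain_complex_def)
  interpret block_triangular "A n" "C n" "A (Suc n)" "C (Suc n)" "c n" for n
    using fin disj tri by unfold_locales auto
  \<comment> \<open>The rank of the connecting map from degree \<open>n\<close> of \<open>C\<close>
    to degree \<open>n - 1\<close> of \<open>A\<close>: what the block matrix has beyond its
    diagonal blocks. \<open>le0\<close> makes the subtraction exact; \<open>leA\<close> and
    \<open>leC\<close> bound this rank by the homology of the target and of the source.\<close>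
  define d where "d n = out_rank G c n - out_rank A c n - out_rank C c n" for n
  have le0: "out_rank A c n + out_rank C c n \<le> out_rank G c n" for n
    using rank_sum_le by (cases n) (auto simp: out_rank_def G_def)
  have leA: "out_rank G c (Suc n) + out_rank A c n \<le> out_rank C c (Suc n) + card (A n)" for n
  proof (cases n)
    case 0
    \<comment> \<open>Everything in degree 0 is a cycle; the zero map to the empty basis stands in
      for a differential there.\<close>
    have "out_rank G c (Suc 0) \<le> out_rank C c (Suc 0) + card (A 0)"
      using rank_le_sub_cycles[of 0 "{}" "\<lambda>_ _. 0"]
      by (simp add: out_rank_def G_def apply_matrix_def zero_fun_def)
    then show ?thesis using 0 by (simp add: out_rank_def)
  next
    case (Suc m)
    have "apply_matrix (A m) (A n) (c m) y = 0"
      if y: "y \<in> apply_matrix (G n) (G (Suc n)) (c n) ` supported (G (Suc n))" "y \<in> supported (A n)" for y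
    proof -
      have "apply_matrix (G m) (G n) (c m) y = 0"
        using y chain_complex_apply[OF cG[folded G_def], of m] Suc by auto
      then show ?thesis using whole_sub[of y m] y Suc by (simp add: G_def)
    qed
    then show ?thesis
      using rank_le_sub_cycles[of n "A m" "c m"] Suc by (simp add: out_rank_def G_def)
  qed
  have leC: "out_rank G c n + out_rank C c (Suc n) \<le> out_rank A c n + card (C n)" for n
  proof (cases n)
    case 0
    then show ?thesis using out_rank_le[OF cC, of 0] by (simp add: out_rank_def)
  next
    case (Suc m)
    have "\<exists>y\<in>supported (G n). apply_matrix (G m) (G n) (c m) y = 0 \<and>
        restrict_fun (C n) y = apply_matrix (C n) (C (Suc n)) (c n) x"
      if x: "x \<in> supported (C (Suc n))" for x
    proof (intro bexI conjI)
      have "restrict_fun (C (Suc n)) x = x"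
        using x by (auto simp: restrict_fun_def supported_def fun_eq_iff)
      then show "restrict_fun (C n) (apply_matrix (G n) (G (Suc n)) (c n) x) =
          apply_matrix (C n) (C (Suc n)) (c n) x"
        using restrict_whole[of n x] by (simp add: G_def)
    qed (use chain_complex_apply[OF cG[folded G_def], of m] Suc apply_matrix_supported in auto)
    then show ?thesis
      using rank_le_quotient_cycles[of "C (Suc n)" m "c n"] Suc by (simp add: out_rank_def G_def)
  qed
  have card: "card (G n) = card (A n) + card (C n)" for n
    using fin disj by (simp add: G_def card_Un_disjoint)
  have hA: "homology_dim A c n + out_rank A c n + out_rank A c (Suc n) = card (A n)"
    and hC: "homology_dim C c n + out_rank C c n + out_rank C c (Suc n) = card (C n)"
    and hG: "homology_dim G c n + out_rank G c n + out_rank G c (Suc n) = card (G n)" for n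
    using out_rank_le[OF cA, of n] out_rank_le[OF cC, of n] out_rank_le[OF cG[folded G_def], of n]
    by (simp_all add: homology_dim_def)
  have d: "d n + out_rank A c n + out_rank C c n = out_rank G c n" for n
    using le0[of n] by (simp add: d_def)
  have dA: "d (Suc n) \<le> homology_dim A c n" for n
    using leA[of n] hA[of n] d[of "Suc n"] by linarith
  have dC: "d n \<le> homology_dim C c n" for n
    using leC[of n] hC[of n] d[of n] by linarith
  have "homology_dim G c n = (homology_dim A c n - d (Suc n)) + (homology_dim C c n - d n)" for n
  proof -
    obtain x y where "homology_dim A c n = d (Suc n) + x" "homology_dim C c n = d n + y"
      using dA[of n] dC[of n] by (metis le_iff_add)
    then show ?thesis
      using hA[of n] hC[of n] hG[of n] card[of n] d[of n] d[of "Suc n"] by simp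
  qed
  moreover have "d 0 = 0" by (simp add: d_def out_rank_def)
  ultimately show ?thesis unfolding G_def using dA dC
    by (intro exI[of _ "\<lambda>n. homology_dim A c n - d (Suc n)"]
        exI[of _ "\<lambda>n. homology_dim C c n - d n"] exI[of _ d]) simp
qed

section \<open>Monomials and edge ideals\<close>

definition mon :: "('v \<Rightarrow> int) \<Rightarrow> ('v \<Rightarrow>\<^sub>0 nat)" where
  "mon \<delta> = Abs_poly_mapping (\<lambda>v. nat (\<delta> v))"

lemma lookup_mon:
  assumes "finite V" "\<And>v. v \<notin> V \<Longrightarrow> \<delta> v = 0"
  shows "Poly_Mapping.lookup (mon \<delta>) v = nat (\<delta> v)"
proof -
  have "{v. nat (\<delta> v) \<noteq> 0} \<subseteq> V" using assms(2) by fastforce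
  then show ?thesis using assms(1) by (simp add: mon_def finite_subset)
qed

lemma mpoly_eq_sum_single:
  "(p :: 'a \<Rightarrow>\<^sub>0 'b::comm_monoid_add) =
     (\<Sum>m\<in>Poly_Mapping.keys p. Poly_Mapping.single m (Poly_Mapping.lookup p m))"
  by (rule poly_mapping_eqI) (auto simp: lookup_sum lookup_single when_def in_keys_iff)

lemma lookup_single_mult:
  fixes p :: "('v \<Rightarrow>\<^sub>0 nat) \<Rightarrow>\<^sub>0 'k::comm_semiring_1"
  shows "Poly_Mapping.lookup (Poly_Mapping.single m c * p) k =
    (if \<forall>v. Poly_Mapping.lookup m v \<le> Poly_Mapping.lookup k v
     then c * Poly_Mapping.lookup p (k - m) else 0)"
proof -
  have eq: "m + l = k \<longleftrightarrow> (\<forall>v. Poly_Mapping.lookup m v \<le> Poly_Mapping.lookup k v) \<and> l = k - m" for l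
    unfolding poly_mapping_eq_iff fun_eq_iff lookup_add lookup_minus
    by (metis add_diff_cancel_left' le_add1 le_add_diff_inverse)
  have "Poly_Mapping.single m c * p =
      (\<Sum>l\<in>Poly_Mapping.keys p. Poly_Mapping.single (m + l) (c * Poly_Mapping.lookup p l))"
    by (subst mpoly_eq_sum_single[of p]) (simp add: sum_distrib_left mult_single)
  then have "Poly_Mapping.lookup (Poly_Mapping.single m c * p) k =
      (\<Sum>l\<in>Poly_Mapping.keys p. if m + l = k then c * Poly_Mapping.lookup p l else 0)"
    by (simp add: lookup_sum lookup_single when_def)
  also have "\<dots> = (if \<forall>v. Poly_Mapping.lookup m v \<le> Poly_Mapping.lookup k v
      then \<Sum>l\<in>Poly_Mapping.keys p. if l = k - m then c * Poly_Mapping.lookup p l else 0 else 0)"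
    unfolding eq by (auto intro!: sum.neutral)
  finally show ?thesis by (auto simp: in_keys_iff)
qed

lemma carrier_mpoly_ring:
  "carrier (mpoly_ring V) = {p. \<forall>m\<in>Poly_Mapping.keys p. Poly_Mapping.keys m \<subseteq> V}"
  by (simp add: mpoly_ring_def)

lemma keys_mult_subset_sum:
  "m \<in> Poly_Mapping.keys (p * q) \<Longrightarrow>
     \<exists>a\<in>Poly_Mapping.keys p. \<exists>b\<in>Poly_Mapping.keys q. m = a + (b :: 'v \<Rightarrow>\<^sub>0 nat)"
  using keys_mult[of p q] by blast

lemma keys_add_mpoly [simp]:
  "Poly_Mapping.keys (a + b :: 'v \<Rightarrow>\<^sub>0 nat) = Poly_Mapping.keys a \<union> Poly_Mapping.keys b"
  by (auto simp: in_keys_iff lookup_add)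

lemma carrier_mpoly_mult:
  "p \<in> carrier (mpoly_ring V) \<Longrightarrow> q \<in> carrier (mpoly_ring V) \<Longrightarrow>
     (p * q :: ('v, 'k::field) mpoly) \<in> carrier (mpoly_ring V)"
  unfolding carrier_mpoly_ring using keys_mult_subset_sum by fastforce

lemma carrier_mpoly_add:
  "p \<in> carrier (mpoly_ring V) \<Longrightarrow> q \<in> carrier (mpoly_ring V) \<Longrightarrow>
     (p + q :: ('v, 'k::field) mpoly) \<in> carrier (mpoly_ring V)"
  unfolding carrier_mpoly_ring using Poly_Mapping.keys_add[of p q] by blast

lemma carrier_mpoly_uminus:
  "p \<in> carrier (mpoly_ring V) \<Longrightarrow> (- p :: ('v, 'k::field) mpoly) \<in> carrier (mpoly_ring V)"
  unfolding carrier_mpoly_ring by (auto simp: in_keys_iff)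

lemma carrier_mpoly_sum:
  "(\<And>a. a \<in> A \<Longrightarrow> f a \<in> carrier (mpoly_ring V)) \<Longrightarrow>
     (sum f A :: ('v, 'k::field) mpoly) \<in> carrier (mpoly_ring V)"
proof (induction A rule: infinite_finite_induct)
  case (insert a A)
  then show ?case by (simp add: carrier_mpoly_add)
qed (simp_all add: carrier_mpoly_ring)

lemma mpoly_ring_simps [simp]:
  "x \<oplus>\<^bsub>mpoly_ring V\<^esub> y = x + y" "x \<otimes>\<^bsub>mpoly_ring V\<^esub> y = x * y"
  "\<zero>\<^bsub>mpoly_ring V\<^esub> = 0" "\<one>\<^bsub>mpoly_ring V\<^esub> = 1"
  by (simp_all add: mpoly_ring_def)

lemma zero_one_carrier_mpoly:
  "0 \<in> carrier (mpoly_ring V)" "1 \<in> carrier (mpoly_ring V)"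
  by (auto simp: carrier_mpoly_ring)

lemma cring_mpoly_ring: "cring (mpoly_ring V :: ('v, 'k::field) mpoly ring)"
proof (rule cringI)
  show "abelian_group (mpoly_ring V :: ('v, 'k) mpoly ring)"
  proof (rule abelian_groupI)
    fix x :: "('v, 'k) mpoly" assume "x \<in> carrier (mpoly_ring V)"
    then have "- x \<in> carrier (mpoly_ring V)" by (rule carrier_mpoly_uminus)
    then show "\<exists>y\<in>carrier (mpoly_ring V). y \<oplus>\<^bsub>mpoly_ring V\<^esub> x = \<zero>\<^bsub>mpoly_ring V\<^esub>"
      by (intro bexI[of _ "- x"]) simp_all
  qed (simp_all add: carrier_mpoly_add zero_one_carrier_mpoly algebra_simps)
  show "comm_monoid (mpoly_ring V :: ('v, 'k) mpoly ring)"
    by (rule comm_monoidI) (simp_all add: carrier_mpoly_mult zero_one_carrier_mpoly algebra_simps)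
qed (simp add: algebra_simps)

definition edge_monomial :: "'v set set \<Rightarrow> ('v \<Rightarrow>\<^sub>0 nat) \<Rightarrow> bool" where
  "edge_monomial E m \<longleftrightarrow> (\<exists>e\<in>E. e \<subseteq> Poly_Mapping.keys m)"

text \<open>Condition on edges needed to read \<open>u * v\<close> as a squarefree monomial.\<close>

definition graph_on :: "'v set \<Rightarrow> 'v set set \<Rightarrow> bool" where
  "graph_on V E \<longleftrightarrow> finite V \<and> (\<forall>e\<in>E. \<exists>u v. e = {u, v} \<and> u \<noteq> v \<and> u \<in> V \<and> v \<in> V)"

text \<open>A monomial ideal contains a polynomial exactly if it contains each of its monomials.
  Membership thus becomes a condition on supports, which is the form used below.\<close>

lemma edge_ideal_eq:
  assumes "graph_on V E"
  shows "edge_ideal V E =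
    {p :: ('v, 'k::field) mpoly. p \<in> carrier (mpoly_ring V) \<and> (\<forall>m\<in>Poly_Mapping.keys p. edge_monomial E m)}"
    (is "_ = ?J")
proof -
  let ?R = "mpoly_ring V :: ('v, 'k) mpoly ring"
  let ?S = "{var u * var v | u v. {u, v} \<in> E} :: ('v, 'k) mpoly set"
  interpret cring ?R by (rule cring_mpoly_ring)
  have var: "var u * var v = (Poly_Mapping.single (Poly_Mapping.single u 1 + Poly_Mapping.single v 1) 1 :: ('v, 'k) mpoly)"
    for u v by (simp add: var_def mult_single)
  have S: "?S \<subseteq> ?J"
  proof
    fix p assume "p \<in> ?S"
    then obtain u v where uv: "{u, v} \<in> E" and p: "p = var u * var v" by auto
    then have "u \<in> V" "v \<in> V" using assms unfolding graph_on_def by (metis doubleton_eq_iff)+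
    then show "p \<in> ?J"
      using uv unfolding p var carrier_mpoly_ring edge_monomial_def
      by (auto intro!: bexI[of _ "{u, v}"])
  qed
  have inv: "\<ominus>\<^bsub>?R\<^esub> p = - p" if "p \<in> carrier ?R" for p
    by (rule minus_equality) (use that carrier_mpoly_uminus in auto)
  have "ideal ?J ?R"
  proof (rule idealI)
    show "ring ?R" by unfold_locales
    show "subgroup ?J (add_monoid ?R)"
    proof (rule add.subgroupI)
      fix p q assume pq: "p \<in> ?J" "q \<in> ?J"
      show "\<ominus>\<^bsub>?R\<^esub> p \<in> ?J"
        using pq inv[of p] carrier_mpoly_uminus[of p V] by (auto simp: in_keys_iff)
      show "p \<oplus>\<^bsub>?R\<^esub> q \<in> ?J"
        using pq carrier_mpoly_add[of p V q] Poly_Mapping.keys_add[of p q] by auto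
    next
      have "0 \<in> ?J" by (simp add: carrier_mpoly_ring)
      then show "?J \<noteq> {}" by blast
    qed auto
  next
    fix p q assume p: "p \<in> ?J" and q: "q \<in> carrier ?R"
    have "p * q \<in> ?J"
    proof (intro CollectI conjI ballI)
      show "p * q \<in> carrier ?R" using p q by (auto intro: carrier_mpoly_mult)
      fix m assume "m \<in> Poly_Mapping.keys (p * q)"
      then obtain a b where "a \<in> Poly_Mapping.keys p" "m = a + b"
        using keys_mult_subset_sum by blast
      then have "edge_monomial E a" "Poly_Mapping.keys a \<subseteq> Poly_Mapping.keys m" using p by auto
      then show "edge_monomial E m" unfolding edge_monomial_def by (meson order_trans)
    qed
    then show "q \<otimes>\<^bsub>?R\<^esub> p \<in> ?J" "p \<otimes>\<^bsub>?R\<^esub> q \<in> ?J"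
      by (simp_all add: mult.commute)
  qed
  then have "edge_ideal V E \<subseteq> ?J"
    unfolding edge_ideal_def using S by (intro genideal_minimal)
  moreover have "p \<in> edge_ideal V E" if p: "p \<in> ?J" for p
  proof -
    have SR: "?S \<subseteq> carrier ?R" using S by auto
    interpret Id: ideal "edge_ideal V E" ?R
      unfolding edge_ideal_def using SR by (rule genideal_ideal)
    have "Poly_Mapping.single m c \<in> edge_ideal V E"
      if "edge_monomial E m" "Poly_Mapping.keys m \<subseteq> V" for m and c :: 'k
    proof -
      obtain u v where uv: "{u, v} \<in> E" "u \<noteq> v" "{u, v} \<subseteq> Poly_Mapping.keys m"
        using \<open>edge_monomial E m\<close> assms unfolding edge_monomial_def graph_on_def by metis
      define l where "l = Poly_Mapping.single u (1::nat) + Poly_Mapping.single v 1"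
      \<comment> \<open>Subtraction of exponents truncates; since \<open>u \<noteq> v\<close>, all
        exponents of \<open>l\<close> are at most 1, so \<open>l\<close> does divide
        \<open>m\<close>.\<close>
      have "l + (m - l) = m"
        using uv by (intro poly_mapping_eqI)
          (auto simp: l_def lookup_add lookup_minus lookup_single when_def in_keys_iff)
      then have "Poly_Mapping.single m c = Poly_Mapping.single (m - l) c * (var u * var v)"
        unfolding var l_def[symmetric] by (simp add: mult_single add.commute)
      moreover have "(var u * var v :: ('v, 'k) mpoly) \<in> edge_ideal V E"
        unfolding edge_ideal_def
        by (rule subsetD[OF genideal_self[OF SR]]) (intro CollectI exI[of _ u] exI[of _ v] conjI refl uv(1))
      moreover have "Poly_Mapping.single (m - l) c \<in> carrier ?R"
      proof -
        have "Poly_Mapping.keys (m - l) \<subseteq> Poly_Mapping.keys m"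
          by (auto simp: in_keys_iff lookup_minus)
        then show ?thesis using that(2) by (auto simp: carrier_mpoly_ring split: if_splits)
      qed
      ultimately show ?thesis
        using Id.I_l_closed[of "var u * var v" "Poly_Mapping.single (m - l) c"]
        by simp
    qed
    then have mem: "Poly_Mapping.single m (Poly_Mapping.lookup p m) \<in> edge_ideal V E"
      if "m \<in> Poly_Mapping.keys p" for m
      using p that by (auto simp: carrier_mpoly_ring)
    have "(\<Sum>m\<in>A. Poly_Mapping.single m (Poly_Mapping.lookup p m)) \<in> edge_ideal V E"
      if "A \<subseteq> Poly_Mapping.keys p" "finite A" for A
      using that(2,1)
    proof (induction A rule: finite_induct)
      case empty
      then show ?case using Id.zero_closed by simp
    next
      case (insert m A)
      then show ?case using Id.a_closed[OF mem] by simp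
    qed
    from this[OF subset_refl finite_keys] show ?thesis
      by (simp only: mpoly_eq_sum_single[of p, symmetric])
  qed
  ultimately show ?thesis by blast
qed

section \<open>The multigraded strands of a resolution\<close>

text \<open>A multigraded piece of the polynomial ring is at most a line. Hence the matrices of a
  resolution are determined by scalars, which \<open>tcoef\<close> records.\<close>

lemma homogeneous_eq_single:
  fixes p :: "('v, 'k::field) mpoly"
  assumes "homogeneous \<delta> p" "finite V" "\<And>v. v \<notin> V \<Longrightarrow> \<delta> v = 0"
  shows "p = Poly_Mapping.single (mon \<delta>) (if 0 \<le> \<delta> then Poly_Mapping.lookup p (mon \<delta>) else 0)"
proof -
  have keys: "0 \<le> \<delta> \<and> m = mon \<delta>" if "m \<in> Poly_Mapping.keys p" for m
  proof -
    have m: "int (Poly_Mapping.lookup m v) = \<delta> v" for v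
      using assms(1) that by (simp add: homogeneous_def)
    then have "0 \<le> \<delta> v" for v by (metis of_nat_0_le_iff)
    moreover have "m = mon \<delta>"
      using lookup_mon[of V \<delta>, OF assms(2,3)] m by (intro poly_mapping_eqI) (metis nat_int)
    ultimately show ?thesis by (simp add: le_fun_def)
  qed
  show ?thesis
  proof (rule poly_mapping_eqI)
    fix k
    show "Poly_Mapping.lookup p k = Poly_Mapping.lookup (Poly_Mapping.single (mon \<delta>)
        (if 0 \<le> \<delta> then Poly_Mapping.lookup p (mon \<delta>) else 0)) k"
      using keys[of k] by (auto simp: lookup_single when_def in_keys_iff)
  qed
qed

lemma single_sum:
  "Poly_Mapping.single k (sum f A) = (\<Sum>a\<in>A. Poly_Mapping.single k (f a))"
  by (induction A rule: infinite_finite_induct) (simp_all add: single_add)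

locale edge_resolution =
  fixes V :: "'v set" and E :: "'v set set" and F :: "(nat, 'v, 'k::field) free_complex"
  assumes graph: "graph_on V E"
    and resolution: "graded_free_resolution V (edge_ideal V E) F"
begin

text \<open>The augmented complex \<open>\<dots> \<rightarrow> F\<^sub>1 \<rightarrow> F\<^sub>0 \<rightarrow> S\<close>, renumbered so that \<open>S\<close> has index 0.\<close>

definition tgens :: "nat \<Rightarrow> nat set" where
  "tgens n = (case n of 0 \<Rightarrow> {0} | Suc i \<Rightarrow> gens F i)"

definition tdeg :: "nat \<Rightarrow> nat \<Rightarrow> 'v \<Rightarrow> int" where
  "tdeg n b = (case n of 0 \<Rightarrow> 0 | Suc i \<Rightarrow> mdeg F i b)"

definition tmat :: "nat \<Rightarrow> nat \<Rightarrow> nat \<Rightarrow> ('v, 'k) mpoly" where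
  "tmat n a b = (case n of 0 \<Rightarrow> aug F b | Suc i \<Rightarrow> bd F i a b)"

text \<open>The scalar that is left of an entry when all variables are set to 1. The same matrix
  serves every multidegree \<beta>; only its index sets \<open>level n \<beta>\<close> vary.\<close>

definition tcoef :: "nat \<Rightarrow> nat \<Rightarrow> nat \<Rightarrow> 'k" where
  "tcoef n a b = (if tdeg n a \<le> tdeg (Suc n) b
     then Poly_Mapping.lookup (tmat n a b) (mon (tdeg (Suc n) b - tdeg n a)) else 0)"

abbreviation tapply :: "nat \<Rightarrow> (nat \<Rightarrow> ('v, 'k) mpoly) \<Rightarrow> nat \<Rightarrow> ('v, 'k) mpoly" where
  "tapply n \<equiv> apply_matrix (tgens n) (tgens (Suc n)) (tmat n)"

definition level :: "nat \<Rightarrow> ('v \<Rightarrow> int) \<Rightarrow> nat set" where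
  "level n \<beta> = {b \<in> tgens n. tdeg n b \<le> \<beta>}"

definition vdeg :: "('v \<Rightarrow> int) \<Rightarrow> bool" where
  "vdeg \<beta> \<longleftrightarrow> (\<forall>v. v \<notin> V \<longrightarrow> \<beta> v = 0)"

text \<open>Together with \<open>component\<close> this identifies functions on
  \<open>level n \<beta>\<close> with the degree-\<beta> part of the free module: each basis element
  is multiplied by the monomial that raises its degree to \<beta>.\<close>

definition lift :: "nat \<Rightarrow> ('v \<Rightarrow> int) \<Rightarrow> (nat \<Rightarrow> 'k) \<Rightarrow> nat \<Rightarrow> ('v, 'k) mpoly" where
  "lift n \<beta> x = (\<lambda>b. if b \<in> level n \<beta> then Poly_Mapping.single (mon (\<beta> - tdeg n b)) (x b) else 0)"

definition component :: "nat \<Rightarrow> ('v \<Rightarrow> int) \<Rightarrow> (nat \<Rightarrow> ('v, 'k) mpoly) \<Rightarrow> nat \<Rightarrow> 'k" where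
  "component n \<beta> y = (\<lambda>b. if b \<in> level n \<beta> then Poly_Mapping.lookup (y b) (mon (\<beta> - tdeg n b)) else 0)"

lemma finite_V: "finite V" using graph by (simp add: graph_on_def)

lemma finite_tgens: "finite (tgens n)"
  using resolution by (cases n) (simp_all add: tgens_def graded_free_resolution_def)

lemma finite_level: "finite (level n \<beta>)"
  using finite_tgens by (simp add: level_def)

lemma vdeg_tdeg: "b \<in> tgens n \<Longrightarrow> vdeg (tdeg n b)"
  using resolution
  by (cases n) (auto simp: tgens_def tdeg_def vdeg_def graded_free_resolution_def)

lemma vdeg_diff: "vdeg \<beta> \<Longrightarrow> vdeg \<gamma> \<Longrightarrow> vdeg (\<beta> - \<gamma>)"
  by (simp add: vdeg_def)

lemma lookup_mon_V: "vdeg \<beta> \<Longrightarrow> Poly_Mapping.lookup (mon \<beta>) v = nat (\<beta> v)"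
  using lookup_mon[OF finite_V, of \<beta>] by (simp add: vdeg_def)

lemma mon_add:
  assumes "vdeg \<alpha>" "vdeg \<beta>" "vdeg \<gamma>" "\<alpha> \<le> \<beta>" "\<beta> \<le> \<gamma>"
  shows "mon (\<beta> - \<alpha>) + mon (\<gamma> - \<beta>) = mon (\<gamma> - \<alpha>)"
  using assms
  by (intro poly_mapping_eqI) (simp add: lookup_add lookup_mon_V vdeg_diff nat_add_distrib[symmetric] le_fun_def)

lemma single_mon_carrier:
  assumes "vdeg \<beta>"
  shows "Poly_Mapping.single (mon \<beta>) c \<in> carrier (mpoly_ring V)"
proof -
  have "Poly_Mapping.keys (mon \<beta>) \<subseteq> V"
    using assms lookup_mon_V[OF assms] by (fastforce simp: in_keys_iff vdeg_def)
  then show ?thesis by (simp add: carrier_mpoly_ring)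
qed

lemma homogeneous_tmat:
  assumes "a \<in> tgens n" "b \<in> tgens (Suc n)"
  shows "homogeneous (tdeg (Suc n) b - tdeg n a) (tmat n a b)"
  using resolution assms
  by (cases n) (auto simp: tgens_def tdeg_def tmat_def graded_free_resolution_def fun_diff_def)

lemma tmat_eq:
  assumes "a \<in> tgens n" "b \<in> tgens (Suc n)"
  shows "tmat n a b = Poly_Mapping.single (mon (tdeg (Suc n) b - tdeg n a)) (tcoef n a b)"
proof -
  have "vdeg (tdeg (Suc n) b - tdeg n a)" using assms vdeg_tdeg vdeg_diff by blast
  moreover have "0 \<le> tdeg (Suc n) b - tdeg n a \<longleftrightarrow> tdeg n a \<le> tdeg (Suc n) b"
    by (simp add: le_fun_def)
  ultimately show ?thesis
    using homogeneous_eq_single[OF homogeneous_tmat[OF assms] finite_V]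
    by (simp add: tcoef_def vdeg_def)
qed

lemma tcoef_le: "tcoef n a b \<noteq> 0 \<Longrightarrow> tdeg n a \<le> tdeg (Suc n) b"
  by (simp add: tcoef_def split: if_splits)

lemma component_tapply:
  assumes \<beta>: "vdeg \<beta>"
  shows "component n \<beta> (tapply n y) =
    apply_matrix (level n \<beta>) (level (Suc n) \<beta>) (tcoef n) (component (Suc n) \<beta> y)"
proof
  fix a
  show "component n \<beta> (tapply n y) a =
    apply_matrix (level n \<beta>) (level (Suc n) \<beta>) (tcoef n) (component (Suc n) \<beta> y) a"
  proof (cases "a \<in> level n \<beta>")
    case True
    then have a: "a \<in> tgens n" "tdeg n a \<le> \<beta>" by (auto simp: level_def)
    let ?m = "mon (\<beta> - tdeg n a)"
    have entry: "Poly_Mapping.lookup (tmat n a b * y b) ?m =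
        (if b \<in> level (Suc n) \<beta> then tcoef n a b * component (Suc n) \<beta> y b else 0)"
      if b: "b \<in> tgens (Suc n)" for b
    proof (cases "tcoef n a b = 0")
      case True
      then show ?thesis using tmat_eq[OF a(1) b] by simp
    next
      case False
      note le = tcoef_le[OF this]
      note vd = vdeg_tdeg[OF a(1)] vdeg_tdeg[OF b]
      have "(\<forall>v. Poly_Mapping.lookup (mon (tdeg (Suc n) b - tdeg n a)) v \<le> Poly_Mapping.lookup ?m v)
          \<longleftrightarrow> tdeg (Suc n) b \<le> \<beta>"
        using le a vd \<beta> by (simp add: lookup_mon_V vdeg_diff le_fun_def nat_le_eq_zle)
      moreover have "?m - mon (tdeg (Suc n) b - tdeg n a) = mon (\<beta> - tdeg (Suc n) b)"
        if "tdeg (Suc n) b \<le> \<beta>"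
        using mon_add[OF vd \<beta> le that] by (metis add_diff_cancel_left')
      ultimately show ?thesis
        using b by (auto simp: tmat_eq[OF a(1) b] lookup_single_mult level_def component_def)
    qed
    have "component n \<beta> (tapply n y) a = (\<Sum>b\<in>tgens (Suc n). Poly_Mapping.lookup (tmat n a b * y b) ?m)"
      using True a by (simp add: component_def apply_matrix_def lookup_sum)
    also have "\<dots> = (\<Sum>b\<in>tgens (Suc n). if b \<in> level (Suc n) \<beta> then tcoef n a b * component (Suc n) \<beta> y b else 0)"
      by (intro sum.cong entry) auto
    also have "\<dots> = (\<Sum>b\<in>level (Suc n) \<beta>. tcoef n a b * component (Suc n) \<beta> y b)"
      using finite_tgens by (intro sum.mono_neutral_cong_right) (auto simp: level_def)
    finally show ?thesis using True by (simp add: apply_matrix_def)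
  qed (simp add: component_def apply_matrix_def)
qed

lemma tapply_lift:
  assumes \<beta>: "vdeg \<beta>"
  shows "tapply n (lift (Suc n) \<beta> x) =
    lift n \<beta> (apply_matrix (level n \<beta>) (level (Suc n) \<beta>) (tcoef n) x)"
proof
  fix a
  have entry: "tmat n a b * lift (Suc n) \<beta> x b =
      (if b \<in> level (Suc n) \<beta> then Poly_Mapping.single (mon (\<beta> - tdeg n a)) (tcoef n a b * x b) else 0)"
    if "a \<in> tgens n" "b \<in> tgens (Suc n)" for b
  proof (cases "tcoef n a b = 0 \<or> b \<notin> level (Suc n) \<beta>")
    case True
    then show ?thesis using tmat_eq[OF that] by (auto simp: lift_def)
  next
    case False
    then show ?thesis
      using mon_add[of "tdeg n a" "tdeg (Suc n) b" \<beta>] vdeg_tdeg that \<beta> tcoef_le[of n a b]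
      by (auto simp: tmat_eq[OF that] lift_def mult_single level_def)
  qed
  show "tapply n (lift (Suc n) \<beta> x) a =
      lift n \<beta> (apply_matrix (level n \<beta>) (level (Suc n) \<beta>) (tcoef n) x) a"
  proof (cases "a \<in> tgens n")
    case a: True
    have "tapply n (lift (Suc n) \<beta> x) a = (\<Sum>b\<in>level (Suc n) \<beta>.
        Poly_Mapping.single (mon (\<beta> - tdeg n a)) (tcoef n a b * x b))"
      using a entry[OF a] finite_tgens
      by (auto simp: apply_matrix_def level_def intro!: sum.mono_neutral_cong_right split: if_splits)
    also have "\<dots> = Poly_Mapping.single (mon (\<beta> - tdeg n a)) (\<Sum>b\<in>level (Suc n) \<beta>. tcoef n a b * x b)"
      by (simp add: single_sum)
    also have "\<dots> = lift n \<beta> (apply_matrix (level n \<beta>) (level (Suc n) \<beta>) (tcoef n) x) a"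
    proof (cases "a \<in> level n \<beta>")
      case True
      then show ?thesis by (simp add: lift_def apply_matrix_def)
    next
      case False
      have "tcoef n a b = 0" if "b \<in> level (Suc n) \<beta>" for b
        using False tcoef_le[of n a b] that a unfolding level_def by force
      then show ?thesis using False by (simp add: lift_def)
    qed
    finally show ?thesis .
  qed (simp add: apply_matrix_def lift_def level_def)
qed

lemma lift_free_module: "vdeg \<beta> \<Longrightarrow> lift n \<beta> x \<in> free_module V (tgens n)"
  by (auto simp: free_module_def lift_def level_def zero_one_carrier_mpoly
      intro!: single_mon_carrier vdeg_diff vdeg_tdeg)

lemma component_lift: "x \<in> supported (level n \<beta>) \<Longrightarrow> component n \<beta> (lift n \<beta> x) = x"
  by (auto simp: component_def lift_def fun_eq_iff supported_def)

lemma component_supported: "component n \<beta> y \<in> supported (level n \<beta>)"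
  by (auto simp: component_def supported_def)

lemma tapply_0: "tapply 0 y = (\<lambda>a. if a = 0 then free_aug F y else 0)"
  by (auto simp: apply_matrix_def tgens_def tmat_def free_aug_def fun_eq_iff)

lemma tapply_Suc: "tapply (Suc n) = free_bd F n"
proof -
  have "tmat (Suc n) = bd F n" by (auto simp: tmat_def fun_eq_iff)
  then show ?thesis by (simp add: tgens_def free_bd_def)
qed

lemma tapply_exact:
  shows "{y \<in> free_module V (tgens (Suc n)). tapply n y = 0} =
     tapply (Suc n) ` free_module V (tgens (Suc (Suc n)))"
proof (cases n)
  case 0
  have "tapply 0 y = 0 \<longleftrightarrow> free_aug F y = 0" for y
    unfolding tapply_0 by (auto simp: fun_eq_iff)
  then have "{y \<in> free_module V (tgens 1). tapply 0 y = 0} = {y \<in> free_module V (gens F 0). free_aug F y = 0}"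
    by (simp add: tgens_def)
  also have "\<dots> = free_bd F 0 ` free_module V (gens F 1)"
    using resolution by (simp add: graded_free_resolution_def)
  also have "\<dots> = tapply 1 ` free_module V (tgens 2)"
    unfolding One_nat_def tapply_Suc by (simp add: tgens_def numeral_2_eq_2)
  finally show ?thesis using 0 by (simp add: numeral_2_eq_2)
next
  case (Suc m)
  have "{x \<in> free_module V (gens F (Suc m)). free_bd F m x = 0} =
      free_bd F (Suc m) ` free_module V (gens F (Suc (Suc m)))"
    using resolution by (simp add: graded_free_resolution_def)
  moreover have "tgens (Suc (Suc i)) = gens F (Suc i)" for i by (simp add: tgens_def)
  ultimately show ?thesis unfolding Suc tapply_Suc by (simp only:)
qed

text \<open>Exactness gives the vanishing of the composite only on modules. Applying it to the basis
  element \<open>b\<close> in its own multidegree isolates a single matrix entry.\<close>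

lemma tcoef_comp_zero:
  assumes a: "a \<in> tgens n" and b: "b \<in> tgens (Suc (Suc n))"
  shows "(\<Sum>e\<in>tgens (Suc n). tcoef n a e * tcoef (Suc n) e b) = 0"
proof (cases "tdeg n a \<le> tdeg (Suc (Suc n)) b")
  case False
  then have "tcoef n a e * tcoef (Suc n) e b = 0" for e
    using tcoef_le[of n a e] tcoef_le[of "Suc n" e b] by (metis mult_eq_0_iff order_trans)
  then show ?thesis by (simp only: sum.neutral_const)
next
  case True
  define \<beta> where "\<beta> = tdeg (Suc (Suc n)) b"
  have \<beta>: "vdeg \<beta>" unfolding \<beta>_def using b by (rule vdeg_tdeg)
  let ?x = "unit_fun b :: nat \<Rightarrow> 'k"
  have b': "b \<in> level (Suc (Suc n)) \<beta>" using b by (simp add: level_def \<beta>_def)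
  have "tapply (Suc n) (lift (Suc (Suc n)) \<beta> ?x) \<in> {y \<in> free_module V (tgens (Suc n)). tapply n y = 0}"
    unfolding tapply_exact using lift_free_module[OF \<beta>] by blast
  then have "tapply n (tapply (Suc n) (lift (Suc (Suc n)) \<beta> ?x)) = 0" by blast
  then have "component n \<beta> (tapply n (tapply (Suc n) (lift (Suc (Suc n)) \<beta> ?x))) a = 0"
    by (simp add: component_def)
  moreover have "?x \<in> supported (level (Suc (Suc n)) \<beta>)"
    using b' by (auto simp: supported_def unit_fun_def)
  ultimately have "apply_matrix (level n \<beta>) (level (Suc n) \<beta>) (tcoef n)
      (apply_matrix (level (Suc n) \<beta>) (level (Suc (Suc n)) \<beta>) (tcoef (Suc n)) ?x) a = 0"
    by (simp add: component_tapply[OF \<beta>] component_lift)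
  moreover have "(\<Sum>c\<in>level (Suc (Suc n)) \<beta>. tcoef (Suc n) e c * ?x c) = tcoef (Suc n) e b" for e
    using b' finite_level by (simp add: unit_fun_def if_distrib cong: if_cong)
  ultimately have "(\<Sum>e\<in>level (Suc n) \<beta>. tcoef n a e * tcoef (Suc n) e b) = 0"
    using True a by (simp add: apply_matrix_def level_def[of n] \<beta>_def[symmetric])
  moreover have "tcoef (Suc n) e b = 0" if "e \<in> tgens (Suc n) - level (Suc n) \<beta>" for e
    using that tcoef_le[of "Suc n" e b] unfolding level_def \<beta>_def by blast
  then have "(\<Sum>e\<in>level (Suc n) \<beta>. tcoef n a e * tcoef (Suc n) e b) =
      (\<Sum>e\<in>tgens (Suc n). tcoef n a e * tcoef (Suc n) e b)"
    by (intro sum.mono_neutral_left finite_tgens) (auto simp: level_def)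
  ultimately show ?thesis by simp
qed


section \<open>Strands with some exponents fixed\<close>

definition piece :: "nat \<Rightarrow> 'v set \<Rightarrow> ('v \<Rightarrow> int) \<Rightarrow> nat set" where
  "piece n S \<beta> = {b \<in> level n \<beta>. \<forall>v\<in>S. tdeg n b v = \<beta> v}"

text \<open>The homology of the degree-\<beta> part of the augmented complex modulo the variables in
  \<open>S\<close>. It interpolates between a strand of \<open>F\<close>, at \<open>S = {}\<close>,
  and Tor, at \<open>S = V\<close>.\<close>

definition hom :: "nat \<Rightarrow> 'v set \<Rightarrow> ('v \<Rightarrow> int) \<Rightarrow> nat" where
  "hom n S \<beta> = homology_dim (\<lambda>m. piece m S \<beta>) tcoef n"

lemma finite_piece: "finite (piece n S \<beta>)"
  using finite_level by (simp add: piece_def)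

text \<open>If \<open>tcoef n a e\<close> and \<open>tcoef (Suc n) e b\<close> are nonzero, the
  degrees of \<open>a\<close>, \<open>e\<close>, \<open>b\<close> increase. On \<open>S\<close> both
  ends agree with \<beta>, which squeezes \<open>e\<close> in between, so no term of the sum is
  lost.\<close>

lemma chain_complex_piece: "chain_complex (\<lambda>m. piece m S \<beta>) tcoef"
  unfolding chain_complex_def
proof (intro conjI allI ballI finite_piece)
  fix n a b assume a: "a \<in> piece n S \<beta>" and b: "b \<in> piece (Suc (Suc n)) S \<beta>"
  have "tcoef n a e * tcoef (Suc n) e b = 0" if e: "e \<in> tgens (Suc n) - piece (Suc n) S \<beta>" for e
  proof (rule ccontr)
    assume "tcoef n a e * tcoef (Suc n) e b \<noteq> 0"
    then have le: "tdeg n a \<le> tdeg (Suc n) e" "tdeg (Suc n) e \<le> tdeg (Suc (Suc n)) b"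
      using tcoef_le by auto
    then have "tdeg (Suc n) e \<le> \<beta>" using b by (auto simp: piece_def level_def)
    moreover have "tdeg (Suc n) e v = \<beta> v" if "v \<in> S" for v
    proof (rule antisym)
      show "\<beta> v \<le> tdeg (Suc n) e v"
        using a that le_funD[OF le(1), of v] by (simp add: piece_def)
      show "tdeg (Suc n) e v \<le> \<beta> v"
        using b that le_funD[OF le(2), of v] by (simp add: piece_def)
    qed
    ultimately show False using e by (auto simp: piece_def level_def)
  qed
  then have "(\<Sum>e\<in>piece (Suc n) S \<beta>. tcoef n a e * tcoef (Suc n) e b) =
      (\<Sum>e\<in>tgens (Suc n). tcoef n a e * tcoef (Suc n) e b)"
    by (intro sum.mono_neutral_left finite_tgens) (auto simp: piece_def level_def)
  then show "(\<Sum>e\<in>piece (Suc n) S \<beta>. tcoef n a e * tcoef (Suc n) e b) = 0"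
    using tcoef_comp_zero[of a n b] a b by (simp add: piece_def level_def)
qed

text \<open>The sequence of multiplication by the variable \<open>v\<close>. Basis elements split by
  whether their degree at \<open>v\<close> is below or equal to \<open>\<beta> v\<close>; the former
  span a subcomplex, because a nonzero entry needs the degree of its row to be at most that of its
  column.\<close>

lemma hom_long_exact_sequence:
  assumes "v \<notin> S"
  shows "\<exists>i p d :: nat \<Rightarrow> nat. d 0 = 0 \<and> (\<forall>n. hom n S (\<beta>(v := \<beta> v - 1)) = i n + d (Suc n) \<and>
    hom n S \<beta> = i n + p n \<and> hom n (insert v S) \<beta> = p n + d n)"
proof -
  let ?A = "\<lambda>n. piece n S (\<beta>(v := \<beta> v - 1))" and ?C = "\<lambda>n. piece n (insert v S) \<beta>"
  have split: "?A n \<union> ?C n = piece n S \<beta>" for n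
  proof (rule Set.set_eqI)
    fix b
    have "tdeg n b \<le> \<beta>(v := \<beta> v - 1) \<longleftrightarrow> tdeg n b \<le> \<beta> \<and> tdeg n b v \<noteq> \<beta> v"
    proof -
      have "(\<forall>u. tdeg n b u \<le> (\<beta>(v := \<beta> v - 1)) u) \<longleftrightarrow>
          (\<forall>u. tdeg n b u \<le> \<beta> u \<and> (u = v \<longrightarrow> tdeg n b u \<noteq> \<beta> u))"
        by (intro all_cong1) auto
      then show ?thesis unfolding le_fun_def by blast
    qed
    moreover have "(\<forall>u\<in>S. tdeg n b u = (\<beta>(v := \<beta> v - 1)) u) \<longleftrightarrow> (\<forall>u\<in>S. tdeg n b u = \<beta> u)"
      using assms by auto
    ultimately show "b \<in> ?A n \<union> ?C n \<longleftrightarrow> b \<in> piece n S \<beta>"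
      by (auto simp: piece_def level_def)
  qed
  have low: "tdeg n b v < \<beta> v" if "b \<in> ?A n" for n b
    using that by (auto simp: piece_def level_def le_fun_def dest!: spec[of _ v])
  have high: "tdeg n b v = \<beta> v" if "b \<in> ?C n" for n b
    using that by (simp add: piece_def)
  have "?A n \<inter> ?C n = {}" for n using low high by fastforce
  moreover have "tcoef n a b = 0" if "a \<in> ?C n" "b \<in> ?A (Suc n)" for n a b
  proof (rule ccontr)
    assume "tcoef n a b \<noteq> 0"
    then have "tdeg n a v \<le> tdeg (Suc n) b v" using tcoef_le by (simp add: le_fun_def)
    then show False using low[OF that(2)] high[OF that(1)] by simp
  qed
  moreover have "chain_complex (\<lambda>n. ?A n \<union> ?C n) tcoef"
    unfolding split by (rule chain_complex_piece)
  ultimately show ?thesis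
    using long_exact_sequence_dims[of ?A tcoef ?C] chain_complex_piece
    unfolding split hom_def[symmetric] by blast
qed

lemma hom_0_eq_0:
  assumes "v \<in> S" "\<beta> v \<noteq> 0"
  shows "hom 0 S \<beta> = 0"
proof -
  have "piece 0 S \<beta> = {}" using assms by (force simp: piece_def level_def tdeg_def)
  then show ?thesis by (simp add: hom_def homology_dim_def)
qed

lemma piece_empty: "piece n {} \<beta> = level n \<beta>"
  by (simp add: piece_def)

text \<open>A cycle of the strand lifts to a cycle over the polynomial ring, which is a boundary by
  exactness; the degree-\<beta> component of a preimage lies in the strand again.\<close>

lemma hom_empty_Suc:
  assumes \<beta>: "vdeg \<beta>"
  shows "hom (Suc n) {} \<beta> = 0"
proof -
  let ?d = "apply_matrix (level n \<beta>) (level (Suc n) \<beta>) (tcoef n)"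
  let ?e = "apply_matrix (level (Suc n) \<beta>) (level (Suc (Suc n)) \<beta>) (tcoef (Suc n))"
  have "{x \<in> supported (level (Suc n) \<beta>). ?d x = 0} \<subseteq> ?e ` supported (level (Suc (Suc n)) \<beta>)"
  proof
    fix x assume "x \<in> {x \<in> supported (level (Suc n) \<beta>). ?d x = 0}"
    then have x: "x \<in> supported (level (Suc n) \<beta>)" "?d x = 0" by auto
    have "tapply n (lift (Suc n) \<beta> x) = 0"
      unfolding tapply_lift[OF \<beta>] x(2) by (auto simp: lift_def fun_eq_iff)
    then obtain y where "lift (Suc n) \<beta> x = tapply (Suc n) y"
      using tapply_exact[of n] lift_free_module[OF \<beta>] by blast
    then have "x = ?e (component (Suc (Suc n)) \<beta> y)"
      using component_lift[OF x(1)] component_tapply[OF \<beta>] by metis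
    then show "x \<in> ?e ` supported (level (Suc (Suc n)) \<beta>)"
      using component_supported by blast
  qed
  moreover have "?e ` supported (level (Suc (Suc n)) \<beta>) \<subseteq> supported (level (Suc n) \<beta>)"
    using apply_matrix_supported by blast
  ultimately have "fun_dim {x \<in> supported (level (Suc n) \<beta>). ?d x = 0}
      \<le> mat_rank (level (Suc n) \<beta>) (level (Suc (Suc n)) \<beta>) (tcoef (Suc n))"
    unfolding mat_rank_def by (intro fun_dim_mono[OF finite_level])
  then show ?thesis
    using card_eq_kernel_plus_mat_rank[OF finite_level, of "Suc n" \<beta> "level n \<beta>" "tcoef n"]
    by (simp add: hom_def homology_dim_def out_rank_def piece_empty)
qed

lemma edge_monomial_mon:
  assumes "vdeg \<beta>"
  shows "edge_monomial E (mon \<beta>) \<longleftrightarrow> (\<exists>e\<in>E. \<forall>v\<in>e. 0 < \<beta> v)"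
proof -
  have "Poly_Mapping.keys (mon \<beta>) = {v. 0 < \<beta> v}"
    using lookup_mon_V[OF assms] by (auto simp: in_keys_iff)
  then show ?thesis by (auto simp: edge_monomial_def)
qed

lemma aug_image: "free_aug F ` free_module V (tgens 1) = edge_ideal V E"
  using resolution by (simp add: graded_free_resolution_def tgens_def)

text \<open>What remains in degree 0 is the degree-\<beta> part of \<open>k[V]\<close> modulo the
  edge ideal: the line of a single monomial, or nothing.\<close>

lemma hom_empty_0:
  assumes \<beta>: "vdeg \<beta>"
  shows "hom 0 {} \<beta> = (if 0 \<le> \<beta> \<and> \<not> (\<exists>e\<in>E. \<forall>v\<in>e. 0 < \<beta> v) then 1 else 0)"
proof (cases "0 \<le> \<beta>")
  case False
  then have "level 0 \<beta> = {}" by (auto simp: level_def tdeg_def)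
  then show ?thesis using False by (simp add: hom_def homology_dim_def piece_empty)
next
  case True
  let ?d = "apply_matrix (level 0 \<beta>) (level 1 \<beta>) (tcoef 0)"
  have l0: "level 0 \<beta> = {0}" using True by (auto simp: level_def tdeg_def tgens_def)
  have hom: "hom 0 {} \<beta> = 1 - fun_dim (?d ` supported (level 1 \<beta>))"
    using l0 by (simp add: hom_def homology_dim_def piece_empty out_rank_def mat_rank_def)
  show ?thesis
  proof (cases "edge_monomial E (mon \<beta>)")
    case edge: True
    have "Poly_Mapping.single (mon \<beta>) (1 :: 'k) \<in> edge_ideal V E"
      using edge single_mon_carrier[OF \<beta>, of 1] by (auto simp: edge_ideal_eq[OF graph])
    then obtain y where "y \<in> free_module V (tgens 1)"
      and y: "free_aug F y = Poly_Mapping.single (mon \<beta>) 1"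
      using aug_image by (metis image_iff)
    have "?d (component 1 \<beta> y) = component 0 \<beta> (tapply 0 y)"
      using component_tapply[OF \<beta>, of 0 y] by simp
    also have "\<dots> = unit_fun 0"
      unfolding tapply_0 y using l0
      by (auto simp: component_def unit_fun_def fun_eq_iff tdeg_def fun_diff_def)
    finally have u: "unit_fun 0 \<in> ?d ` supported (level 1 \<beta>)"
      using component_supported by (metis image_eqI)
    have "fun_subspace (?d ` supported (level 1 \<beta>))" by (rule fun_subspace_apply_matrix)
    then have "fun_space.span (unit_fun ` {0}) \<subseteq> ?d ` supported (level 1 \<beta>)"
      using u by (intro fun_space.span_minimal) auto
    then have "supported {0} \<subseteq> ?d ` supported (level 1 \<beta>)"
      by (rule order_trans[rotated]) (rule supported_subset_span, simp)
    then have "fun_dim (supported {0::nat} :: (nat \<Rightarrow> 'k) set) \<le> fun_dim (?d ` supported (level 1 \<beta>))"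
    proof (rule fun_dim_mono[of "{0::nat}", rotated])
      show "?d ` supported (level 1 \<beta>) \<subseteq> supported {0}"
        unfolding l0 using apply_matrix_supported by blast
    qed simp
    then show ?thesis
      using edge hom by (simp add: edge_monomial_mon[OF \<beta>] fun_dim_supported)
  next
    case edge: False
    have "?d x = 0" if x: "x \<in> supported (level 1 \<beta>)" for x
    proof -
      have "free_aug F (lift 1 \<beta> x) \<in> edge_ideal V E"
        using aug_image lift_free_module[OF \<beta>] by blast
      moreover have "free_aug F (lift 1 \<beta> x) = tapply 0 (lift 1 \<beta> x) 0"
        by (simp add: tapply_0)
      also have "\<dots> = Poly_Mapping.single (mon \<beta>) (?d x 0)"
        using tapply_lift[OF \<beta>, of 0 x] l0 by (simp add: lift_def tdeg_def)
      ultimately have "?d x 0 = 0"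
        using edge by (auto simp: edge_ideal_eq[OF graph] split: if_splits)
      moreover have "?d x a = 0" if "a \<noteq> 0" for a
        using that l0 by (simp add: apply_matrix_def)
      ultimately have "?d x a = (0 :: nat \<Rightarrow> 'k) a" for a by (cases "a = 0") simp_all
      then show ?thesis by (rule ext)
    qed
    then have "?d ` supported (level 1 \<beta>) \<subseteq> {0}" by auto
    then have "fun_dim (?d ` supported (level 1 \<beta>)) \<le> fun_dim {0 :: nat \<Rightarrow> 'k}"
      by (intro fun_dim_mono[of "{}"]) (auto simp: supported_def)
    also have "\<dots> = 0"
      using fun_dim_supported[of "{} :: nat set"]
      by (simp add: supported_def fun_eq_iff[symmetric] zero_fun_def[symmetric])
    finally show ?thesis using edge hom True by (simp add: edge_monomial_mon[OF \<beta>])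
  qed
qed

text \<open>When every exponent is fixed, only basis elements of degree exactly \<alpha> are left,
  and entries between them are constants; this is the complex tensored with \<open>k\<close>. The
  index moves by one because index 0 is taken by the ring.\<close>

lemma tor_dim_eq_hom:
  assumes \<alpha>: "vdeg \<alpha>" "\<alpha> v \<noteq> 0"
  shows "tor_dim F i \<alpha> = hom (Suc i) V \<alpha>"
proof -
  have vV: "v \<in> V" using \<alpha> by (auto simp: vdeg_def)
  have piece: "piece n V \<alpha> = {b \<in> tgens n. tdeg n b = \<alpha>}" for n
  proof -
    have "tdeg n b = \<alpha> \<longleftrightarrow> tdeg n b \<le> \<alpha> \<and> (\<forall>v\<in>V. tdeg n b v = \<alpha> v)" if "b \<in> tgens n" for b
      using vdeg_tdeg[OF that] \<alpha>(1) by (auto simp: vdeg_def fun_eq_iff le_fun_def)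
    then show ?thesis by (auto simp: piece_def level_def)
  qed
  \<comment> \<open>The generator of the ring has degree 0, which is not \<alpha>. So the
    augmentation is invisible here, and every chain on \<open>gens F 0\<close> is a cycle, in
    accordance with \<open>tensor_cycles\<close>.\<close>
  have p0: "piece 0 V \<alpha> = {}" using \<alpha>(2) by (auto simp: piece tdeg_def)
  have chains: "tensor_chains F n \<alpha> = supported (piece (Suc n) V \<alpha>)" for n
    by (auto simp: tensor_chains_def supported_def piece tgens_def tdeg_def)
  have bd: "tensor_bd F n x = apply_matrix (piece (Suc n) V \<alpha>) (piece (Suc (Suc n)) V \<alpha>) (tcoef (Suc n)) x"
    (is "_ = ?r") if x: "x \<in> supported (piece (Suc (Suc n)) V \<alpha>)" for n x
  proof
    fix a
    let ?c = "\<lambda>b. Poly_Mapping.lookup (bd F n a b) 0"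
    have mon0: "mon (0 :: 'v \<Rightarrow> int) = 0" by (simp add: mon_def)
    have c: "?c b = (if a \<in> piece (Suc n) V \<alpha> then tcoef (Suc n) a b else 0)"
      if a: "a \<in> gens F n" and b: "b \<in> piece (Suc (Suc n)) V \<alpha>" for b
    proof (cases "a \<in> piece (Suc n) V \<alpha>")
      case True
      then have "tdeg (Suc n) a = \<alpha>" "tdeg (Suc (Suc n)) b = \<alpha>" using b by (auto simp: piece)
      then show ?thesis using True mon0 by (simp add: tcoef_def tmat_def)
    next
      case False
      have ab: "a \<in> tgens (Suc n)" "b \<in> tgens (Suc (Suc n))"
        using a b by (auto simp: tgens_def piece)
      have "?c b = 0"
      proof (rule ccontr)
        assume "?c b \<noteq> 0"
        then have "0 \<in> Poly_Mapping.keys (tmat (Suc n) a b)" by (simp add: in_keys_iff tmat_def)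
        then have "\<forall>v. 0 = (tdeg (Suc (Suc n)) b - tdeg (Suc n) a) v"
          using homogeneous_tmat[OF ab] by (force simp: homogeneous_def)
        then have "tdeg (Suc n) a = tdeg (Suc (Suc n)) b" by (auto simp: fun_eq_iff)
        then show False using False b ab by (auto simp: piece)
      qed
      then show ?thesis using False by simp
    qed
    have sub: "piece (Suc n) V \<alpha> \<subseteq> gens F n" by (auto simp: piece tgens_def)
    show "tensor_bd F n x a = ?r a"
    proof (cases "a \<in> gens F n")
      case a: True
      have "tensor_bd F n x a = (\<Sum>b\<in>gens F (Suc n). ?c b * x b)"
        using a by (simp add: tensor_bd_def apply_matrix_def)
      also have "\<dots> = (\<Sum>b\<in>piece (Suc (Suc n)) V \<alpha>. ?c b * x b)"
        using x finite_tgens[of "Suc (Suc n)"]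
        by (intro sum.mono_neutral_right) (auto simp: piece tgens_def supported_def)
      also have "\<dots> = ?r a"
        using c[OF a] by (auto simp: apply_matrix_def intro!: sum.neutral)
      finally show ?thesis .
    qed (use sub in \<open>auto simp: tensor_bd_def apply_matrix_def\<close>)
  qed
  have "tensor_boundaries F i \<alpha> =
      apply_matrix (piece (Suc i) V \<alpha>) (piece (Suc (Suc i)) V \<alpha>) (tcoef (Suc i)) ` supported (piece (Suc (Suc i)) V \<alpha>)"
    unfolding tensor_boundaries_def chains using bd by (intro image_cong refl)
  then have bdim: "fun_dim (tensor_boundaries F i \<alpha>) = out_rank (\<lambda>m. piece m V \<alpha>) tcoef (Suc (Suc i))"
    by (simp add: out_rank_def mat_rank_def)
  have "fun_dim (tensor_cycles F i \<alpha>) = card (piece (Suc i) V \<alpha>) - out_rank (\<lambda>m. piece m V \<alpha>) tcoef (Suc i)"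
  proof -
    have "tensor_cycles F i \<alpha> = {x \<in> supported (piece (Suc i) V \<alpha>).
        apply_matrix (piece i V \<alpha>) (piece (Suc i) V \<alpha>) (tcoef i) x = 0}"
    proof (cases i)
      case 0
      then show ?thesis by (auto simp: tensor_cycles_def chains p0 apply_matrix_def fun_eq_iff)
    next
      case (Suc j)
      then show ?thesis using bd[of _ j] by (auto simp: tensor_cycles_def chains)
    qed
    then show ?thesis
      using card_eq_kernel_plus_mat_rank[OF finite_piece, of "Suc i" V \<alpha> "piece i V \<alpha>" "tcoef i"]
      by (simp add: out_rank_def)
  qed
  then show ?thesis using bdim by (simp add: tor_dim_def hom_def homology_dim_def)
qed

end

section \<open>Recursion over induced subgraphs\<close>

definition independent_set :: "'v set set \<Rightarrow> 'v set \<Rightarrow> bool" where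
  "independent_set E A \<longleftrightarrow> \<not> (\<exists>e\<in>E. e \<subseteq> A)"

definition neighbours :: "'v set set \<Rightarrow> 'v \<Rightarrow> 'v set \<Rightarrow> 'v set" where
  "neighbours E v W = {w \<in> W. {v, w} \<in> E}"

text \<open>\<open>h n S T\<close> is the homology in degree \<open>n\<close> of the part of the augmented resolution with
  exponent 1 at \<open>S\<close>, at most 1 at \<open>T\<close> and 0 elsewhere.  Up to a shift it is the cohomology
  of the link of \<open>T\<close> in the independence complex of \<open>S \<union> T\<close>.\<close>

locale strand_homology =
  fixes V :: "'v set" and E :: "'v set set" and h :: "nat \<Rightarrow> 'v set \<Rightarrow> 'v set \<Rightarrow> nat"
  assumes graph: "graph_on V E"
    and h_empty: "\<And>n T. T \<subseteq> V \<Longrightarrow> h n {} T = (if n = 0 \<and> independent_set E T then 1 else 0)"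
    and h_les: "\<And>v S T. v \<in> V \<Longrightarrow> S \<subseteq> V \<Longrightarrow> T \<subseteq> V \<Longrightarrow> S \<inter> T = {} \<Longrightarrow> v \<notin> S \<union> T \<Longrightarrow>
      \<exists>i p d :: nat \<Rightarrow> nat. d 0 = 0 \<and> (\<forall>n. h n S T = i n + d (Suc n) \<and>
        h n S (insert v T) = i n + p n \<and> h n (insert v S) T = p n + d n)"
    and h_0: "\<And>S T. S \<subseteq> V \<Longrightarrow> T \<subseteq> V \<Longrightarrow> S \<inter> T = {} \<Longrightarrow> S \<noteq> {} \<Longrightarrow> h 0 S T = 0"
begin

lemma finite_V: "finite V" using graph by (simp add: graph_on_def)

lemma edgeE:
  assumes "e \<in> E"
  obtains u v where "e = {u, v}" "u \<noteq> v" "u \<in> V" "v \<in> V"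
  using graph assms unfolding graph_on_def by blast

lemma edge_neq: "{u, v} \<in> E \<Longrightarrow> u \<noteq> v"
  by (erule edgeE) (auto simp: doubleton_eq_iff)

lemma h_lesE:
  assumes "insert v S \<subseteq> V" "T \<subseteq> V" "insert v S \<inter> T = {}" "v \<notin> S"
  obtains i p d :: "nat \<Rightarrow> nat" where "d 0 = 0" "\<And>n. h n S T = i n + d (Suc n)"
    "\<And>n. h n S (insert v T) = i n + p n" "\<And>n. h n (insert v S) T = p n + d n"
proof -
  have "\<exists>i p d :: nat \<Rightarrow> nat. d 0 = 0 \<and> (\<forall>n. h n S T = i n + d (Suc n) \<and>
      h n S (insert v T) = i n + p n \<and> h n (insert v S) T = p n + d n)"
    by (rule h_les) (use assms in auto)
  then show ?thesis using that by (elim exE conjE) simp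
qed

lemma h_deleteE:
  assumes "W \<subseteq> V" "T \<subseteq> V" "W \<inter> T = {}" "v \<in> W"
  obtains i p d :: "nat \<Rightarrow> nat" where "d 0 = 0" "\<And>n. h n (W - {v}) T = i n + d (Suc n)"
    "\<And>n. h n (W - {v}) (insert v T) = i n + p n" "\<And>n. h n W T = p n + d n"
proof -
  have W: "insert v (W - {v}) = W" using assms by auto
  have "\<exists>i p d :: nat \<Rightarrow> nat. d 0 = 0 \<and> (\<forall>n. h n (W - {v}) T = i n + d (Suc n) \<and>
      h n (W - {v}) (insert v T) = i n + p n \<and> h n (insert v (W - {v})) T = p n + d n)"
    by (rule h_les) (use assms in auto)
  then show ?thesis unfolding W using that by (elim exE conjE) simp
qed

text \<open>The sequence of a vertex \<open>u\<close> computes exponent 1 at \<open>u\<close> from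
  exponent 0 and exponent at most 1. So if \<open>S\<close> gives zero for every bound set between
  \<open>T\<close> and \<open>T \<union> R\<close>, the vertices of \<open>R\<close> can join
  \<open>S\<close> one at a time.\<close>

lemma h_acyclic_extend:
  assumes "finite R" "S \<subseteq> V" "T \<subseteq> V" "R \<subseteq> V" "S \<inter> T = {}" "R \<inter> (S \<union> T) = {}"
    and "\<And>T' n. T \<subseteq> T' \<Longrightarrow> T' \<subseteq> T \<union> R \<Longrightarrow> h n S T' = 0"
  shows "h n (S \<union> R) T = 0"
  using assms
proof (induction R arbitrary: T n rule: finite_induct)
  case empty
  then show ?case by simp
next
  case (insert u R)
  have 1: "h n (S \<union> R) T = 0" for n
  proof (rule insert.IH)
    show "h n S T' = 0" if "T \<subseteq> T'" "T' \<subseteq> T \<union> R" for T' n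
      using that by (intro insert.prems(6)) auto
  qed (use insert.prems in auto)
  have 2: "h n (S \<union> R) (insert u T) = 0" for n
  proof (rule insert.IH)
    show "h n S T' = 0" if "insert u T \<subseteq> T'" "T' \<subseteq> insert u T \<union> R" for T' n
      using that by (intro insert.prems(6)) auto
  qed (use insert.prems insert.hyps in auto)
  obtain i p d :: "nat \<Rightarrow> nat" where *: "d 0 = 0" "\<And>n. h n (S \<union> R) T = i n + d (Suc n)"
      "\<And>n. h n (S \<union> R) (insert u T) = i n + p n" "\<And>n. h n (insert u (S \<union> R)) T = p n + d n"
    by (rule h_lesE[of u "S \<union> R" T]) (use insert.prems insert.hyps in auto)
  have "d n = 0" using *(1) *(2)[of "n - 1"] 1[of "n - 1"] by (cases n) auto
  then show ?case using *(3)[of n] *(4)[of n] 2[of n] by simp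
qed

lemma h_dependent:
  assumes "S \<subseteq> V" "T \<subseteq> V" "S \<inter> T = {}" "\<not> independent_set E T"
  shows "h n S T = 0"
proof -
  have "h n ({} \<union> S) T = 0"
  proof (rule h_acyclic_extend)
    fix T' n assume "T \<subseteq> T'" "T' \<subseteq> T \<union> S"
    moreover obtain e where "e \<in> E" "e \<subseteq> T" using assms by (auto simp: independent_set_def)
    ultimately have "\<not> independent_set E T'" "T' \<subseteq> V"
      using assms(1,2) unfolding independent_set_def by blast+
    then show "h n {} T' = 0" by (simp add: h_empty)
  qed (use assms finite_subset[OF _ finite_V] in auto)
  then show ?thesis by simp
qed

text \<open>If \<open>u\<close> can be added to every relevant independent set, exponent 0 and
  exponent at most 1 at \<open>u\<close> have the same homology, and exponent 1 has none.\<close>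

lemma h_cone:
  assumes "insert u S \<subseteq> V" "T \<subseteq> V" "insert u S \<inter> T = {}" "u \<notin> S"
    and "\<And>T'. T \<subseteq> T' \<Longrightarrow> T' \<subseteq> T \<union> S \<Longrightarrow> independent_set E T' \<Longrightarrow> independent_set E (insert u T')"
  shows "h n (insert u S) T = 0"
proof -
  have "h n ({u} \<union> S) T = 0"
  proof (rule h_acyclic_extend)
    fix T' n assume T': "T \<subseteq> T'" "T' \<subseteq> T \<union> S"
    then have V: "T' \<subseteq> V" "u \<notin> T'" "u \<in> V" using assms by auto
    have ind: "independent_set E (insert u T') \<longleftrightarrow> independent_set E T'"
      using assms(5)[OF T'] by (auto simp: independent_set_def)
    obtain i p d :: "nat \<Rightarrow> nat" where *: "d 0 = 0" "\<And>n. h n {} T' = i n + d (Suc n)"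
      "\<And>n. h n {} (insert u T') = i n + p n" "\<And>n. h n {u} T' = p n + d n"
      by (rule h_lesE[of u "{}" T']) (use V in auto)
    have eq: "h n {} T' = h n {} (insert u T')" for n using V ind by (simp add: h_empty)
    \<comment> \<open>Equal dimensions alone do not give an isomorphism. Vanishing in degree 0 makes
      the map onto there, and all other degrees are zero anyway.\<close>
    have "h 0 {u} T' = 0" using V by (intro h_0) auto
    then have "p 0 = 0" using *(4)[of 0] by simp
    then have "p n = 0" for n
      using *(3)[of n] h_empty[of "insert u T'" n] V by (cases n) auto
    moreover have "d n = 0"
      using *(1) *(2,3)[of "n - 1"] eq[of "n - 1"] \<open>\<And>n. p n = 0\<close> by (cases n) auto
    ultimately show "h n {u} T' = 0" using *(4) by simp
  qed (use assms finite_subset[OF _ finite_V] in auto)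
  then show ?thesis by simp
qed

text \<open>Each exact sequence raises the top degree by at most one, starting from degree 0 at
  \<open>S = {}\<close>.\<close>

lemma h_large:
  assumes "S \<subseteq> V" "T \<subseteq> V" "S \<inter> T = {}" "card S < n"
  shows "h n S T = 0"
proof -
  have "finite S" using assms finite_V finite_subset by blast
  then show ?thesis using assms
  proof (induction S arbitrary: T n rule: finite_induct)
    case empty
    then show ?case by (simp add: h_empty)
  next
    case (insert v S)
    obtain i p d :: "nat \<Rightarrow> nat" where *: "d 0 = 0" "\<And>n. h n S T = i n + d (Suc n)"
      "\<And>n. h n S (insert v T) = i n + p n" "\<And>n. h n (insert v S) T = p n + d n"
      by (rule h_lesE[of v S T]) (use insert.prems insert.hyps in auto)
    obtain m where n: "n = Suc m" "card S < m" using insert by (cases n) auto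
    have "h m S T = 0" "h n S (insert v T) = 0"
      using insert.prems insert.hyps n by (intro insert.IH; auto)+
    then show ?case using *(2)[of m] *(3)[of n] *(4)[of n] n by simp
  qed
qed

text \<open>If a neighbour \<open>w\<close> joins \<open>v\<close> in the bound set, this set is
  dependent and the term vanishes. The connecting map is then an isomorphism, so each neighbour that
  is removed costs one degree.\<close>

lemma h_link:
  assumes "finite N" "S \<subseteq> V" "v \<in> V" "v \<notin> S" "N \<subseteq> S" "\<And>w. w \<in> N \<Longrightarrow> {v, w} \<in> E"
  shows "h n S {v} = (if card N \<le> n then h (n - card N) (S - N) {v} else 0)"
  using assms
proof (induction N arbitrary: n S rule: finite_induct)
  case (insert w N)
  let ?S = "S - {w}"
  have w: "w \<in> S" "{v, w} \<in> E" using insert.prems by auto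
  obtain i p d :: "nat \<Rightarrow> nat" where *: "d 0 = 0" "\<And>n. h n ?S {v} = i n + d (Suc n)"
      "\<And>n. h n ?S {w, v} = i n + p n" "\<And>n. h n S {v} = p n + d n"
    by (rule h_deleteE[of S "{v}" w]) (use insert.prems w in auto)
  have "h n ?S {w, v} = 0" for n
    using insert.prems w by (intro h_dependent) (auto simp: independent_set_def insert_commute)
  then have "i n = 0" "p n = 0" for n using *(3)[of n] by simp_all
  then have step: "h n S {v} = (case n of 0 \<Rightarrow> 0 | Suc m \<Rightarrow> h m ?S {v})" for n
    using *(1,2,4) by (cases n) auto
  have IH: "h m ?S {v} = (if card N \<le> m then h (m - card N) (?S - N) {v} else 0)" for m
    using insert.prems insert.hyps by (intro insert.IH) auto
  have "S - insert w N = ?S - N" by auto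
  then show ?case using step[of n] IH insert.hyps by (cases n) auto
qed simp

text \<open>\<open>g m W\<close> is indexed like the cohomology of the independence complex of \<open>W\<close>, with a set of
  \<open>m\<close> vertices in degree \<open>m\<close>.\<close>

definition g :: "nat \<Rightarrow> 'v set \<Rightarrow> nat" where
  "g m W = (if m \<le> card W then h (card W - m) W {} else 0)"

lemma g_empty: "g m {} = (if m = 0 then 1 else 0)"
proof -
  have "independent_set E {}" by (auto simp: independent_set_def elim: edgeE)
  then show ?thesis by (simp add: g_def h_empty)
qed

lemma h_isolated:
  assumes "W \<subseteq> V" "v \<in> W" "neighbours E v W = {}"
  shows "h n W {} = 0"
proof -
  have "h n (insert v (W - {v})) {} = 0"
  proof (rule h_cone)
    fix T' assume T': "T' \<subseteq> {} \<union> (W - {v})" "independent_set E T'"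
    show "independent_set E (insert v T')"
      unfolding independent_set_def
    proof (rule notI, elim bexE)
      fix e assume e: "e \<in> E" "e \<subseteq> insert v T'"
      then have "v \<in> e" using T' by (auto simp: independent_set_def)
      then obtain w where "e = {v, w}" "w \<noteq> v" using e(1) by (auto elim!: edgeE)
      then have "w \<in> neighbours E v W" using e T' by (auto simp: neighbours_def)
      then show False using assms by simp
    qed
  qed (use assms in auto)
  then show ?thesis using assms by (simp add: insert_absorb)
qed

lemma g_isolated:
  assumes "W \<subseteq> V" "v \<in> W" "neighbours E v W = {}"
  shows "g m W = 0"
  using h_isolated[OF assms] by (simp add: g_def)

text \<open>Deletion and link of \<open>v\<close>: the ranks along
  \<open>H\<^sup>m(\<Delta>\<^sub>W) \<rightarrow> H\<^sup>m(\<Delta>\<^sub>S) \<rightarrow> H\<^sup>m(lk v) \<rightarrow> H\<^sup>m\<^sup>+\<^sup>1(\<Delta>\<^sub>W)\<close>.\<close>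

lemma g_les:
  assumes W: "W \<subseteq> V" and v: "v \<in> W" and S: "S = W - {v}" and L: "L = S - neighbours E v W"
  shows "\<exists>a b e :: nat \<Rightarrow> nat. g 0 W = e 0 \<and> (\<forall>m. g m S = a m + e m \<and> g m L = a m + b m \<and>
    g (Suc m) W = b m + e (Suc m))"
proof -
  define c where "c = card S"
  define N where "N = neighbours E v W"
  have finW: "finite W" using W finite_V finite_subset by blast
  have cW: "card W = Suc c" using v finW S card_Suc_Diff1[of W v] by (simp add: c_def)
  have NS: "N \<subseteq> S" "finite N" using edge_neq finW by (auto simp: N_def neighbours_def S)
  have cL: "card L = c - card N" "card N \<le> c"
    using NS finW card_Diff_subset[of N S] card_mono[of S N] by (auto simp: L N_def c_def S)
  obtain i p d :: "nat \<Rightarrow> nat" where *: "d 0 = 0" "\<And>n. h n S {} = i n + d (Suc n)"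
      "\<And>n. h n S {v} = i n + p n" "\<And>n. h n W {} = p n + d n"
    unfolding S by (rule h_deleteE[of W "{}" v]) (use W v in auto)
  \<comment> \<open>No neighbour of \<open>v\<close> is left in \<open>L\<close>, so exponent 1 at
    \<open>v\<close> gives zero and it does not matter whether \<open>v\<close> is bounded by 1 or
    by 0.\<close>
  have link: "h n L {v} = h n L {}" for n
  proof -
    have vL: "v \<notin> L" "insert v L \<subseteq> V" using W v by (auto simp: L S)
    obtain i p d :: "nat \<Rightarrow> nat" where *: "d 0 = 0" "\<And>n. h n L {} = i n + d (Suc n)"
      "\<And>n. h n L {v} = i n + p n" "\<And>n. h n (insert v L) {} = p n + d n"
      by (rule h_lesE[of v L "{}"]) (use vL in auto)
    have "neighbours E v (insert v L) = {}"
      using edge_neq by (auto simp: L S neighbours_def)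
    then have "h n (insert v L) {} = 0" for n using vL by (intro h_isolated[of _ v]) auto
    then have "p n = 0" "d n = 0" for n using *(4)[of n] by simp_all
    then show ?thesis using * by simp
  qed
  \<comment> \<open>The \<open>card N\<close> degrees lost in \<open>h_link\<close> are just
    \<open>card S - card L\<close>, so \<open>g\<close> has the same index for the link as for the
    deletion.\<close>
  have B: "h n S {v} = (if card N \<le> n then h (n - card N) L {} else 0)" for n
  proof -
    have "h n S {v} = (if card N \<le> n then h (n - card N) (S - N) {v} else 0)"
      by (rule h_link) (use NS W v in \<open>auto simp: S N_def neighbours_def\<close>)
    moreover have "S - N = L" by (simp add: L N_def)
    ultimately show ?thesis by (simp only: link)
  qed
  have van: "h n S {} = 0" "h n S {v} = 0" if "c < n" for n
    using that W v by (intro h_large; auto simp: c_def S)+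
  \<comment> \<open>The ranks of the three maps in terms of \<open>m = c - n\<close>. The connecting
    map leads from degree \<open>Suc n\<close> to degree \<open>n\<close>, hence the
    \<open>Suc\<close> in \<open>e\<close>.\<close>
  define a b e where "a m = (if m \<le> c then i (c - m) else 0)"
    and "b m = (if m \<le> c then p (c - m) else 0)" and "e m = (if m \<le> c then d (Suc (c - m)) else 0)" for m
  show ?thesis
  proof (intro exI conjI allI)
    show "g 0 W = e 0"
      using *(4)[of "Suc c"] *(3)[of "Suc c"] van(2)[of "Suc c"] by (simp add: g_def cW e_def)
    fix m
    show "g m S = a m + e m"
      using *(2) by (simp add: g_def c_def[symmetric] a_def e_def)
    show "g m L = a m + b m"
    proof (cases "m \<le> c - card N")
      case True
      then have "m \<le> c" "card N \<le> c - m" "c - m - card N = c - card N - m" using cL(2) by auto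
      then show ?thesis
        using *(3)[of "c - m"] B[of "c - m"] True by (simp add: g_def cL(1) a_def b_def)
    next
      case False
      then have "m \<le> c \<Longrightarrow> \<not> card N \<le> c - m" by auto
      then show ?thesis
        using *(3)[of "c - m"] B[of "c - m"] False
        by (cases "m \<le> c") (simp_all add: g_def cL(1) a_def b_def)
    qed
    show "g (Suc m) W = b m + e (Suc m)"
    proof (cases "m < c")
      case True
      then have "Suc (c - Suc m) = c - m" by simp
      then show ?thesis using *(4)[of "c - m"] True by (simp add: g_def cW b_def e_def)
    next
      case False
      then show ?thesis
        using *(1) *(4)[of 0] by (cases "m = c") (simp_all add: g_def cW b_def e_def)
    qed
  qed
qed

text \<open>Passing to the link of \<open>v\<close> removes all neighbours of \<open>u\<close> and
  so isolates \<open>u\<close>. The link is acyclic, and deleting \<open>v\<close> changes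
  nothing.\<close>

lemma g_fold:
  assumes W: "W \<subseteq> V" "u \<in> W" "v \<in> W" "u \<noteq> v"
    and sub: "neighbours E u W \<subseteq> neighbours E v W"
  shows "g m W = g m (W - {v})"
proof -
  let ?L = "W - {v} - neighbours E v W"
  obtain a b e :: "nat \<Rightarrow> nat" where *: "g 0 W = e 0" "\<And>m. g m (W - {v}) = a m + e m"
      "\<And>m. g m ?L = a m + b m" "\<And>m. g (Suc m) W = b m + e (Suc m)"
    using g_les[OF W(1,3) refl refl] by blast
  \<comment> \<open>Otherwise \<open>v\<close> would be a neighbour of \<open>u\<close> and by
    assumption of itself.\<close>
  have "u \<notin> neighbours E v W"
  proof
    assume "u \<in> neighbours E v W"
    then have "v \<in> neighbours E u W" using W by (simp add: neighbours_def insert_commute)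
    then show False using sub edge_neq by (auto simp: neighbours_def)
  qed
  then have "g m ?L = 0" for m
    using W sub by (intro g_isolated[of _ u]) (auto simp: neighbours_def)
  then have "a m = 0" "b m = 0" for m using *(3)[of m] by simp_all
  then show ?thesis using * by (cases m) auto
qed

text \<open>Deleting \<open>v\<close> isolates \<open>u\<close>, so \<open>W\<close> has the
  cohomology of the link of \<open>v\<close>, shifted by one; this link is what remains without the
  edge.\<close>

lemma g_isolated_edge:
  assumes W: "W \<subseteq> V" "u \<in> W" "v \<in> W" and nb: "neighbours E u W = {v}" "neighbours E v W = {u}"
  shows "g m W = (case m of 0 \<Rightarrow> 0 | Suc m' \<Rightarrow> g m' (W - {u, v}))"
proof -
  let ?L = "W - {v} - neighbours E v W"
  obtain a b e :: "nat \<Rightarrow> nat" where *: "g 0 W = e 0" "\<And>m. g m (W - {v}) = a m + e m"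
      "\<And>m. g m ?L = a m + b m" "\<And>m. g (Suc m) W = b m + e (Suc m)"
    using g_les[OF W(1,3) refl refl] by blast
  have "{u, v} \<in> E" using nb by (auto simp: neighbours_def)
  then have "u \<noteq> v" by (rule edge_neq)
  then have "g m (W - {v}) = 0" for m
    using W nb by (intro g_isolated[of _ u]) (auto simp: neighbours_def)
  then have "a m = 0" "e m = 0" for m using *(2)[of m] by simp_all
  moreover have "?L = W - {u, v}" using nb by auto
  ultimately show ?thesis using *(1,3,4) by (cases m) auto
qed

text \<open>The independence complex consists of \<open>card W\<close> separate points. Its reduced
  cohomology has dimension \<open>card W - 1\<close> and sits in topological degree 0, which is
  index 1 of \<open>g\<close>.\<close>

lemma g_complete:
  assumes "W \<subseteq> V" "W \<noteq> {}" "\<And>u v. u \<in> W \<Longrightarrow> v \<in> W \<Longrightarrow> u \<noteq> v \<Longrightarrow> {u, v} \<in> E"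
  shows "g m W = (if m = 1 then card W - 1 else 0)"
proof -
  have "finite W" using assms finite_V finite_subset by blast
  then show ?thesis using assms(2,1,3)
  proof (induction W arbitrary: m rule: finite_ne_induct)
    case (singleton v)
    then show ?case using edge_neq by (subst g_isolated[of _ v]) (auto simp: neighbours_def dest: edge_neq[of v v, simplified])
  next
    case (insert v S)
    let ?W = "insert v S"
    have S: "?W - {v} = S" using insert.hyps by auto
    have "S \<subseteq> neighbours E v ?W" using insert.prems insert.hyps by (auto simp: neighbours_def)
    then have L: "?W - {v} - neighbours E v ?W = {}" by auto
    obtain a b e :: "nat \<Rightarrow> nat" where *: "g 0 ?W = e 0" "\<And>m. g m S = a m + e m"
        "\<And>m. g m {} = a m + b m" "\<And>m. g (Suc m) ?W = b m + e (Suc m)"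
      using g_les[of ?W v S "{}"] L S insert.prems by auto
    have IH: "g m S = (if m = 1 then card S - 1 else 0)" for m
      using insert.prems by (intro insert.IH) auto
    have "card S \<noteq> 0" using insert.hyps by simp
    moreover have "a 0 = 0" "e 0 = 0" using *(2)[of 0] IH[of 0] by simp_all
    \<comment> \<open>The link of the new point is empty and has a class in index 0. As
      \<open>g 0 S = 0\<close>, this class cannot come from the deletion and yields a new one in
      index 1.\<close>
    moreover have "b 0 = 1" using *(3)[of 0] calculation by (simp add: g_empty)
    moreover have "a (Suc j) = 0" "b (Suc j) = 0" for j using *(3)[of "Suc j"] by (simp_all add: g_empty)
    moreover have "e (Suc j) = (if j = 0 then card S - 1 else 0)" for j
      using *(2)[of "Suc j"] IH[of "Suc j"] calculation by simp
    ultimately have gW: "g 0 ?W = 0" "g (Suc 0) ?W = Suc (card S - 1)" "g (Suc (Suc j)) ?W = 0" for j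
      using *(1) *(4)[of 0] *(4)[of "Suc j"] by simp_all
    have card: "card ?W - 1 = Suc (card S - 1)"
      using \<open>card S \<noteq> 0\<close> insert.hyps(1,3) by (simp del: card_eq_0_iff card_0_eq)
    consider "m = 0" | "m = Suc 0" | j where "m = Suc (Suc j)"
      by (metis not0_implies_Suc)
    then show ?case
    proof cases
      case 2
      then show ?thesis unfolding card using gW(2) by simp
    qed (simp_all add: gW)
  qed
qed

end

section \<open>The strands of a resolution obey the recursion\<close>

context edge_resolution
begin

lemma hom_lesE:
  assumes "v \<notin> S"
  obtains i p d :: "nat \<Rightarrow> nat" where "d 0 = 0"
    "\<And>n. hom n S (\<beta>(v := \<beta> v - 1)) = i n + d (Suc n)" "\<And>n. hom n S \<beta> = i n + p n"
    "\<And>n. hom n (insert v S) \<beta> = p n + d n"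
  using hom_long_exact_sequence[OF assms, of \<beta>] that by (elim exE conjE) simp

text \<open>No monomial has a negative exponent at \<open>v\<close>. Fixing other vertices preserves
  the vanishing, since both remaining terms of each sequence still have the negative
  exponent.\<close>

lemma hom_negative:
  assumes "finite S" "S \<subseteq> V" "vdeg \<beta>" "v \<in> V - S" "\<beta> v < 0"
  shows "hom n S \<beta> = 0"
  using assms
proof (induction S arbitrary: \<beta> n rule: finite_induct)
  case empty
  then have "\<not> 0 \<le> \<beta>" by (auto simp: le_fun_def not_le)
  then show ?case using hom_empty_0 hom_empty_Suc empty by (cases n) auto
next
  case (insert u S)
  obtain i p d :: "nat \<Rightarrow> nat" where *: "d 0 = 0"
      "\<And>n. hom n S (\<beta>(u := \<beta> u - 1)) = i n + d (Suc n)" "\<And>n. hom n S \<beta> = i n + p n"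
      "\<And>n. hom n (insert u S) \<beta> = p n + d n"
    by (rule hom_lesE[of u S \<beta>]) (use insert.hyps in auto)
  have vd: "vdeg (\<beta>(u := \<beta> u - 1))" using insert.prems by (auto simp: vdeg_def)
  have "hom n S (\<beta>(u := \<beta> u - 1)) = 0" for n
    by (rule insert.IH[OF _ vd]) (use insert.prems in auto)
  moreover have "hom n S \<beta> = 0" for n
    using insert.prems by (intro insert.IH) auto
  ultimately have "d (Suc n) = 0" "p n = 0" for n using *(2)[of n] *(3)[of n] by simp_all
  then show ?case using *(1,4) by (cases n) auto
qed

text \<open>The subcomplex in the sequence of \<open>v\<close> has exponent at most -1 there and is
  acyclic, so an exponent 0 may be regarded as fixed or as bounded.\<close>

lemma hom_insert_zero:
  assumes "S \<subseteq> V" "vdeg \<beta>" "v \<in> V - S" "\<beta> v = 0"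
  shows "hom n (insert v S) \<beta> = hom n S \<beta>"
proof -
  obtain i p d :: "nat \<Rightarrow> nat" where *: "d 0 = 0"
      "\<And>n. hom n S (\<beta>(v := \<beta> v - 1)) = i n + d (Suc n)" "\<And>n. hom n S \<beta> = i n + p n"
      "\<And>n. hom n (insert v S) \<beta> = p n + d n"
    by (rule hom_lesE[of v S \<beta>]) (use assms in auto)
  have "hom n S (\<beta>(v := \<beta> v - 1)) = 0" for n
    using assms finite_subset[OF _ finite_V]
    by (intro hom_negative[of _ _ v]) (auto simp: vdeg_def)
  then have "i n = 0" "d (Suc n) = 0" for n using *(2)[of n] by simp_all
  then show ?thesis using *(1,3,4) by (cases n) auto
qed

lemma hom_union_zero:
  assumes "finite Z" "Z \<subseteq> V" "vdeg \<beta>" "\<And>v. v \<in> Z \<Longrightarrow> \<beta> v = 0"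
  shows "hom n Z \<beta> = hom n {} \<beta>"
  using assms
proof (induction Z rule: finite_induct)
  case (insert v Z)
  then show ?case using hom_insert_zero[of Z \<beta> v n] by auto
qed simp

text \<open>Everything outside \<open>T\<close> is fixed, the vertices outside
  \<open>S \<union> T\<close> at exponent 0, which is harmless by \<open>hom_insert_zero\<close>.
  For \<open>T = {}\<close> all exponents are fixed, as \<open>tor_dim_eq_hom\<close>
  demands.\<close>

definition strand_hom :: "nat \<Rightarrow> 'v set \<Rightarrow> 'v set \<Rightarrow> nat" where
  "strand_hom n S T = hom n (V - T) (indicator (S \<union> T))"

lemma vdeg_indicator: "A \<subseteq> V \<Longrightarrow> vdeg (indicator A)"
  by (auto simp: vdeg_def indicator_def)

sublocale strand_homology V E strand_hom
proof
  show "graph_on V E" by (rule graph)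
next
  fix n T assume T: "T \<subseteq> V"
  have "strand_hom n {} T = hom n {} (indicator T)"
    unfolding strand_hom_def using T finite_V
    by (subst hom_union_zero) (auto intro: vdeg_indicator)
  also have "\<dots> = (if n = 0 \<and> independent_set E T then 1 else 0)"
  proof (cases n)
    case 0
    have "(0 :: 'v \<Rightarrow> int) \<le> indicator T" by (simp add: le_fun_def)
    moreover have "(\<exists>e\<in>E. \<forall>v\<in>e. 0 < (indicator T v :: int)) \<longleftrightarrow> (\<exists>e\<in>E. e \<subseteq> T)"
      by (intro bex_cong refl) (auto simp: indicator_def split: if_splits)
    ultimately show ?thesis
      using 0 hom_empty_0[OF vdeg_indicator[OF T]] by (simp add: independent_set_def)
  qed (simp add: hom_empty_Suc[OF vdeg_indicator[OF T]])
  finally show "strand_hom n {} T = (if n = 0 \<and> independent_set E T then 1 else 0)" .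
next
  fix v S T assume a: "v \<in> V" "S \<subseteq> V" "T \<subseteq> V" "S \<inter> T = {}" "v \<notin> S \<union> T"
  \<comment> \<open>The sequence is taken while \<open>v\<close> is still free. In its first term
    the exponent of \<open>v\<close> drops to 0, after which \<open>v\<close> may be counted among
    the fixed vertices.\<close>
  let ?Z = "V - insert v T" and ?\<beta> = "indicator (insert v (S \<union> T)) :: 'v \<Rightarrow> int"
  have \<beta>: "?\<beta>(v := ?\<beta> v - 1) = indicator (S \<union> T)"
    using a by (auto simp: fun_eq_iff indicator_def)
  have Z: "insert v ?Z = V - T" using a by auto
  have "hom n ?Z (indicator (S \<union> T)) = hom n (V - T) (indicator (S \<union> T))" for n
    using hom_insert_zero[of ?Z "indicator (S \<union> T)" v n] a Z by (auto simp: vdeg_indicator)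
  then show "\<exists>i p d :: nat \<Rightarrow> nat. d 0 = 0 \<and> (\<forall>n. strand_hom n S T = i n + d (Suc n) \<and>
      strand_hom n S (insert v T) = i n + p n \<and> strand_hom n (insert v S) T = p n + d n)"
    using hom_long_exact_sequence[of v ?Z ?\<beta>] unfolding \<beta> Z by (simp add: strand_hom_def)
next
  fix S T assume a: "S \<subseteq> V" "T \<subseteq> V" "S \<inter> T = {}" "S \<noteq> {}"
  then obtain v where "v \<in> S" by auto
  then show "strand_hom 0 S T = 0"
    using a unfolding strand_hom_def by (intro hom_0_eq_0[of v]) auto
qed

lemma tor_dim_eq_g:
  assumes "W \<subseteq> V" "W \<noteq> {}"
  shows "tor_dim F i (indicator W) = (if Suc i \<le> card W then g (card W - Suc i) W else 0)"
proof -
  obtain v where "v \<in> W" using assms by auto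
  then have "tor_dim F i (indicator W) = strand_hom (Suc i) W {}"
    using assms by (simp add: tor_dim_eq_hom[of _ v] vdeg_indicator strand_hom_def)
  then show ?thesis using assms by (auto simp: g_def h_large)
qed

end

section \<open>Shifted skew diagrams are convex above the diagonal\<close>

text \<open>Of two cells with the second weakly below and to the right of the first, the rectangle
  they span belongs to the diagram as far as it lies above the diagonal. This is all that is kept of
  the two partitions.\<close>

definition shifted_convex :: "(nat \<times> nat) set \<Rightarrow> bool" where
  "shifted_convex D \<longleftrightarrow> (\<forall>(i, j)\<in>D. i < j) \<and>
     (\<forall>i j i' j' x y. (i, j) \<in> D \<longrightarrow> (i', j') \<in> D \<longrightarrow> i \<le> x \<longrightarrow> x \<le> i' \<longrightarrow> j \<le> y \<longrightarrow> y \<le> j' \<longrightarrow>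
        x < y \<longrightarrow> (x, y) \<in> D)"

text \<open>The shift by the row index is offset by strict decrease: going down, both boundaries of
  the rows move weakly to the left.\<close>

lemma strict_decreasing_plus_antimono:
  fixes f :: "nat \<Rightarrow> nat"
  assumes "\<forall>i\<in>{1..<l}. f (Suc i) < f i" "1 \<le> i" "i \<le> j" "j \<le> l"
  shows "j + f j \<le> i + f i"
  using assms(3,4)
proof (induction j rule: dec_induct)
  case (step j)
  then have "f (Suc j) < f j" using assms(1,2) by auto
  then show ?case using step by simp
qed simp

lemma shifted_skew_diagram_convex:
  assumes "shifted_skew_diagram D"
  shows "shifted_convex D"
proof -
  obtain l r :: nat and lam mu :: "nat \<Rightarrow> nat" where lr: "r \<le> l"
    and lam: "\<forall>i\<in>{1..<l}. lam (Suc i) < lam i" and mu: "\<forall>i\<in>{1..<r}. mu (Suc i) < mu i"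
    and mu0: "\<forall>i>r. mu i = 0"
    and D: "D = {(i, j). 1 \<le> i \<and> i \<le> l \<and> i + mu i + 1 \<le> j \<and> j \<le> i + lam i}"
    using assms unfolding shifted_skew_diagram_def by blast
  have convex: "(x, y) \<in> D" if h: "(i, j) \<in> D" "(i', j') \<in> D" "i \<le> x" "x \<le> i'" "j \<le> y" "y \<le> j'" "x < y"
    for i j i' j' x y
  proof -
    have x: "1 \<le> i" "1 \<le> x" "x \<le> l" "i' \<le> l" using h by (auto simp: D)
    have "i' + lam i' \<le> x + lam x"
      using strict_decreasing_plus_antimono[OF lam, of x i'] x h by simp
    then have "y \<le> x + lam x" using h by (simp add: D)
    \<comment> \<open>In rows beyond \<open>r\<close> the left boundary is the diagonal itself, and
      the bound is just \<open>x < y\<close>.\<close>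
    moreover have "x + mu x + 1 \<le> y"
    proof (cases "x \<le> r")
      case True
      then have "x + mu x \<le> i + mu i"
        using strict_decreasing_plus_antimono[OF mu, of i x] x h by simp
      then show ?thesis using h by (simp add: D)
    qed (use mu0 h in auto)
    ultimately show ?thesis using x by (simp add: D)
  qed
  show ?thesis
    unfolding shifted_convex_def
  proof (intro conjI)
    show "\<forall>(i, j)\<in>D. i < j" by (auto simp: D)
  qed (intro allI impI, rule convex)
qed

lemma shifted_convex_less: "shifted_convex D \<Longrightarrow> (i, j) \<in> D \<Longrightarrow> i < j"
  by (auto simp: shifted_convex_def)

lemma shifted_convexD:
  assumes "shifted_convex D" "(i, j) \<in> D" "(i', j') \<in> D" "i \<le> x" "x \<le> i'" "j \<le> y" "y \<le> j'" "x < y"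
  shows "(x, y) \<in> D"
  using assms(1)[unfolded shifted_convex_def, THEN conjunct2, rule_format, OF assms(2,3)] assms(4-) by simp

section \<open>Steps of the rectangular decomposition\<close>

text \<open>The early exit with nothing to remove cannot occur: a cell in the first row and a cell
  in the last column force the top cell by convexity.\<close>

lemma rect_decomp_no_top:
  assumes "finite X" "finite Y" "\<not> (X = {} \<and> Y = {})"
    and "\<not> (X \<noteq> {} \<and> Y \<noteq> {} \<and> (Min X, Max Y) \<in> D)" and D: "shifted_convex D"
    and X': "X' = {x\<in>X. cells D {z\<in>X. z \<le> x} Y = {}}"
    and Y': "Y' = {y\<in>Y. cells D X {z\<in>Y. y \<le> z} = {}}"
  shows "\<not> (X' = {} \<and> Y' = {})"
    and "rect_decomp D X Y = (Empty_Rect X' Y' # fst (rect_decomp D (X - X') (Y - Y')),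
      snd (rect_decomp D (X - X') (Y - Y')))"
proof -
  show ne: "\<not> (X' = {} \<and> Y' = {})"
  proof (cases "X = {} \<or> Y = {}")
    case True
    then show ?thesis using assms(3) unfolding X' Y' cells_def by auto
  next
    case False
    show ?thesis
    proof
      assume "X' = {} \<and> Y' = {}"
      then have XY: "X' = {}" "Y' = {}" by auto
      have mem: "Min X \<in> X" "Max Y \<in> Y" using False assms(1,2) by simp_all
      have eq: "{z\<in>X. z \<le> Min X} = {Min X}" "{z\<in>Y. Max Y \<le> z} = {Max Y}"
        using mem Min_le[OF assms(1)] Max_ge[OF assms(2)] by (auto intro: antisym)
      then have "cells D {z\<in>X. z \<le> Min X} Y \<noteq> {}" "cells D X {z\<in>Y. Max Y \<le> z} \<noteq> {}"
        using XY mem unfolding X' Y' by blast+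
      then have "cells D {Min X} Y \<noteq> {}" "cells D X {Max Y} \<noteq> {}"
        unfolding eq .
      then obtain x y where xy: "y \<in> Y" "(Min X, y) \<in> D" "x \<in> X" "(x, Max Y) \<in> D"
        unfolding cells_def by auto
      then have le: "Min X \<le> x" "y \<le> Max Y" using assms by auto
      moreover have "Min X < y" using shifted_convex_less[OF D] xy by auto
      ultimately have "(Min X, Max Y) \<in> D"
        by (intro shifted_convexD[OF D xy(2,4)]) auto
      then show False using False assms by auto
    qed
  qed
  have "rect_decomp D X Y = (let X' = {x\<in>X. cells D {z\<in>X. z \<le> x} Y = {}};
           Y' = {y\<in>Y. cells D X {z\<in>Y. y \<le> z} = {}}
       in if X' = {} \<and> Y' = {} then ([], {})
          else let R = rect_decomp D (X - X') (Y - Y')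
               in (Empty_Rect X' Y' # fst R, snd R))"
    using assms(1-4) by (subst rect_decomp.simps) (simp only: simp_thms if_False if_True)
  then show "rect_decomp D X Y = (Empty_Rect X' Y' # fst (rect_decomp D (X - X') (Y - Y')),
      snd (rect_decomp D (X - X') (Y - Y')))"
    unfolding X'[symmetric] Y'[symmetric] Let_def using ne by (simp only: if_False)
qed

lemma rect_decomp_top:
  assumes "finite X" "finite Y" "X \<noteq> {}" "Y \<noteq> {}" "(Min X, Max Y) \<in> D"
    and m': "m' = Max {x\<in>X. (x, Max Y) \<in> D}" and n': "n' = Min {y\<in>Y. (Min X, y) \<in> D}"
    and X': "X' = {x\<in>X. x \<le> m'}" and Y': "Y' = {y\<in>Y. n' \<le> y}"
  shows "rect_decomp D X Y = (if (m', n') \<in> D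
    then (Full_Rect X' Y' # fst (rect_decomp D (X - X') (Y - Y')),
      cells D (X - X') Y' \<union> cells D X' (Y - Y') \<union> snd (rect_decomp D (X - X') (Y - Y')))
    else ([Pedestal X' Y'], cells D (X - X') Y' \<union> cells D X' (Y - Y')))"
  using assms(1-5)
  by (subst rect_decomp.simps)
    (simp only: Let_def m'[symmetric] n'[symmetric] X'[symmetric] Y'[symmetric] simp_thms
      if_False if_True)

lemma rect_decomp_empty: "rect_decomp D {} {} = ([], {})"
  by (subst rect_decomp.simps) simp

locale top_cell =
  fixes D :: "(nat \<times> nat) set" and X Y :: "nat set"
  assumes convex: "shifted_convex D"
    and fin: "finite X" "finite Y" and ne: "X \<noteq> {}" "Y \<noteq> {}" and top: "(Min X, Max Y) \<in> D"
begin

definition m' where "m' = Max {x\<in>X. (x, Max Y) \<in> D}"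
definition n' where "n' = Min {y\<in>Y. (Min X, y) \<in> D}"
definition P where "P = {x\<in>X. x \<le> m'}"
definition Q where "Q = {y\<in>Y. n' \<le> y}"

lemma m': "m' \<in> X" "(m', Max Y) \<in> D" "\<And>x. x \<in> X \<Longrightarrow> (x, Max Y) \<in> D \<Longrightarrow> x \<le> m'"
proof -
  have "finite {x\<in>X. (x, Max Y) \<in> D}" "{x\<in>X. (x, Max Y) \<in> D} \<noteq> {}"
    using fin top Max_in[OF fin(2) ne(2)] Min_in[OF fin(1) ne(1)] by auto
  from Max_in[OF this] Max_ge[OF this(1)]
  show "m' \<in> X" "(m', Max Y) \<in> D" "\<And>x. x \<in> X \<Longrightarrow> (x, Max Y) \<in> D \<Longrightarrow> x \<le> m'"
    unfolding m'_def by auto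
qed

lemma n': "n' \<in> Y" "(Min X, n') \<in> D" "\<And>y. y \<in> Y \<Longrightarrow> (Min X, y) \<in> D \<Longrightarrow> n' \<le> y"
proof -
  have "finite {y\<in>Y. (Min X, y) \<in> D}" "{y\<in>Y. (Min X, y) \<in> D} \<noteq> {}"
    using fin top Max_in[OF fin(2) ne(2)] Min_in[OF fin(1) ne(1)] by auto
  from Min_in[OF this] Min_le[OF this(1)]
  show "n' \<in> Y" "(Min X, n') \<in> D" "\<And>y. y \<in> Y \<Longrightarrow> (Min X, y) \<in> D \<Longrightarrow> n' \<le> y"
    unfolding n'_def by auto
qed

lemma Min_X: "Min X \<in> X" "\<And>x. x \<in> X \<Longrightarrow> Min X \<le> x" and Max_Y: "Max Y \<in> Y" "\<And>y. y \<in> Y \<Longrightarrow> y \<le> Max Y"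
  using fin ne by auto

lemma Min_X_in_P: "Min X \<in> P" and Max_Y_in_Q: "Max Y \<in> Q"
  using Min_X Max_Y m' n' by (auto simp: P_def Q_def)

lemma row_top: "y \<in> Y \<Longrightarrow> (Min X, y) \<in> D \<longleftrightarrow> y \<in> Q"
  using n' top shifted_convexD[OF convex n'(2) top, of "Min X" y] shifted_convex_less[OF convex n'(2)]
    Max_Y by (auto simp: Q_def)

lemma column_top: "x \<in> X \<Longrightarrow> (x, Max Y) \<in> D \<longleftrightarrow> x \<in> P"
  using m' top shifted_convexD[OF convex top m'(2), of x "Max Y"] shifted_convex_less[OF convex m'(2)]
    Min_X by (auto simp: P_def)

text \<open>Convexity between the leftmost cell of the first row and the cell of row
  \<open>x\<close> in the last column. So the block lacks only positions on or below the diagonal,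
  and \<open>full_iff\<close> says that a pedestal is a block that the diagonal enters.\<close>

lemma block_cell:
  assumes "x \<in> P" "y \<in> Q" "x < y"
  shows "(x, y) \<in> D"
proof -
  have "(x, Max Y) \<in> D" using assms column_top by (auto simp: P_def)
  then show ?thesis
    using shifted_convexD[OF convex n'(2), of x "Max Y" x y] assms Min_X Max_Y
    by (auto simp: P_def Q_def)
qed

lemma full_iff: "(m', n') \<in> D \<longleftrightarrow> m' < n'"
  using block_cell[of m' n'] m' n' shifted_convex_less[OF convex] by (auto simp: P_def Q_def)

lemmas decomp = rect_decomp_top[OF fin ne top m'_def n'_def P_def Q_def]

end

section \<open>Reductions of the graph\<close>

lemma neighbours_Diff: "neighbours E v (W - R) = neighbours E v W - R"
  by (auto simp: neighbours_def)

context strand_homology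
begin

lemma g_fold_set:
  assumes "finite R" "W \<subseteq> V" "u \<in> W" "R \<subseteq> W - {u}"
    and "\<And>v. v \<in> R \<Longrightarrow> neighbours E u W \<subseteq> neighbours E v W"
  shows "g m W = g m (W - R)"
  using assms
proof (induction R rule: finite_induct)
  case (insert v R)
  have "g m W = g m (W - R)" using insert.prems by (intro insert.IH) auto
  also have "\<dots> = g m (W - R - {v})"
  proof (rule g_fold)
    show "neighbours E u (W - R) \<subseteq> neighbours E v (W - R)"
      using insert.prems(4)[of v] unfolding neighbours_Diff by blast
  qed (use insert.prems insert.hyps in auto)
  also have "W - R - {v} = W - insert v R" by auto
  finally show ?case .
qed simp

text \<open>Vertices of the block may have further neighbours, given by excess cells; only
  \<open>p\<close> and \<open>q\<close> are required to have none. The others fold onto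
  \<open>p\<close> or \<open>q\<close>, and their excess edges disappear with them.\<close>

lemma g_rectangle:
  assumes W: "W \<subseteq> V" and PQ: "P \<subseteq> W" "Q \<subseteq> W" "P \<inter> Q = {}" "p \<in> P" "q \<in> Q"
    and nb: "neighbours E p W = Q" "neighbours E q W = P"
    and full: "\<And>u v. u \<in> P \<Longrightarrow> v \<in> Q \<Longrightarrow> {u, v} \<in> E"
  shows "g m W = (case m of 0 \<Rightarrow> 0 | Suc m' \<Rightarrow> g m' (W - P - Q))"
proof -
  have fin: "finite P" "finite Q" using finite_V W PQ by (auto intro: finite_subset)
  let ?W1 = "W - (P - {p})" and ?W2 = "W - (P - {p}) - (Q - {q})"
  have QP: "Q \<subseteq> neighbours E v W" if "v \<in> P" for v
    using full[OF that] PQ(2) by (auto simp: neighbours_def)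
  have PQ': "P \<subseteq> neighbours E v W" if "v \<in> Q" for v
    using full[OF _ that] PQ(1) by (auto simp: neighbours_def insert_commute)
  have "g m W = g m ?W1"
  proof (rule g_fold_set[of _ _ p])
    show "neighbours E p W \<subseteq> neighbours E v W" if "v \<in> P - {p}" for v
      using QP that unfolding nb by auto
  qed (use fin W PQ in auto)
  also have "\<dots> = g m ?W2"
  proof (rule g_fold_set[of _ _ q])
    show "neighbours E q ?W1 \<subseteq> neighbours E v ?W1" if "v \<in> Q - {q}" for v
      using PQ' that unfolding neighbours_Diff nb by auto
  qed (use fin W PQ in auto)
  also have "\<dots> = (case m of 0 \<Rightarrow> 0 | Suc m' \<Rightarrow> g m' (?W2 - {p, q}))"
  proof (rule g_isolated_edge)
    show "neighbours E p ?W2 = {q}" "neighbours E q ?W2 = {p}"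
      unfolding neighbours_Diff nb using PQ by auto
  qed (use W PQ in auto)
  also have "?W2 - {p, q} = W - P - Q" using PQ by auto
  finally show ?thesis .
qed

end

section \<open>The bipartite graph\<close>

lemma bip_edges_iff [simp]:
  "{Inl x, Inr y} \<in> bip_edges D X Y \<longleftrightarrow> (x, y) \<in> D \<and> x \<in> X \<and> y \<in> Y"
  "{Inr y, Inl x} \<in> bip_edges D X Y \<longleftrightarrow> (x, y) \<in> D \<and> x \<in> X \<and> y \<in> Y"
  "{Inl x, Inl x'} \<notin> bip_edges D X Y" "{Inr y, Inr y'} \<notin> bip_edges D X Y"
  by (auto simp: bip_edges_def cells_def doubleton_eq_iff)

lemma graph_on_bip: "finite X \<Longrightarrow> finite Y \<Longrightarrow> graph_on (X <+> Y) (bip_edges D X Y)"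
  by (auto simp: graph_on_def bip_edges_def cells_def)

lemma neighbours_bip:
  assumes "A \<subseteq> X" "B \<subseteq> Y"
  shows "x \<in> X \<Longrightarrow> neighbours (bip_edges D X Y) (Inl x) (A <+> B) = Inr ` {y\<in>B. (x, y) \<in> D}"
    and "y \<in> Y \<Longrightarrow> neighbours (bip_edges D X Y) (Inr y) (A <+> B) = Inl ` {x\<in>A. (x, y) \<in> D}"
  using assms by (auto simp: neighbours_def)

locale bip_homology = strand_homology "X <+> Y" "bip_edges D X Y" h
  for X Y :: "nat set" and D :: "(nat \<times> nat) set" and h +
  assumes convex: "shifted_convex D" and fin: "finite X" "finite Y"
begin

lemma g_bip_full:
  assumes sub: "A \<subseteq> X" "B \<subseteq> Y" and "top_cell D A B" and "(top_cell.m' D A B, top_cell.n' D A B) \<in> D"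
  shows "g m (A <+> B) = (case m of 0 \<Rightarrow> 0 | Suc m' \<Rightarrow>
    g m' ((A - top_cell.P D A B) <+> (B - top_cell.Q D A B)))"
proof -
  interpret top_cell D A B by fact
  have "P \<subseteq> A" "Q \<subseteq> B" by (auto simp: P_def Q_def)
  have less: "x < y" if "x \<in> P" "y \<in> Q" for x y
    using that full_iff assms(4) by (auto simp: P_def Q_def)
  have "g m (A <+> B) = (case m of 0 \<Rightarrow> 0 | Suc j \<Rightarrow> g j ((A <+> B) - Inl ` P - Inr ` Q))"
  proof (rule g_rectangle)
    show "neighbours (bip_edges D X Y) (Inl (Min A)) (A <+> B) = Inr ` Q"
      unfolding neighbours_bip(1)[OF sub subsetD[OF sub(1) Min_X(1)]] using row_top \<open>Q \<subseteq> B\<close> by auto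
    show "neighbours (bip_edges D X Y) (Inr (Max B)) (A <+> B) = Inl ` P"
      unfolding neighbours_bip(2)[OF sub subsetD[OF sub(2) Max_Y(1)]] using column_top \<open>P \<subseteq> A\<close> by auto
    show "{u, v} \<in> bip_edges D X Y" if uv: "u \<in> Inl ` P" "v \<in> Inr ` Q" for u v
    proof -
      obtain x y where xy: "u = Inl x" "v = Inr y" "x \<in> P" "y \<in> Q" using uv by auto
      then have "x \<in> X" "y \<in> Y" using sub \<open>P \<subseteq> A\<close> \<open>Q \<subseteq> B\<close> by blast+
      then show ?thesis using xy block_cell[OF _ _ less] by simp
    qed
    show "Inl (Min A) \<in> Inl ` P" "Inr (Max B) \<in> Inr ` Q" using Min_X_in_P Max_Y_in_Q by auto
  qed (use sub \<open>P \<subseteq> A\<close> \<open>Q \<subseteq> B\<close> in auto)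
  also have "(A <+> B) - Inl ` P - Inr ` Q = (A - P) <+> (B - Q)" by auto
  finally show ?thesis .
qed

text \<open>After folding the columns to the right of \<open>m'\<close> onto the last one, row \<open>m'\<close> has a single
  neighbour left; folding the remaining rows of the pedestal onto it isolates column \<open>n'\<close>.\<close>

lemma g_bip_pedestal:
  assumes sub: "A \<subseteq> X" "B \<subseteq> Y" and "top_cell D A B" and "(top_cell.m' D A B, top_cell.n' D A B) \<notin> D"
  shows "g m (A <+> B) = 0"
proof -
  interpret top_cell D A B by fact
  have le: "n' \<le> m'" using full_iff assms(4) by auto
  have finA: "finite A" "finite B" using sub fin by (auto intro: finite_subset)
  have PA: "P \<subseteq> A" and QB: "Q \<subseteq> B" by (auto simp: P_def Q_def)
  have n'Y: "n' \<in> Y" "n' \<in> B" and m'X: "m' \<in> X" "m' \<in> A" "m' \<in> P"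
    using n' m' sub by (auto simp: P_def)
  define B1 where "B1 = {y\<in>B. m' < y \<and> y \<noteq> Max B}"
  let ?W = "A <+> B" and ?W1 = "A <+> (B - B1)" and ?W2 = "(A - (P - {m'})) <+> (B - B1)"
  have B1: "y \<in> Q \<and> y \<in> Y" if "y \<in> B1" for y using that le sub by (auto simp: B1_def Q_def)
  have "g m ?W = g m (?W - Inr ` B1)"
  proof (rule g_fold_set)
    fix v :: "nat + nat" assume "v \<in> Inr ` B1"
    then obtain y where y: "y \<in> B1" "v = Inr y" by auto
    have "(x, y) \<in> D" if "x \<in> P" for x
      using that B1[OF y(1)] y by (intro block_cell) (auto simp: B1_def P_def)
    then show "neighbours (bip_edges D X Y) (Inr (Max B)) ?W \<subseteq> neighbours (bip_edges D X Y) v ?W"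
      unfolding y(2) neighbours_bip(2)[OF sub subsetD[OF sub(2) Max_Y(1)]]
        neighbours_bip(2)[OF sub conjunct2[OF B1[OF y(1)]]]
      using column_top by auto
  qed (use sub finA Max_Y in \<open>auto simp: B1_def\<close>)
  also have "?W - Inr ` B1 = ?W1" by auto
  also have "g m ?W1 = g m (?W1 - Inl ` (P - {m'}))"
  proof (rule g_fold_set)
    fix v :: "nat + nat" assume "v \<in> Inl ` (P - {m'})"
    then obtain x where x: "x \<in> P" "v = Inl x" by auto
    \<comment> \<open>Cells lie above the diagonal, so row \<open>m'\<close> meets only columns
      beyond \<open>m'\<close>, and of these only the last is left.\<close>
    have 1: "neighbours (bip_edges D X Y) (Inl m') ?W1 \<subseteq> {Inr (Max B)}"
      using shifted_convex_less[OF convex] m'X sub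
      by (subst neighbours_bip(1)) (auto simp: B1_def)
    have "(x, Max B) \<in> D" using x PA column_top by auto
    then have "Inr (Max B) \<in> neighbours (bip_edges D X Y) v ?W1"
      using x PA sub Max_Y by (auto simp: neighbours_def B1_def)
    with 1 show "neighbours (bip_edges D X Y) (Inl m') ?W1 \<subseteq> neighbours (bip_edges D X Y) v ?W1"
      by auto
  qed (use sub finA m'X PA in \<open>auto intro: finite_subset\<close>)
  also have "?W1 - Inl ` (P - {m'}) = ?W2" by auto
  also have "g m ?W2 = 0"
  proof (rule g_isolated)
    show "Inr n' \<in> ?W2" using n'Y le by (auto simp: B1_def)
    \<comment> \<open>All rows that are left have index at least \<open>m'\<close>, hence at least
      \<open>n'\<close>, and lie below every possible cell of column \<open>n'\<close>.\<close>
    have "(x, n') \<notin> D" if "x \<in> A - (P - {m'})" for x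
      using that le shifted_convex_less[OF convex, of x n'] by (auto simp: P_def)
    then show "neighbours (bip_edges D X Y) (Inr n') ?W2 = {}"
      using sub n'Y by (subst neighbours_bip(2)) auto
  qed (use sub in auto)
  finally show ?thesis .
qed

text \<open>Each full rectangle raises both \<open>rect\<close> and the index of \<open>g\<close> by
  one. In the other two cases \<open>g\<close> vanishes, and these are the cases that break
  sphericality.\<close>

theorem g_bip:
  assumes "A \<subseteq> X" "B \<subseteq> Y"
  shows "g m (A <+> B) = (if spherical D A B \<and> rect D A B = m then 1 else 0)"
  using assms
proof (induction "card A + card B" arbitrary: A B m rule: less_induct)
  case less
  have finAB: "finite A" "finite B" using less.prems fin by (auto intro: finite_subset)
  consider "A = {} \<and> B = {}" | "\<not> (A = {} \<and> B = {})" "\<not> (A \<noteq> {} \<and> B \<noteq> {} \<and> (Min A, Max B) \<in> D)"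
    | "top_cell D A B"
    using convex finAB by (auto simp: top_cell_def)
  then show ?case
  proof cases
    case 1
    then have "A <+> B = {}" by auto
    then have "g m (A <+> B) = (if m = 0 then 1 else 0)" by (simp only: g_empty)
    then show ?thesis using 1 by (auto simp: spherical_def rect_def blocks_def rect_decomp_empty)
  next
    case 2
    let ?A = "{x\<in>A. cells D {z\<in>A. z \<le> x} B = {}}" and ?B = "{y\<in>B. cells D A {z\<in>B. y \<le> z} = {}}"
    note dec = rect_decomp_no_top[OF finAB 2 convex refl refl]
    have "\<not> spherical D A B" by (simp add: spherical_def blocks_def dec(2))
    \<comment> \<open>An empty rectangle contributes a row or a column without cells, which is an
      isolated vertex.\<close>
    moreover have "g m (A <+> B) = 0"
    proof (cases "?A = {}")
      case True
      then obtain y where y: "y \<in> B" "cells D A {z\<in>B. y \<le> z} = {}" using dec(1) by blast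
      then have "{x\<in>A. (x, y) \<in> D} = {}" by (auto simp: cells_def)
      then show ?thesis
        using y less.prems neighbours_bip(2)[OF less.prems, of y D] by (intro g_isolated[of _ "Inr y"]) auto
    next
      case False
      then obtain x where x: "x \<in> A" "cells D {z\<in>A. z \<le> x} B = {}" by blast
      then have "{y\<in>B. (x, y) \<in> D} = {}" by (auto simp: cells_def)
      then show ?thesis
        using x less.prems neighbours_bip(1)[OF less.prems, of x D] by (intro g_isolated[of _ "Inl x"]) auto
    qed
    ultimately show ?thesis by simp
  next
    case 3
    then interpret top_cell D A B .
    show ?thesis
    proof (cases "(m', n') \<in> D")
      case True
      have "card (A - P) < card A" "card (B - Q) \<le> card B"
        using Min_X_in_P Min_X(1) finAB by (auto intro: psubset_card_mono card_mono)
      then have "g j ((A - P) <+> (B - Q)) =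
          (if spherical D (A - P) (B - Q) \<and> rect D (A - P) (B - Q) = j then 1 else 0)" for j
        using less.prems by (intro less.hyps) auto
      then show ?thesis
        using g_bip_full[OF less.prems 3 True, of m] True
        by (auto simp: spherical_def blocks_def rect_def decomp split: nat.splits)
    next
      case False
      then show ?thesis
        using g_bip_pedestal[OF less.prems 3 False, of m]
        by (simp add: spherical_def blocks_def decomp)
    qed
  qed
qed

end

section \<open>The nonbipartite graph\<close>

lemma nonbip_edges_iff:
  "{x, y} \<in> nonbip_edges D X \<longleftrightarrow> x \<in> X \<and> y \<in> X \<and> ((x, y) \<in> D \<or> (y, x) \<in> D)"
  by (auto simp: nonbip_edges_def cells_def doubleton_eq_iff)

lemma graph_on_nonbip:
  assumes "finite X" "shifted_convex D"
  shows "graph_on X (nonbip_edges D X)"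
  unfolding graph_on_def
proof (intro conjI ballI assms(1))
  fix e assume "e \<in> nonbip_edges D X"
  then obtain x y where "e = {x, y}" "(x, y) \<in> D" "x \<in> X" "y \<in> X"
    by (auto simp: nonbip_edges_def cells_def)
  then show "\<exists>u v. e = {u, v} \<and> u \<noteq> v \<and> u \<in> X \<and> v \<in> X"
    using shifted_convex_less[OF assms(2), of x y] by (intro exI[of _ x] exI[of _ y]) auto
qed

text \<open>Removing a full rectangle from the rows and columns \<open>M\<close> leaves rows \<open>M' \<union> B\<close> and columns
  \<open>A \<union> M'\<close> with \<open>A < M' < B\<close>; the added rows and columns contain no cells.\<close>

locale padded_diagram =
  fixes D :: "(nat \<times> nat) set" and M A B :: "nat set"
  assumes convex: "shifted_convex D"
    and pad_fin: "finite M" "finite A" "finite B" and pad_ne: "M \<noteq> {}"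
    and AM: "\<And>a x. a \<in> A \<Longrightarrow> x \<in> M \<Longrightarrow> a < x" and MB: "\<And>x b. x \<in> M \<Longrightarrow> b \<in> B \<Longrightarrow> x < b"
begin

lemma Min_rows: "Min (M \<union> B) = Min M"
proof (rule Min_eqI)
  show "Min M \<le> y" if "y \<in> M \<union> B" for y
    using that pad_fin MB[OF Min_in[OF pad_fin(1) pad_ne]] by (auto intro: less_imp_le)
qed (use pad_fin pad_ne in auto)

lemma Max_columns: "Max (A \<union> M) = Max M"
proof (rule Max_eqI)
  show "y \<le> Max M" if "y \<in> A \<union> M" for y
    using that pad_fin AM[OF _ Max_in[OF pad_fin(1) pad_ne]] by (auto intro: less_imp_le)
qed (use pad_fin pad_ne in auto)

end

locale padded_top_cell = padded_diagram +
  assumes top: "(Min M, Max M) \<in> D"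
begin

sublocale top_cell D "M \<union> B" "A \<union> M"
  using convex pad_fin pad_ne top by unfold_locales (simp_all add: Min_rows Max_columns)

lemma Min_M: "Min M \<in> M" "Min M \<in> P" and Max_M: "Max M \<in> M" "Max M \<in> Q"
  using pad_fin pad_ne Min_X_in_P Max_Y_in_Q unfolding Min_rows Max_columns by simp_all

text \<open>Cells lie above the diagonal, so no row in \<open>B\<close> meets column
  \<open>Max M\<close>. With \<open>n'_in_M\<close> this keeps the padding out of the block.\<close>

lemma m'_in_M: "m' \<in> M"
proof (rule ccontr)
  assume "m' \<notin> M"
  then have "m' \<in> B" using m'(1) by auto
  then show False
    using MB[OF Max_M(1)] shifted_convex_less[OF convex m'(2)] unfolding Max_columns by fastforce
qed

lemma n'_in_M: "n' \<in> M"
proof (rule ccontr)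
  assume "n' \<notin> M"
  then have "n' \<in> A" using n'(1) by auto
  then show False
    using AM[OF _ Min_M(1)] shifted_convex_less[OF convex n'(2)] unfolding Min_rows by fastforce
qed

lemma P_eq: "P = {x\<in>M. x \<le> m'}"
  using MB[OF m'_in_M] unfolding P_def by fastforce

lemma Q_eq: "Q = {y\<in>M. n' \<le> y}"
  using AM[OF _ n'_in_M] unfolding Q_def by fastforce

lemma row_top_M: "y \<in> M \<Longrightarrow> (Min M, y) \<in> D \<longleftrightarrow> y \<in> Q"
  using row_top[of y] unfolding Min_rows by auto

lemma column_top_M: "x \<in> M \<Longrightarrow> (x, Max M) \<in> D \<longleftrightarrow> x \<in> P"
  using column_top[of x] unfolding Max_columns by auto

lemma not_below_Min: "x \<in> M \<Longrightarrow> (x, Min M) \<notin> D"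
  using shifted_convex_less[OF convex, of x "Min M"] Min_le[OF pad_fin(1), of x] by auto

lemma not_above_Max: "y \<in> M \<Longrightarrow> (Max M, y) \<notin> D"
  using shifted_convex_less[OF convex, of "Max M" y] Max_ge[OF pad_fin(1), of y] by auto

end

lemma staircase_cells_iff:
  "(x, y) \<in> staircase_cells D M \<longleftrightarrow>
     (x, y) \<in> D \<and> x \<in> M \<and> y \<in> M \<and> x < y \<and> (\<forall>z\<in>M. \<not> (x < z \<and> z < y))"
  by (auto simp: staircase_cells_def cells_def)

locale nonbip_homology = strand_homology X "nonbip_edges D X" h
  for X :: "nat set" and D :: "(nat \<times> nat) set" and h +
  assumes convex: "shifted_convex D" and finX: "finite X"
begin

abbreviation nbs :: "nat \<Rightarrow> nat set \<Rightarrow> nat set" where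
  "nbs \<equiv> neighbours (nonbip_edges D X)"

lemma nbs_eq: "M \<subseteq> X \<Longrightarrow> x \<in> M \<Longrightarrow> nbs x M = {y\<in>M. (x, y) \<in> D \<or> (y, x) \<in> D}"
  by (auto simp: neighbours_def nonbip_edges_iff)

text \<open>A vertex is now both a row and a column. Within \<open>M\<close> the column of
  \<open>Min M\<close> and the row of \<open>Max M\<close> are empty, so these two behave as in the
  bipartite graph and can serve as \<open>p\<close> and \<open>q\<close>.\<close>

lemma nbs_extremes:
  assumes "M \<subseteq> X" "padded_top_cell D M A B"
  shows "nbs (Min M) M = top_cell.Q D (M \<union> B) (A \<union> M)"
    and "nbs (Max M) M = top_cell.P D (M \<union> B) (A \<union> M)"
proof -
  interpret padded_top_cell D M A B by fact
  show "nbs (Min M) M = Q"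
    using row_top_M not_below_Min by (auto simp: nbs_eq[OF assms(1) Min_M(1)] Q_eq)
  show "nbs (Max M) M = P"
    using column_top_M not_above_Max by (auto simp: nbs_eq[OF assms(1) Max_M(1)] P_eq)
qed

lemma g_nonbip_full:
  assumes sub: "M \<subseteq> X" and "padded_top_cell D M A B"
    and full: "(top_cell.m' D (M \<union> B) (A \<union> M), top_cell.n' D (M \<union> B) (A \<union> M)) \<in> D"
  shows "g m M = (case m of 0 \<Rightarrow> 0 | Suc j \<Rightarrow>
    g j (M - top_cell.P D (M \<union> B) (A \<union> M) - top_cell.Q D (M \<union> B) (A \<union> M)))"
proof -
  interpret padded_top_cell D M A B by fact
  have lt: "x < y" if "x \<in> P" "y \<in> Q" for x y
    using that full_iff full by (auto simp: P_def Q_def)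
  have PM: "P \<subseteq> M" and QM: "Q \<subseteq> M" by (auto simp: P_eq Q_eq)
  show ?thesis
  proof (rule g_rectangle[OF sub PM QM])
    show "P \<inter> Q = {}" using lt by blast
    show "{u, v} \<in> nonbip_edges D X" if "u \<in> P" "v \<in> Q" for u v
    proof -
      have "u \<in> X" "v \<in> X" using that PM QM sub by auto
      then show ?thesis using block_cell[OF that lt[OF that]] by (simp add: nonbip_edges_iff)
    qed
  qed (use Min_M Max_M nbs_extremes[OF assms(1,2)] in auto)
qed

text \<open>Folding reduces a pedestal to the complete graph on its diagonal part \<open>n', \<dots>, m'\<close> and the
  two extreme vertices.\<close>

lemma g_nonbip_pedestal:
  assumes sub: "M \<subseteq> X" and "padded_top_cell D M A B"
    and "(top_cell.m' D (M \<union> B) (A \<union> M), top_cell.n' D (M \<union> B) (A \<union> M)) \<notin> D"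
  shows "g m M = (if m = 1 then Suc (card
    {x\<in>M. top_cell.n' D (M \<union> B) (A \<union> M) \<le> x \<and> x \<le> top_cell.m' D (M \<union> B) (A \<union> M)}) else 0)"
proof -
  interpret padded_top_cell D M A B by fact
  have le: "n' \<le> m'" using full_iff assms(3) by auto
  have PM: "P \<subseteq> M" and QM: "Q \<subseteq> M" by (auto simp: P_eq Q_eq)
  have bounds: "Min M < n'" "m' < Max M"
    using shifted_convex_less[OF convex n'(2)] shifted_convex_less[OF convex m'(2)]
    unfolding Min_rows Max_columns by auto
  \<comment> \<open>\<open>C\<close> is the set of vertices that are both rows and columns of the
    pedestal. Other rows fold onto \<open>Min M\<close>, other columns onto
    \<open>Max M\<close>.\<close>
  define C where "C = {x\<in>M. n' \<le> x \<and> x \<le> m'}"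
  define L where "L = {x\<in>M. x < n' \<and> x \<noteq> Min M}"
  define R where "R = {x\<in>M. m' < x \<and> x \<noteq> Max M}"
  have finC: "finite C" "finite L" "finite R" using pad_fin by (auto simp: C_def L_def R_def)
  have LP: "L \<subseteq> P - {Min M}" using le by (auto simp: L_def P_eq)
  have RQ: "R \<subseteq> Q - {Max M}" using le by (auto simp: R_def Q_eq)
  have "g m M = g m (M - L)"
  proof (rule g_fold_set[of _ _ "Min M"])
    fix v assume v: "v \<in> L"
    have "(v, y) \<in> D" if "y \<in> Q" for y
      using that v LP by (intro block_cell) (auto simp: L_def Q_eq)
    then show "nbs (Min M) M \<subseteq> nbs v M"
      using v QM sub unfolding nbs_extremes[OF assms(1,2)]
      by (subst nbs_eq) (auto simp: L_def)
  qed (use sub Min_M finC LP PM in auto)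
  also have "\<dots> = g m (M - L - R)"
  proof (rule g_fold_set[of _ _ "Max M"])
    fix v assume v: "v \<in> R"
    have "(x, v) \<in> D" if "x \<in> P" for x
      using that v RQ by (intro block_cell) (auto simp: R_def P_eq)
    then have "P \<subseteq> nbs v M"
      using v PM sub by (subst nbs_eq) (auto simp: R_def)
    then show "nbs (Max M) (M - L) \<subseteq> nbs v (M - L)"
      unfolding neighbours_Diff nbs_extremes[OF assms(1,2)] by auto
  qed (use sub Max_M finC RQ QM bounds le in \<open>auto simp: L_def R_def\<close>)
  also have "M - L - R = insert (Min M) (insert (Max M) C)" (is "_ = ?K")
    using Min_M Max_M bounds le by (auto simp: L_def R_def C_def)
  \<comment> \<open>For \<open>u < v\<close> among the kept vertices, \<open>u\<close> is a row and
    \<open>v\<close> a column of the block, and the block contains all its positions above the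
    diagonal.\<close>
  also have "g m ?K = (if m = 1 then card ?K - 1 else 0)"
  proof (rule g_complete)
    have KP: "x \<in> P" if "x \<in> ?K" "x \<noteq> Max M" for x
      using that Min_M by (auto simp: C_def P_eq)
    have KQ: "x \<in> Q" if "x \<in> ?K" "x \<noteq> Min M" for x
      using that Max_M by (auto simp: C_def Q_eq)
    have KM: "?K \<subseteq> M" using Min_M Max_M by (auto simp: C_def)
    then show "?K \<subseteq> X" using sub by auto
    have edge: "{u, v} \<in> nonbip_edges D X" if "u \<in> ?K" "v \<in> ?K" "u < v" for u v
    proof -
      have "u \<in> M" "v \<in> M" using that KM by auto
      then have "u \<noteq> Max M" "v \<noteq> Min M"
        using that(3) Max_ge[OF pad_fin(1)] Min_le[OF pad_fin(1)] by (auto simp: not_le[symmetric])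
      then have "(u, v) \<in> D" using that KP KQ by (intro block_cell) auto
      then show ?thesis using \<open>u \<in> M\<close> \<open>v \<in> M\<close> sub by (auto simp: nonbip_edges_iff)
    qed
    show "{u, v} \<in> nonbip_edges D X" if "u \<in> ?K" "v \<in> ?K" "u \<noteq> v" for u v
      using edge[OF that(1,2)] edge[OF that(2,1)] that(3) by (metis insert_commute linorder_neqE_nat)
  qed simp
  also have "card ?K - 1 = Suc (card C)"
    using finC bounds le by (auto simp: C_def)
  finally show ?thesis by (simp add: C_def)
qed

text \<open>A staircase cell is determined by its column. The columns of those outside the excess
  are the elements of \<open>C\<close> and one more, the successor \<open>r\<close> of
  \<open>m'\<close> in \<open>M\<close>.\<close>

lemma card_staircase_pedestal:
  assumes "padded_top_cell D M A B"
    and "(top_cell.m' D (M \<union> B) (A \<union> M), top_cell.n' D (M \<union> B) (A \<union> M)) \<notin> D"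
  shows "card (staircase_cells D M - snd (rect_decomp D (M \<union> B) (A \<union> M))) = Suc (card
    {x\<in>M. top_cell.n' D (M \<union> B) (A \<union> M) \<le> x \<and> x \<le> top_cell.m' D (M \<union> B) (A \<union> M)})"
proof -
  interpret padded_top_cell D M A B by fact
  have le: "n' \<le> m'" using full_iff assms(2) by auto
  have bounds: "Min M < n'" "m' < Max M"
    using shifted_convex_less[OF convex n'(2)] shifted_convex_less[OF convex m'(2)]
    unfolding Min_rows Max_columns by auto
  define C where "C = {x\<in>M. n' \<le> x \<and> x \<le> m'}"
  define r where "r = Min {x\<in>M. m' < x}"
  have finC: "finite C" using pad_fin by (simp add: C_def)
  have r: "r \<in> M" "m' < r" "\<And>x. x \<in> M \<Longrightarrow> m' < x \<Longrightarrow> r \<le> x"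
  proof -
    have "finite {x\<in>M. m' < x}" "{x\<in>M. m' < x} \<noteq> {}" using pad_fin bounds Max_M by auto
    from Min_in[OF this] Min_le[OF this(1)]
    show "r \<in> M" "m' < r" "\<And>x. x \<in> M \<Longrightarrow> m' < x \<Longrightarrow> r \<le> x" unfolding r_def by auto
  qed
  let ?S = "staircase_cells D M - snd (rect_decomp D (M \<union> B) (A \<union> M))"
  \<comment> \<open>A cell outside the block in both directions would not be excess either, but it
    would have \<open>y < n'\<close> and \<open>m' < x\<close>, and with \<open>n' \<le> m'\<close>
    it would lie below the diagonal.\<close>
  have S: "(x, y) \<in> ?S \<longleftrightarrow> (x, y) \<in> staircase_cells D M \<and> x \<le> m' \<and> n' \<le> y" for x y
  proof -
    have "(x, y) \<in> snd (rect_decomp D (M \<union> B) (A \<union> M)) \<longleftrightarrow> \<not> (x \<le> m' \<and> n' \<le> y)"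
      if xy: "(x, y) \<in> staircase_cells D M"
    proof -
      have xy': "(x, y) \<in> D" "x \<in> M" "y \<in> M" "x < y" using xy by (auto simp: staircase_cells_iff)
      then show ?thesis
        using assms(2) le by (auto simp: decomp cells_def P_eq Q_eq)
    qed
    then show ?thesis by auto
  qed
  have inj: "inj_on snd ?S"
  proof (rule inj_onI, clarify)
    fix x y x' y' assume "(x, y) \<in> staircase_cells D M" "(x', y') \<in> staircase_cells D M" and "snd (x, y) = snd (x', y')"
    then show "x = x' \<and> y = y'" by (auto simp: staircase_cells_iff) (metis linorder_neqE_nat)
  qed
  have "snd ` ?S = insert r C"
  proof (intro subset_antisym subsetI)
    fix y assume "y \<in> snd ` ?S"
    then obtain x where x: "(x, y) \<in> ?S" by force
    then have xy: "x \<in> M" "y \<in> M" "x < y" "x \<le> m'" "n' \<le> y" "\<And>z. z \<in> M \<Longrightarrow> \<not> (x < z \<and> z < y)"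
      unfolding S by (auto simp: staircase_cells_iff)
    show "y \<in> insert r C"
    proof (cases "y \<le> m'")
      case False
      then have "r \<le> y" using r xy by auto
      moreover have "\<not> r < y" using xy(6)[OF r(1)] r(2) xy(4) by auto
      ultimately show ?thesis by simp
    qed (use xy in \<open>simp add: C_def\<close>)
  next
    fix y assume y: "y \<in> insert r C"
    have yM: "y \<in> M" "n' \<le> y" using y r le by (auto simp: C_def)
    \<comment> \<open>The row of a staircase cell in column \<open>y\<close> must be the predecessor
      of \<open>y\<close> in \<open>M\<close>.\<close>
    define x where "x = Max {z\<in>M. z < y}"
    have "finite {z\<in>M. z < y}" "{z\<in>M. z < y} \<noteq> {}" using pad_fin bounds yM Min_M by auto
    from Max_in[OF this] Max_ge[OF this(1)]
    have x: "x \<in> M" "x < y" "\<And>z. z \<in> M \<Longrightarrow> z < y \<Longrightarrow> z \<le> x" unfolding x_def by auto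
    have "x \<le> m'"
      using y x(1,2) r(3)[of x] by (auto simp: C_def not_le[symmetric])
    then have "(x, y) \<in> D"
      using x(1,2) yM by (intro block_cell) (auto simp: P_eq Q_eq)
    then have "(x, y) \<in> ?S"
      unfolding S staircase_cells_iff using x yM \<open>x \<le> m'\<close> by (auto simp: not_le[symmetric])
    then show "y \<in> snd ` ?S" by force
  qed
  then have "card ?S = card (insert r C)" using card_image[OF inj] by simp
  also have "\<dots> = Suc (card C)" using finC r(2) by (subst card_insert_disjoint) (auto simp: C_def)
  finally show ?thesis by (simp add: C_def)
qed

text \<open>Row and column sets may differ here, since the induction runs over padded
  diagrams.\<close>

definition no_empty :: "nat set \<Rightarrow> nat set \<Rightarrow> bool" where
  "no_empty R C \<longleftrightarrow> (\<forall>b\<in>blocks D R C. is_empty_rect b \<longrightarrow>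
     strictly_below_diagonal (block_rows b) (block_cols b))"

text \<open>Cells inside \<open>P\<close>, inside \<open>Q\<close>, or joining \<open>M'\<close> to
  one of them become excess. A cell from \<open>P\<close> to \<open>Q\<close> is not on the
  staircase, because a vertex of the nonempty set \<open>M'\<close> lies in between. What is left
  are the staircase cells of \<open>M'\<close>.\<close>

lemma staircase_full_step:
  assumes PQ: "P \<union> M' \<union> Q = M" and PM': "\<And>x y. x \<in> P \<Longrightarrow> y \<in> M' \<union> Q \<Longrightarrow> x < y"
    and M'Q: "\<And>x y. x \<in> M' \<Longrightarrow> y \<in> Q \<Longrightarrow> x < y" and "M' \<noteq> {}"
    and AM: "\<And>a x. a \<in> A \<Longrightarrow> x \<in> M \<Longrightarrow> a < x" and MB: "\<And>x b. x \<in> M \<Longrightarrow> b \<in> B \<Longrightarrow> x < b"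
  shows "staircase_cells D M - (cells D (M' \<union> Q \<union> B) Q \<union> cells D P (A \<union> P \<union> M') \<union> ex) =
    staircase_cells D M' - ex"
proof -
  have "(x, y) \<in> staircase_cells D M - (cells D (M' \<union> Q \<union> B) Q \<union> cells D P (A \<union> P \<union> M')) \<longleftrightarrow>
      (x, y) \<in> staircase_cells D M'" (is "?l \<longleftrightarrow> ?r") for x y
  proof
    assume ?l
    then have xy: "(x, y) \<in> D" "x \<in> M" "y \<in> M" "x < y" "\<And>z. z \<in> M \<Longrightarrow> \<not> (x < z \<and> z < y)"
      "\<not> (x \<in> M' \<union> Q \<union> B \<and> y \<in> Q)" "\<not> (x \<in> P \<and> y \<in> A \<union> P \<union> M')"
      unfolding Diff_iff Un_iff staircase_cells_iff by (auto simp: cells_def)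
    obtain z where z: "z \<in> M'" using \<open>M' \<noteq> {}\<close> by auto
    have "y \<notin> Q"
    proof
      assume yQ: "y \<in> Q"
      then have "x \<in> P" using xy(2,6) PQ by auto
      then show False using xy(5)[of z] z yQ PM' M'Q PQ by auto
    qed
    moreover from this have "x \<notin> P" using xy(3,7) PQ by auto
    moreover have "y \<notin> P" using PM'[of y x] xy(2,4) \<open>x \<notin> P\<close> PQ by fastforce
    moreover have "x \<notin> Q" using M'Q[of y x] xy(3,4) \<open>y \<notin> Q\<close> \<open>y \<notin> P\<close> PQ by fastforce
    ultimately have "x \<in> M'" "y \<in> M'" using xy(2,3) PQ by auto
    then show ?r using xy PQ by (auto simp: staircase_cells_iff)
  next
    assume ?r
    then have xy: "(x, y) \<in> D" "x \<in> M'" "y \<in> M'" "x < y" "\<And>z. z \<in> M' \<Longrightarrow> \<not> (x < z \<and> z < y)"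
      by (auto simp: staircase_cells_iff)
    have "\<not> (x < z \<and> z < y)" if z: "z \<in> M" for z
    proof
      assume "x < z \<and> z < y"
      moreover have "z \<notin> P" using calculation PM'[of z x] xy(2) by auto
      moreover have "z \<notin> Q" using calculation M'Q[of y z] xy(3) by auto
      ultimately show False using z PQ xy(5)[of z] by auto
    qed
    moreover have "y \<notin> Q" using M'Q[of y y] xy(3) by auto
    moreover have "x \<notin> P" using PM'[of x x] xy(2) by auto
    ultimately show ?l using xy PQ by (auto simp: staircase_cells_iff cells_def)
  qed
  then have "staircase_cells D M - (cells D (M' \<union> Q \<union> B) Q \<union> cells D P (A \<union> P \<union> M')) =
      staircase_cells D M'" by (intro Set.set_eqI) (auto simp only: split_paired_all)
  then show ?thesis by blast
qed

text \<open>\<open>A\<close> and \<open>B\<close> hold the columns and rows of vertices already used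
  by earlier rectangles. They contribute no cells within the current diagram but influence which
  blocks \<open>rect_decomp\<close> reports.\<close>

theorem g_nonbip:
  assumes "M \<subseteq> X" "M \<noteq> {}" "finite A" "finite B"
    and "\<And>a x. a \<in> A \<Longrightarrow> x \<in> M \<Longrightarrow> a < x" "\<And>x b. x \<in> M \<Longrightarrow> b \<in> B \<Longrightarrow> x < b"
  shows "g m M = (if no_empty (M \<union> B) (A \<union> M) \<and> rect D (M \<union> B) (A \<union> M) = m
    then card (staircase_cells D M - excess_cells D (M \<union> B) (A \<union> M)) else 0)"
  using assms
proof (induction "card M" arbitrary: M A B m rule: less_induct)
  case less
  have finM: "finite M" using less.prems(1) finX by (rule finite_subset)
  interpret padded_diagram D M A B
    using convex finM less.prems by unfold_locales auto
  let ?R = "M \<union> B" and ?C = "A \<union> M"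
  show ?case
  proof (cases "(Min M, Max M) \<in> D")
    case False
    let ?R' = "{x\<in>?R. cells D {z\<in>?R. z \<le> x} ?C = {}}" and ?C' = "{y\<in>?C. cells D ?R {z\<in>?C. y \<le> z} = {}}"
    have fins: "finite ?R" "finite ?C" using pad_fin by auto
    have nt: "\<not> (?R \<noteq> {} \<and> ?C \<noteq> {} \<and> (Min ?R, Max ?C) \<in> D)"
      using False unfolding Min_rows Max_columns by blast
    have ne2: "\<not> (?R = {} \<and> ?C = {})" using pad_ne by auto
    note dec = rect_decomp_no_top[OF fins ne2 nt convex refl refl]
    have mem: "Min M \<in> M" "Max M \<in> M" using pad_fin pad_ne by auto
    \<comment> \<open>A nonempty side of the empty rectangle contains \<open>Min M\<close> as a row
      or \<open>Max M\<close> as a column, so as long as \<open>M\<close> is nonempty the block is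
      not strictly below the diagonal.\<close>
    have R': "Min M \<in> ?R' \<and> cells D {Min M} ?C = {}" if nonempty: "?R' \<noteq> {}"
    proof -
      obtain x where x: "x \<in> ?R" "cells D {z\<in>?R. z \<le> x} ?C = {}" using nonempty by blast
      have "Min M \<le> x" using Min_le[of ?R x] x(1) pad_fin Min_rows by simp
      then have "{z\<in>?R. z \<le> Min M} \<subseteq> {z\<in>?R. z \<le> x}" "{Min M} \<subseteq> {z\<in>?R. z \<le> x}" using mem by auto
      then have "cells D {z\<in>?R. z \<le> Min M} ?C = {}" "cells D {Min M} ?C = {}"
        using x(2) unfolding cells_def by blast+
      then show ?thesis using mem by auto
    qed
    have C': "Max M \<in> ?C' \<and> cells D ?R {Max M} = {}" if nonempty: "?C' \<noteq> {}"
    proof -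
      obtain y where y: "y \<in> ?C" "cells D ?R {z\<in>?C. y \<le> z} = {}" using nonempty by blast
      have "y \<le> Max M" using Max_ge[of ?C y] y(1) pad_fin Max_columns by simp
      then have "{z\<in>?C. Max M \<le> z} \<subseteq> {z\<in>?C. y \<le> z}" "{Max M} \<subseteq> {z\<in>?C. y \<le> z}" using mem by auto
      then have "cells D ?R {z\<in>?C. Max M \<le> z} = {}" "cells D ?R {Max M} = {}"
        using y(2) unfolding cells_def by blast+
      then show ?thesis using mem by auto
    qed
    have "\<not> no_empty ?R ?C"
    proof
      assume "no_empty ?R ?C"
      moreover have "Empty_Rect ?R' ?C' \<in> blocks D ?R ?C" unfolding blocks_def dec(2) by simp
      ultimately have "strictly_below_diagonal ?R' ?C'" unfolding no_empty_def by fastforce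
      then have "Max M < Min M" using R' C' unfolding strictly_below_diagonal_def by blast
      then show False using Min_le[OF pad_fin(1) mem(2)] by simp
    qed
    moreover have "g m M = 0"
    proof (cases "?R' = {}")
      case False
      then have "cells D {Min M} ?C = {}" using R' by blast
      then have no: "(Min M, y) \<notin> D" if "y \<in> M" for y using that unfolding cells_def by blast
      have "(y, Min M) \<notin> D" if "y \<in> M" for y
        using shifted_convex_less[OF convex, of y "Min M"] Min_le[OF pad_fin(1) that] by auto
      then have "nbs (Min M) M = {}" using no by (auto simp: nbs_eq[OF less.prems(1) mem(1)])
      then show ?thesis using g_isolated[OF less.prems(1) mem(1)] by simp
    next
      case True
      then have "cells D ?R {Max M} = {}" using C' dec(1) by blast
      then have no: "(y, Max M) \<notin> D" if "y \<in> M" for y using that unfolding cells_def by blast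
      have "(Max M, y) \<notin> D" if "y \<in> M" for y
        using shifted_convex_less[OF convex, of "Max M" y] Max_ge[OF pad_fin(1) that] by auto
      then have "nbs (Max M) M = {}" using no by (auto simp: nbs_eq[OF less.prems(1) mem(2)])
      then show ?thesis using g_isolated[OF less.prems(1) mem(2)] by simp
    qed
    ultimately show ?thesis by simp
  next
    case True
    then interpret padded_top_cell D M A B by unfold_locales
    have ptc: "padded_top_cell D M A B" by unfold_locales
    show ?thesis
    proof (cases "(m', n') \<in> D")
      case False
      have "no_empty ?R ?C" "rect D ?R ?C = 1"
        using False by (auto simp: no_empty_def blocks_def rect_def decomp)
      then show ?thesis
        unfolding excess_cells_def
        using g_nonbip_pedestal[OF less.prems(1) ptc False, of m]
          card_staircase_pedestal[OF ptc False] by auto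
    next
      case full: True
      define M' where "M' = M - P - Q"
      have lt: "m' < n'" using full full_iff by simp
      have PM: "P \<subseteq> M" and QM: "Q \<subseteq> M" by (auto simp: P_eq Q_eq)
      have PQ: "P \<union> M' \<union> Q = M" using PM QM by (auto simp: M'_def)
      have PQlt: "x < y" if "x \<in> P" "y \<in> M' \<union> Q" for x y
        using that lt by (auto simp: P_eq Q_eq M'_def)
      have M'Q: "x < y" if "x \<in> M'" "y \<in> Q" for x y
        using that by (auto simp: P_eq Q_eq M'_def)
      \<comment> \<open>The vertices of \<open>Q\<close> were used as columns only, so their rows
        join the padding; likewise the columns \<open>P\<close> below.\<close>
      have rows: "?R - P = M' \<union> Q \<union> B"
        using PQ MB PM PQlt by (auto simp: M'_def) (use lt in \<open>force simp: P_eq Q_eq\<close>)+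
      have cols: "?C - Q = A \<union> P \<union> M'"
        using PQ AM QM PQlt by (auto simp: M'_def) (use lt in \<open>force simp: P_eq Q_eq\<close>)+
      let ?rec = "rect_decomp D (M' \<union> Q \<union> B) (A \<union> P \<union> M')"
      have dec: "rect_decomp D ?R ?C = (Full_Rect P Q # fst ?rec,
          cells D (M' \<union> Q \<union> B) Q \<union> cells D P (A \<union> P \<union> M') \<union> snd ?rec)"
        using decomp full unfolding rows cols by simp
      have g: "g m M = (case m of 0 \<Rightarrow> 0 | Suc j \<Rightarrow> g j M')"
        using g_nonbip_full[OF less.prems(1) ptc full, of m] unfolding M'_def .
      have noe: "no_empty ?R ?C \<longleftrightarrow> no_empty (M' \<union> Q \<union> B) (A \<union> P \<union> M')"
        by (simp add: no_empty_def blocks_def dec)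
      have rect: "rect D ?R ?C = Suc (rect D (M' \<union> Q \<union> B) (A \<union> P \<union> M'))"
        by (simp add: rect_def dec)
      show ?thesis
      proof (cases "M' = {}")
        case False
        have "M' \<subseteq> M" "Min M \<notin> M'" using PQ Min_M by (auto simp: M'_def)
        then have "card M' < card M" using Min_M(1) pad_fin by (intro psubset_card_mono) auto
        then have IH: "g j M' = (if no_empty (M' \<union> (Q \<union> B)) ((A \<union> P) \<union> M') \<and>
            rect D (M' \<union> (Q \<union> B)) ((A \<union> P) \<union> M') = j
            then card (staircase_cells D M' - excess_cells D (M' \<union> (Q \<union> B)) ((A \<union> P) \<union> M')) else 0)" for j
        proof (rule less.hyps)
          show "a < x" if "a \<in> A \<union> P" "x \<in> M'" for a x
            using that AM[of a x] PQlt[of a x] \<open>M' \<subseteq> M\<close> by auto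
          show "x < b" if "x \<in> M'" "b \<in> Q \<union> B" for x b
            using that MB[of x b] M'Q[of x b] \<open>M' \<subseteq> M\<close> by auto
        qed (use False pad_fin PM QM \<open>M' \<subseteq> M\<close> less.prems(1) in \<open>auto intro: finite_subset\<close>)
        have st: "staircase_cells D M - excess_cells D ?R ?C =
            staircase_cells D M' - excess_cells D (M' \<union> Q \<union> B) (A \<union> P \<union> M')"
          unfolding excess_cells_def dec snd_conv
          by (rule staircase_full_step[OF PQ PQlt M'Q False AM MB])
        show ?thesis
          unfolding g noe rect st using IH by (auto simp: Un_assoc split: nat.splits)
      next
        case True
        \<comment> \<open>The vertices are used up. The rows \<open>Q \<union> B\<close> and the
          columns \<open>A \<union> P\<close> form one block strictly below the diagonal, the only
          empty rectangle that \<open>no_empty\<close> admits.\<close>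
        have below: "a < b" if ab: "b \<in> Q \<union> B" "a \<in> A \<union> P" for a b
        proof -
          have "a < m' \<or> a \<le> m'" "n' \<le> b"
            using ab AM[of a m'] m'_in_M MB[of n' b] n'_in_M by (auto simp: P_eq Q_eq intro: less_imp_le)
          then show ?thesis using lt by auto
        qed
        then have no_cells: "(b, a) \<notin> D" if "b \<in> Q \<union> B" "a \<in> A \<union> P" for a b
          using that shifted_convex_less[OF convex, of b a] by fastforce
        have ne': "Q \<union> B \<noteq> {}" "A \<union> P \<noteq> {}" using Max_M Min_M by auto
        have fins: "finite (Q \<union> B)" "finite (A \<union> P)"
          using pad_fin PM QM by (auto intro: finite_subset)
        have all: "Q \<union> B = {x\<in>Q \<union> B. cells D {z\<in>Q \<union> B. z \<le> x} (A \<union> P) = {}}"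
          "A \<union> P = {y\<in>A \<union> P. cells D (Q \<union> B) {z\<in>A \<union> P. y \<le> z} = {}}"
          using no_cells unfolding cells_def by blast+
        have nt: "\<not> (Q \<union> B \<noteq> {} \<and> A \<union> P \<noteq> {} \<and> (Min (Q \<union> B), Max (A \<union> P)) \<in> D)"
          using no_cells Min_in[OF fins(1) ne'(1)] Max_in[OF fins(2) ne'(2)] by blast
        have ne2: "\<not> (Q \<union> B = {} \<and> A \<union> P = {})" using ne' by blast
        have rec: "rect_decomp D (Q \<union> B) (A \<union> P) = ([Empty_Rect (Q \<union> B) (A \<union> P)], {})"
          using rect_decomp_no_top(2)[OF fins ne2 nt convex all]
          unfolding Diff_cancel rect_decomp_empty fst_conv snd_conv .
        have "no_empty (M' \<union> Q \<union> B) (A \<union> P \<union> M')"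
          using True below ne' by (simp add: no_empty_def blocks_def rec strictly_below_diagonal_def)
        moreover have "rect D (M' \<union> Q \<union> B) (A \<union> P \<union> M') = 0"
          using True by (simp add: rect_def rec)
        \<comment> \<open>With nothing between \<open>P\<close> and \<open>Q\<close>, one staircase
          cell crosses from the last vertex of \<open>P\<close> to the first of \<open>Q\<close>;
          the others lie inside \<open>P\<close> or \<open>Q\<close> and are excess. The count 1
          agrees with \<open>g 0 {} = 1\<close>.\<close>
        moreover have "staircase_cells D M - excess_cells D ?R ?C = {(m', n')}"
        proof -
          have M: "M = P \<union> Q" using PQ True by auto
          have mn: "m' \<in> P" "n' \<in> Q" using m'_in_M n'_in_M by (auto simp: P_eq Q_eq)
          have disj: "m' \<notin> Q \<union> B" "n' \<notin> A \<union> P" using below[of m' m'] below[of n' n'] mn by auto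
          have ex: "excess_cells D ?R ?C = cells D (Q \<union> B) Q \<union> cells D P (A \<union> P)"
            using True by (simp add: excess_cells_def dec rec)
          have uniq: "(x, y) = (m', n')" if xy: "(x, y) \<in> staircase_cells D M" "(x, y) \<notin> excess_cells D ?R ?C" for x y
          proof -
            have s: "(x, y) \<in> D" "x \<in> M" "y \<in> M" "x < y" "\<And>z. z \<in> M \<Longrightarrow> \<not> (x < z \<and> z < y)"
              using xy(1) by (auto simp: staircase_cells_iff)
            have "\<not> (x \<in> Q \<and> y \<in> Q)" "\<not> (x \<in> P \<and> y \<in> P)"
              using xy(2) s(1) by (auto simp: ex cells_def)
            moreover have "\<not> (y \<in> P \<and> x \<in> Q)" using PQlt[of y x] s(4) by auto
            moreover have "x \<in> P \<or> x \<in> Q" "y \<in> P \<or> y \<in> Q" using s(2,3) M by auto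
            ultimately have "x \<in> P \<and> y \<in> Q" by blast
            then have "x \<le> m'" "n' \<le> y" by (auto simp: P_eq Q_eq)
            moreover have "\<not> x < m'" using s(5)[OF m'_in_M] lt \<open>n' \<le> y\<close> by auto
            moreover have "\<not> n' < y" using s(5)[OF n'_in_M] lt \<open>x \<le> m'\<close> by auto
            ultimately show ?thesis by simp
          qed
          have "(m', n') \<in> staircase_cells D M"
          proof -
            have "\<not> (m' < z \<and> z < n')" if "z \<in> M" for z
            proof -
              have "z \<in> P \<or> z \<in> Q" using that M by blast
              then show ?thesis by (auto simp: P_eq Q_eq)
            qed
            then show ?thesis using full m'_in_M n'_in_M lt by (simp add: staircase_cells_iff)
          qed
          moreover have "(m', n') \<notin> excess_cells D ?R ?C"
            using disj mn unfolding ex cells_def by blast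
          ultimately have "(m', n') \<in> staircase_cells D M - excess_cells D ?R ?C" by (rule DiffI)
          moreover have "z = (m', n')" if "z \<in> staircase_cells D M - excess_cells D ?R ?C" for z
            using uniq[of "fst z" "snd z"] that by simp
          ultimately show ?thesis by blast
        qed
        ultimately show ?thesis
          unfolding g noe rect using True by (simp add: g_empty split: nat.splits)
      qed
    qed
  qed
qed

end

section \<open>A free resolution of an edge ideal\<close>

text \<open>The resolution has all lists of (numbers of) edges as basis, with differential
  \<open>\<partial>(e # t) = t - e # \<partial> t\<close>; prepending an edge that divides the multidegree is a contracting
  homotopy.  It is not minimal, but unlike the Taylor resolution it needs no signs.\<close>

fun bcoef :: "nat list \<Rightarrow> nat list \<Rightarrow> 'k::comm_ring_1" where
  "bcoef a [] = 0"
| "bcoef a (e # t) = (if a = t then 1 else 0) -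
     (case a of [] \<Rightarrow> 0 | z # a' \<Rightarrow> if z = e then bcoef a' t else 0)"

text \<open>The inclusion of edges makes the degree of \<open>a\<close> divide that of
  \<open>b\<close> whenever the entry is nonzero, so that the truncated subtraction of exponents in
  \<open>M\<close> is exact.\<close>

lemma bcoef_nonzero:
  "bcoef a b \<noteq> (0 :: 'k::comm_ring_1) \<Longrightarrow> length b = Suc (length a) \<and> set a \<subseteq> set b"
proof (induction b arbitrary: a)
  case (Cons e t)
  show ?case
  proof (cases "a = t")
    case False
    then obtain a' where a: "a = e # a'" "bcoef a' t \<noteq> (0 :: 'k)"
      using Cons.prems by (cases a) (simp_all split: if_splits)
    then show ?thesis using Cons.IH[OF a(2)] by auto
  qed auto
qed simp

definition emon :: "'v set \<Rightarrow> ('v \<Rightarrow>\<^sub>0 nat)" where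
  "emon A = mon (indicator A)"

lemma lookup_emon:
  assumes "finite A"
  shows "Poly_Mapping.lookup (emon A) v = indicator A v"
proof -
  have "Poly_Mapping.lookup (emon A) v = nat (indicator A v)"
    unfolding emon_def using assms by (rule lookup_mon) simp
  then show ?thesis by (simp add: indicator_def)
qed

locale edge_list =
  fixes V :: "'v set" and E :: "'v set set" and f :: "nat \<Rightarrow> 'v set" and N :: nat
  assumes graph: "graph_on V E" and E: "E = f ` {..<N}"
begin

definition L :: "nat \<Rightarrow> nat list set" where
  "L n = {t. length t = n \<and> set t \<subseteq> {..<N}}"

text \<open>The least common multiple of the listed edges. The intersection with \<open>V\<close>
  keeps the support finite for lists with arbitrary entries.\<close>

definition ldeg :: "nat list \<Rightarrow> ('v \<Rightarrow>\<^sub>0 nat)" where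
  "ldeg t = emon ((\<Union>i\<in>set t. f i) \<inter> V)"

definition divides :: "('v \<Rightarrow>\<^sub>0 nat) \<Rightarrow> ('v \<Rightarrow>\<^sub>0 nat) \<Rightarrow> bool" where
  "divides m k \<longleftrightarrow> (\<forall>v. Poly_Mapping.lookup m v \<le> Poly_Mapping.lookup k v)"

definition M :: "nat list \<Rightarrow> nat list \<Rightarrow> ('v, 'k::field) mpoly" where
  "M a b = Poly_Mapping.single (ldeg b - ldeg a) (bcoef a b)"

text \<open>The coefficient of \<open>t\<close> in the degree-\<beta> component of \<open>x\<close>,
  where \<beta> is the total degree and includes \<open>ldeg t\<close>.\<close>

definition coef :: "(nat list \<Rightarrow> ('v, 'k::field) mpoly) \<Rightarrow> nat list \<Rightarrow> ('v \<Rightarrow>\<^sub>0 nat) \<Rightarrow> 'k" where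
  "coef x t \<beta> = (if divides (ldeg t) \<beta> then Poly_Mapping.lookup (x t) (\<beta> - ldeg t) else 0)"

definition dif :: "nat \<Rightarrow> (nat list \<Rightarrow> ('v, 'k::field) mpoly) \<Rightarrow> nat list \<Rightarrow> ('v, 'k) mpoly" where
  "dif n y t = (\<Sum>s\<in>L (Suc n). M t s * y s)"

lemma finite_L: "finite (L n)"
proof -
  have "L n = {t. set t \<subseteq> {..<N} \<and> length t = n}" by (auto simp: L_def)
  then show ?thesis using finite_lists_length_eq[of "{..<N}" n] by simp
qed

lemma L_0: "L 0 = {[]}"
  by (auto simp: L_def)

lemma L_Suc: "L (Suc n) = (\<lambda>(e, t). e # t) ` ({..<N} \<times> L n)"
  by (auto simp: L_def length_Suc_conv image_iff)

lemma Cons_in_L: "e # t \<in> L (Suc n) \<longleftrightarrow> e < N \<and> t \<in> L n"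
  by (auto simp: L_def)

lemma finite_V: "finite V" using graph by (simp add: graph_on_def)

lemma f_subset: "i < N \<Longrightarrow> f i \<subseteq> V"
proof -
  assume "i < N"
  then have "f i \<in> E" using E by auto
  then obtain u v where "f i = {u, v}" "u \<in> V" "v \<in> V"
    using graph unfolding graph_on_def by blast
  then show ?thesis by simp
qed

lemma lookup_ldeg: "Poly_Mapping.lookup (ldeg t) v = indicator ((\<Union>i\<in>set t. f i) \<inter> V) v"
  unfolding ldeg_def using finite_V by (intro lookup_emon) auto

lemma divides_ldeg_iff:
  assumes "t \<in> L n"
  shows "divides (ldeg t) \<beta> \<longleftrightarrow> (\<forall>i\<in>set t. f i \<subseteq> Poly_Mapping.keys \<beta>)"
proof -
  have "divides (ldeg t) \<beta> \<longleftrightarrow> (\<Union>i\<in>set t. f i) \<inter> V \<subseteq> Poly_Mapping.keys \<beta>"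
    unfolding divides_def lookup_ldeg by (auto simp: in_keys_iff indicator_def Suc_le_eq split: if_splits)
  moreover have "(\<Union>i\<in>set t. f i) \<inter> V = (\<Union>i\<in>set t. f i)"
    using assms f_subset by (auto simp: L_def)
  ultimately show ?thesis by auto
qed

lemma divides_add: "divides m (k + m)"
  by (simp add: divides_def lookup_add)

lemma divides_diff_add: "divides m k \<Longrightarrow> k - m + m = k"
  by (intro poly_mapping_eqI) (simp add: divides_def lookup_add lookup_minus)

lemma divides_ldeg_mono: "set a \<subseteq> set b \<Longrightarrow> divides (ldeg a) (ldeg b)"
  unfolding divides_def lookup_ldeg by (auto simp: indicator_def)

lemma divides_trans: "divides a b \<Longrightarrow> divides b c \<Longrightarrow> divides a c"
  unfolding divides_def by (meson order_trans)

lemma ldeg_carrier: "Poly_Mapping.keys (ldeg t) \<subseteq> V"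
  by (auto simp: in_keys_iff lookup_ldeg indicator_def split: if_splits)

lemma M_carrier: "M a b \<in> carrier (mpoly_ring V)"
proof -
  have "Poly_Mapping.keys (ldeg b - ldeg a) \<subseteq> Poly_Mapping.keys (ldeg b)"
    by (auto simp: in_keys_iff lookup_minus)
  then show ?thesis using ldeg_carrier[of b] by (auto simp: M_def carrier_mpoly_ring split: if_splits)
qed

lemma dif_carrier:
  "(\<And>s. s \<in> L (Suc n) \<Longrightarrow> y s \<in> carrier (mpoly_ring V)) \<Longrightarrow> dif n y t \<in> carrier (mpoly_ring V)"
  unfolding dif_def by (intro carrier_mpoly_sum carrier_mpoly_mult M_carrier)

lemma lookup_dif:
  fixes y :: "nat list \<Rightarrow> ('v, 'k::field) mpoly"
  shows "Poly_Mapping.lookup (dif n y t) \<gamma> = (\<Sum>s\<in>L (Suc n). bcoef t s * coef y s (\<gamma> + ldeg t))"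
proof -
  have "Poly_Mapping.lookup (M t s * y s) \<gamma> = bcoef t s * coef y s (\<gamma> + ldeg t)" for s
  proof (cases "bcoef t s = (0 :: 'k)")
    case True
    then show ?thesis by (simp add: M_def)
  next
    case False
    then have le: "divides (ldeg t) (ldeg s)"
      using bcoef_nonzero divides_ldeg_mono by blast
    have "(\<forall>v. Poly_Mapping.lookup (ldeg s - ldeg t) v \<le> Poly_Mapping.lookup \<gamma> v) \<longleftrightarrow>
        divides (ldeg s) (\<gamma> + ldeg t)"
      by (simp add: divides_def lookup_minus lookup_add le_diff_conv)
    moreover have "\<gamma> - (ldeg s - ldeg t) = \<gamma> + ldeg t - ldeg s"
      using le by (intro poly_mapping_eqI) (simp add: divides_def lookup_minus lookup_add)
    ultimately show ?thesis by (simp add: M_def lookup_single_mult coef_def)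
  qed
  then show ?thesis by (simp add: dif_def lookup_sum)
qed

lemma sum_L_Suc: "(\<Sum>s\<in>L (Suc n). h s) = (\<Sum>e<N. \<Sum>t\<in>L n. h (e # t))"
proof -
  have "(\<Sum>s\<in>L (Suc n). h s) = (\<Sum>p\<in>{..<N} \<times> L n. h ((\<lambda>(e, t). e # t) p))"
    unfolding L_Suc by (rule sum.reindex[unfolded comp_apply[abs_def] o_def]) (auto simp: inj_on_def)
  also have "\<dots> = (\<Sum>e<N. \<Sum>t\<in>L n. h (e # t))"
    by (simp add: sum.cartesian_product split_def)
  finally show ?thesis .
qed

text \<open>With \<open>d\<close> for the differential,
  \<open>d (d (e # t)) = d t - d (e # d t) = e # d (d t)\<close>, and induction applies to
  \<open>t\<close>.\<close>

lemma bcoef_comp_zero: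
  "s \<in> L (Suc n) \<Longrightarrow> (\<Sum>t\<in>L n. bcoef a t * bcoef t s) = (0 :: 'k::field)"
proof (induction s arbitrary: a n)
  case (Cons e s)
  have s: "s \<in> L n" "e < N" using Cons.prems by (auto simp: L_def)
  show ?case
  proof (cases n)
    case 0
    then show ?thesis by (simp add: L_0)
  next
    case (Suc k)
    have "(\<Sum>t\<in>L n. bcoef a t * bcoef t (e # s)) =
        (\<Sum>t\<in>L n. bcoef a t * (if t = s then 1 else 0)) -
        (\<Sum>t\<in>L n. bcoef a t * (case t of [] \<Rightarrow> 0 | z # t' \<Rightarrow> if z = e then bcoef t' s else (0::'k)))"
      by (simp add: right_diff_distrib sum_subtractf)
    also have "(\<Sum>t\<in>L n. bcoef a t * (if t = s then 1 else 0)) = (bcoef a s :: 'k)"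
      using s finite_L by (simp add: if_distrib cong: if_cong)
    also have "(\<Sum>t\<in>L n. bcoef a t * (case t of [] \<Rightarrow> 0 | z # t' \<Rightarrow> if z = e then bcoef t' s else (0::'k))) =
        (\<Sum>z<N. if z = e then \<Sum>t'\<in>L k. bcoef a (e # t') * bcoef t' s else 0)"
      unfolding Suc sum_L_Suc by (intro sum.cong refl) auto
    also have "\<dots> = (\<Sum>t'\<in>L k. bcoef a (e # t') * bcoef t' s)"
      using s by simp
    also have "\<dots> = (\<Sum>t'\<in>L k. (if a = t' then bcoef t' s else 0)) -
        (\<Sum>t'\<in>L k. (case a of [] \<Rightarrow> 0 | z # a' \<Rightarrow> if z = e then bcoef a' t' else 0) * bcoef t' s)"
      by (simp add: left_diff_distrib sum_subtractf if_distrib[of "\<lambda>c. c * _"] cong: if_cong)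
    also have "(\<Sum>t'\<in>L k. (if a = t' then bcoef t' s else 0)) = (bcoef a s :: 'k)"
    proof (cases "bcoef a s = (0 :: 'k)")
      case False
      then have "a \<in> L k" using bcoef_nonzero[of a s] s Suc by (auto simp: L_def)
      then show ?thesis using finite_L by simp
    qed (auto intro!: sum.neutral)
    also have "(\<Sum>t'\<in>L k. (case a of [] \<Rightarrow> 0 | z # a' \<Rightarrow> if z = e then bcoef a' t' else 0) * bcoef t' s) = (0 :: 'k)"
    proof (cases a)
      case a: (Cons z a')
      then show ?thesis using Cons.IH[of k a'] s Suc by (cases "z = e") simp_all
    qed simp
    finally show ?thesis by simp
  qed
qed (simp add: L_def)

lemma dif_dif:
  fixes y :: "nat list \<Rightarrow> ('v, 'k::field) mpoly"
  shows "(\<Sum>t\<in>L n. M r t * dif n y t) = 0"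
proof -
  have M2: "M r t * M t s = Poly_Mapping.single (ldeg s - ldeg r) (bcoef r t * bcoef t s :: 'k)" for t s
  proof (cases "bcoef r t = (0 :: 'k) \<or> bcoef t s = (0 :: 'k)")
    case True
    then show ?thesis by (auto simp: M_def)
  next
    case False
    then have "divides (ldeg r) (ldeg t)" "divides (ldeg t) (ldeg s)"
      using bcoef_nonzero divides_ldeg_mono by blast+
    then have "ldeg t - ldeg r + (ldeg s - ldeg t) = ldeg s - ldeg r"
      by (intro poly_mapping_eqI) (simp add: divides_def lookup_add lookup_minus)
    then show ?thesis by (simp add: M_def mult_single)
  qed
  have "(\<Sum>t\<in>L n. M r t * dif n y t) = (\<Sum>s\<in>L (Suc n). (\<Sum>t\<in>L n. M r t * M t s) * y s)"
    unfolding dif_def by (simp add: sum_distrib_left sum_distrib_right mult.assoc) (rule sum.swap)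
  also have "\<dots> = 0"
    unfolding M2 single_sum[symmetric] by (intro sum.neutral ballI) (simp add: bcoef_comp_zero)
  finally show ?thesis .
qed

text \<open>The homotopy needs an edge dividing each multidegree that occurs in \<open>x\<close>.
  For \<open>n > 0\<close> the first entry of a list provides it; for \<open>n = 0\<close> it exists
  because \<open>x []\<close> lies in the edge ideal.\<close>

lemma dif_exact:
  fixes x :: "nat list \<Rightarrow> ('v, 'k::field) mpoly"
  assumes carr: "\<And>t. t \<in> L n \<Longrightarrow> x t \<in> carrier (mpoly_ring V)"
    and edge: "\<And>m. n = 0 \<Longrightarrow> m \<in> Poly_Mapping.keys (x []) \<Longrightarrow> edge_monomial E m"
    and closed: "\<And>k r. n = Suc k \<Longrightarrow> r \<in> L k \<Longrightarrow> dif k x r = 0"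
  shows "\<exists>y. (\<forall>s. y s \<in> carrier (mpoly_ring V)) \<and> (\<forall>t\<in>L n. x t = dif n y t)"
proof -
  define has where "has \<beta> i \<longleftrightarrow> i < N \<and> f i \<subseteq> Poly_Mapping.keys \<beta>"
    for \<beta> :: "'v \<Rightarrow>\<^sub>0 nat" and i
  \<comment> \<open>The choice depends on the multidegree alone, so the homotopy is linear over
    \<open>k\<close> but not over the polynomial ring.\<close>
  define \<epsilon> where "\<epsilon> \<beta> = (SOME i. has \<beta> i)" for \<beta>
  have \<epsilon>: "has \<beta> (\<epsilon> \<beta>)" if "has \<beta> i" for \<beta> i unfolding \<epsilon>_def using that by (rule someI)
  have has: "\<exists>i. has \<beta> i" if t: "t \<in> L n" and nz: "coef x t \<beta> \<noteq> 0" for t \<beta>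
  proof (cases n)
    case 0
    then have "t = []" using t L_0 by simp
    have "ldeg [] = 0" by (intro poly_mapping_eqI) (simp add: lookup_ldeg)
    then have "\<beta> \<in> Poly_Mapping.keys (x [])"
      using nz \<open>t = []\<close> by (simp add: coef_def in_keys_iff split: if_splits)
    then show ?thesis using edge 0 E unfolding edge_monomial_def has_def by auto
  next
    case (Suc k)
    then obtain e s where es: "t = e # s" "e < N" using t by (auto simp: L_Suc)
    have "divides (ldeg t) \<beta>" using nz by (simp add: coef_def split: if_splits)
    then show ?thesis using es divides_ldeg_iff[OF t] by (auto simp: has_def)
  qed
  \<comment> \<open>In total degree \<beta> this prepends \<open>\<epsilon> \<beta>\<close> to
    \<open>x\<close>. As coefficients are indexed by the exponent beside the basis element, the
    exponent for \<open>t\<close> exceeds that for \<open>e # t\<close> by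
    \<open>ldeg (e # t) - ldeg t\<close>.\<close>
  define y where "y s = (case s of [] \<Rightarrow> 0 | e # t \<Rightarrow> if s \<in> L (Suc n) then
    Abs_poly_mapping (\<lambda>\<delta>. if \<epsilon> (\<delta> + ldeg s) = e
      then Poly_Mapping.lookup (x t) (\<delta> + (ldeg s - ldeg t)) else 0) else 0)" for s
  have lookup_y: "Poly_Mapping.lookup (y (e # t)) \<delta> = (if \<epsilon> (\<delta> + ldeg (e # t)) = e
      then Poly_Mapping.lookup (x t) (\<delta> + (ldeg (e # t) - ldeg t)) else 0)"
    if "e # t \<in> L (Suc n)" for e t \<delta>
  proof -
    let ?\<kappa> = "ldeg (e # t) - ldeg t"
    have "finite ((\<lambda>\<delta>. \<delta> + ?\<kappa>) -` Poly_Mapping.keys (x t))"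
      by (intro finite_vimageI) (auto simp: inj_def)
    then have "finite {\<delta>. (if \<epsilon> (\<delta> + ldeg (e # t)) = e
        then Poly_Mapping.lookup (x t) (\<delta> + ?\<kappa>) else 0) \<noteq> 0}"
      by (rule rev_finite_subset) (auto simp: in_keys_iff)
    then show ?thesis using that by (simp add: y_def)
  qed
  have comp_y: "coef y (e # t) \<beta> =
      (if divides (ldeg (e # t)) \<beta> \<and> \<epsilon> \<beta> = e then coef x t \<beta> else 0)"
    if et: "e # t \<in> L (Suc n)" for e t \<beta>
  proof (cases "divides (ldeg (e # t)) \<beta>")
    case True
    have le: "divides (ldeg t) (ldeg (e # t))" by (intro divides_ldeg_mono) auto
    then have "divides (ldeg t) \<beta>" using True divides_trans by blast
    moreover have "\<beta> - ldeg (e # t) + (ldeg (e # t) - ldeg t) = \<beta> - ldeg t"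
      using True le by (intro poly_mapping_eqI) (simp add: divides_def lookup_add lookup_minus)
    ultimately show ?thesis
      using True divides_diff_add[OF True] by (simp add: coef_def lookup_y[OF et])
  qed (simp add: coef_def)
  have "x t = dif n y t" if t: "t \<in> L n" for t
  proof (rule poly_mapping_eqI)
    fix \<gamma>
    define \<beta> where "\<beta> = \<gamma> + ldeg t"
    have xt: "Poly_Mapping.lookup (x t) \<gamma> = coef x t \<beta>"
      unfolding coef_def \<beta>_def using divides_add by simp
    have "Poly_Mapping.lookup (dif n y t) \<gamma> = (\<Sum>s\<in>L (Suc n). bcoef t s * coef y s \<beta>)"
      unfolding lookup_dif \<beta>_def ..
    also have "\<dots> = (\<Sum>e<N. \<Sum>s\<in>L n. bcoef t (e # s) *
        (if divides (ldeg (e # s)) \<beta> \<and> \<epsilon> \<beta> = e then coef x s \<beta> else 0))"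
      unfolding sum_L_Suc by (intro sum.cong refl arg_cong2[where f = "(*)"] comp_y) (auto simp: L_Suc)
    also have "\<dots> = coef x t \<beta>"
    proof (cases "\<exists>i. has \<beta> i")
      case False
      have nd: "\<not> divides (ldeg (e # s)) \<beta>" if "e < N" "s \<in> L n" for e s
        using that False divides_ldeg_iff[of "e # s" "Suc n" \<beta>] by (auto simp: Cons_in_L has_def)
      have "(\<Sum>e<N. \<Sum>s\<in>L n. bcoef t (e # s) *
          (if divides (ldeg (e # s)) \<beta> \<and> \<epsilon> \<beta> = e then coef x s \<beta> else 0)) = 0"
        by (intro sum.neutral ballI) (simp add: nd)
      then show ?thesis using has[OF t] False by metis
    next
      case True
      then have \<epsilon>N: "\<epsilon> \<beta> < N" "f (\<epsilon> \<beta>) \<subseteq> Poly_Mapping.keys \<beta>" using \<epsilon> by (auto simp: has_def)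
      have div: "divides (ldeg (\<epsilon> \<beta> # s)) \<beta> \<longleftrightarrow> divides (ldeg s) \<beta>" if "s \<in> L n" for s
      proof -
        have "\<epsilon> \<beta> # s \<in> L (Suc n)" using \<epsilon>N that by (simp add: Cons_in_L)
        then show ?thesis using \<epsilon>N divides_ldeg_iff[OF that, of \<beta>] divides_ldeg_iff[of "\<epsilon> \<beta> # s" "Suc n" \<beta>]
          by simp
      qed
      have "(\<Sum>e<N. \<Sum>s\<in>L n. bcoef t (e # s) *
          (if divides (ldeg (e # s)) \<beta> \<and> \<epsilon> \<beta> = e then coef x s \<beta> else 0)) =
          (\<Sum>e<N. if e = \<epsilon> \<beta> then \<Sum>s\<in>L n. bcoef t (\<epsilon> \<beta> # s) * coef x s \<beta> else 0)"
      proof (intro sum.cong refl)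
        fix e
        show "(\<Sum>s\<in>L n. bcoef t (e # s) *
            (if divides (ldeg (e # s)) \<beta> \<and> \<epsilon> \<beta> = e then coef x s \<beta> else 0)) =
          (if e = \<epsilon> \<beta> then \<Sum>s\<in>L n. bcoef t (\<epsilon> \<beta> # s) * coef x s \<beta> else 0)"
        proof (cases "e = \<epsilon> \<beta>")
          case eq: True
          have "bcoef t (e # s) * (if divides (ldeg (e # s)) \<beta> \<and> \<epsilon> \<beta> = e then coef x s \<beta> else 0) =
              bcoef t (\<epsilon> \<beta> # s) * coef x s \<beta>" if "s \<in> L n" for s
            unfolding eq div[OF that] by (cases "divides (ldeg s) \<beta>") (simp_all add: coef_def del: bcoef.simps)
          then show ?thesis unfolding if_P[OF eq] by (rule sum.cong[OF refl])
        qed auto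
      qed
      also have "\<dots> = (\<Sum>s\<in>L n. bcoef t (\<epsilon> \<beta> # s) * coef x s \<beta>)"
        using \<epsilon>N by simp
      \<comment> \<open>Expanding the differential of \<open>\<epsilon> \<beta> # x\<close> gives
        \<open>x\<close> minus \<open>\<epsilon> \<beta>\<close> prepended to the differential of
        \<open>x\<close>, and the latter is zero by \<open>closed\<close>.\<close>
      also have "\<dots> = (\<Sum>s\<in>L n. if t = s then coef x s \<beta> else 0) -
          (\<Sum>s\<in>L n. (case t of [] \<Rightarrow> 0 | z # r \<Rightarrow> if z = \<epsilon> \<beta> then bcoef r s else 0) * coef x s \<beta>)"
        by (simp add: left_diff_distrib sum_subtractf if_distrib[of "\<lambda>c. c * _"] cong: if_cong)
      also have "(\<Sum>s\<in>L n. if t = s then coef x s \<beta> else 0) = coef x t \<beta>"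
        using t finite_L by simp
      also have "(\<Sum>s\<in>L n. (case t of [] \<Rightarrow> 0 | z # r \<Rightarrow> if z = \<epsilon> \<beta> then bcoef r s else 0) * coef x s \<beta>) = 0"
      proof (cases t)
        case (Cons z r)
        then obtain k where k: "n = Suc k" "r \<in> L k" using t by (auto simp: L_def)
        have "divides (ldeg r) (ldeg t)" unfolding Cons by (intro divides_ldeg_mono) auto
        then have "divides (ldeg r) \<beta>" unfolding \<beta>_def using divides_add divides_trans by blast
        then have "(\<Sum>s\<in>L n. bcoef r s * coef x s \<beta>) = Poly_Mapping.lookup (dif k x r) (\<beta> - ldeg r)"
          unfolding lookup_dif k(1) by (simp add: divides_diff_add)
        then show ?thesis using closed[OF k] Cons by (cases "z = \<epsilon> \<beta>") simp_all
      qed simp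
      finally show ?thesis by simp
    qed
    finally show "Poly_Mapping.lookup (x t) \<gamma> = Poly_Mapping.lookup (dif n y t) \<gamma>"
      unfolding xt by (rule sym)
  qed
  moreover have "y s \<in> carrier (mpoly_ring V)" for s
  proof (cases "s \<in> L (Suc n)")
    case True
    then obtain e t where s: "s = e # t" "t \<in> L n" by (auto simp: L_Suc)
    show ?thesis
      unfolding carrier_mpoly_ring
    proof (intro CollectI ballI)
      fix \<delta> assume "\<delta> \<in> Poly_Mapping.keys (y s)"
      then have "\<delta> + (ldeg s - ldeg t) \<in> Poly_Mapping.keys (x t)"
        using True unfolding s by (simp add: in_keys_iff lookup_y split: if_splits)
      then have "Poly_Mapping.keys (\<delta> + (ldeg s - ldeg t)) \<subseteq> V"
        using carr[OF s(2)] unfolding carrier_mpoly_ring by blast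
      then show "Poly_Mapping.keys \<delta> \<subseteq> V" by simp
    qed
  qed (auto simp: y_def carrier_mpoly_ring split: list.splits)
  ultimately show ?thesis by (intro exI[of _ y] conjI allI ballI)
qed

text \<open>Lists are encoded as numbers because \<open>betti\<close> ranges over bases of natural
  numbers. The empty list generates the ring, so index \<open>i\<close> uses length
  \<open>Suc i\<close>.\<close>

definition resolution :: "(nat, 'v, 'k::field) free_complex" where
  "resolution = \<lparr>gens = \<lambda>i. list_encode ` L (Suc i),
     mdeg = \<lambda>i b v. int (Poly_Mapping.lookup (ldeg (list_decode b)) v),
     bd = \<lambda>i a b. M (list_decode a) (list_decode b),
     aug = \<lambda>b. M [] (list_decode b)\<rparr>"

definition encode_fun :: "nat \<Rightarrow> (nat list \<Rightarrow> ('v, 'k::field) mpoly) \<Rightarrow> nat \<Rightarrow> ('v, 'k) mpoly" where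
  "encode_fun n x = (\<lambda>b. if b \<in> list_encode ` L n then x (list_decode b) else 0)"

lemma sum_encode: "(\<Sum>b\<in>list_encode ` A. h b) = (\<Sum>t\<in>A. h (list_encode t))"
  by (subst sum.reindex) (auto intro: inj_on_subset[OF inj_list_encode])

lemma free_module_encode:
  "(free_module V (list_encode ` L n) :: (nat \<Rightarrow> ('v, 'k::field) mpoly) set) =
    encode_fun n ` {x. \<forall>t\<in>L n. x t \<in> carrier (mpoly_ring V)}"
proof (intro subset_antisym subsetI)
  fix x :: "nat \<Rightarrow> ('v, 'k) mpoly" assume x: "x \<in> free_module V (list_encode ` L n)"
  then have "x = encode_fun n (\<lambda>t. x (list_encode t))"
    by (auto simp: encode_fun_def free_module_def fun_eq_iff)
  moreover have "\<forall>t\<in>L n. x (list_encode t) \<in> carrier (mpoly_ring V)"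
    using x by (auto simp: free_module_def)
  ultimately show "x \<in> encode_fun n ` {x. \<forall>t\<in>L n. x t \<in> carrier (mpoly_ring V)}" by blast
qed (auto simp: encode_fun_def free_module_def)

lemma encode_fun_eq_iff: "encode_fun n x = encode_fun n y \<longleftrightarrow> (\<forall>t\<in>L n. x t = y t)"
  by (auto simp: encode_fun_def fun_eq_iff)

lemma free_bd_resolution:
  "free_bd resolution i (encode_fun (Suc (Suc i)) y) = encode_fun (Suc i) (dif (Suc i) y)"
  by (auto simp: free_bd_def apply_matrix_def resolution_def encode_fun_def dif_def sum_encode fun_eq_iff
      intro!: sum.cong)

lemma free_aug_resolution: "free_aug resolution (encode_fun (Suc 0) y) = dif 0 y []"
  by (auto simp: free_aug_def resolution_def encode_fun_def dif_def sum_encode intro!: sum.cong)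

lemma homogeneous_M:
  "homogeneous (\<lambda>v. int (Poly_Mapping.lookup (ldeg b) v) - int (Poly_Mapping.lookup (ldeg a) v))
    (M a b :: ('v, 'k::field) mpoly)"
proof (cases "bcoef a b = (0 :: 'k)")
  case False
  then have "divides (ldeg a) (ldeg b)" using bcoef_nonzero divides_ldeg_mono by blast
  then show ?thesis by (auto simp: homogeneous_def M_def lookup_minus divides_def of_nat_diff split: if_splits)
qed (simp add: homogeneous_def M_def)

text \<open>Both requirements on a resolution in one equation: at \<open>n = 0\<close> the image is
  the ideal, and at \<open>n = Suc k\<close> it is the kernel of the next map.\<close>

lemma dif_image:
  "(\<lambda>y :: nat list \<Rightarrow> ('v, 'k::field) mpoly. encode_fun n (dif n y)) ` {y. \<forall>t\<in>L (Suc n). y t \<in> carrier (mpoly_ring V)} =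
    {encode_fun n x | x. (\<forall>t\<in>L n. x t \<in> carrier (mpoly_ring V)) \<and>
      (case n of 0 \<Rightarrow> \<forall>m\<in>Poly_Mapping.keys (x []). edge_monomial E m
         | Suc k \<Rightarrow> \<forall>r\<in>L k. dif k x r = 0)}" (is "?I = ?K")
proof (intro subset_antisym subsetI)
  fix z :: "nat \<Rightarrow> ('v, 'k) mpoly" assume "z \<in> ?I"
  then obtain y where y: "\<forall>t\<in>L (Suc n). y t \<in> carrier (mpoly_ring V)" "z = encode_fun n (dif n y)"
    by blast
  have "\<forall>t\<in>L n. dif n y t \<in> carrier (mpoly_ring V)" using y(1) by (simp add: dif_carrier)
  moreover have "case n of 0 \<Rightarrow> \<forall>m\<in>Poly_Mapping.keys (dif n y []). edge_monomial E m
      | Suc k \<Rightarrow> \<forall>r\<in>L k. dif k (dif n y) r = 0"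
  proof (cases n)
    case 0
    have "edge_monomial E m" if m: "m \<in> Poly_Mapping.keys (dif 0 y [])" for m
    proof -
      have "ldeg [] = 0" by (intro poly_mapping_eqI) (simp add: lookup_ldeg)
      then have "(\<Sum>s\<in>L (Suc 0). bcoef [] s * coef y s m) \<noteq> 0"
        using m by (simp add: in_keys_iff lookup_dif)
      then obtain s where s: "s \<in> L (Suc 0)" "coef y s m \<noteq> 0"
        by (metis (no_types, lifting) mult_zero_right sum.neutral)
      then obtain e where e: "s = [e]" "e < N" by (auto simp: L_Suc L_0)
      have "divides (ldeg s) m" using s by (simp add: coef_def split: if_splits)
      then have "f e \<subseteq> Poly_Mapping.keys m" using divides_ldeg_iff[OF s(1)] e by simp
      then show ?thesis using e E by (auto simp: edge_monomial_def)
    qed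
    then show ?thesis using 0 by simp
  next
    case (Suc k)
    have "dif k (dif n y) r = 0" for r
      using dif_dif[of r n y] by (simp add: dif_def[of k] Suc)
    then show ?thesis using Suc by simp
  qed
  ultimately show "z \<in> ?K" using y(2) by blast
next
  fix z :: "nat \<Rightarrow> ('v, 'k) mpoly" assume "z \<in> ?K"
  then obtain x where x: "\<forall>t\<in>L n. x t \<in> carrier (mpoly_ring V)" "z = encode_fun n x"
    and c: "case n of 0 \<Rightarrow> \<forall>m\<in>Poly_Mapping.keys (x []). edge_monomial E m
         | Suc k \<Rightarrow> \<forall>r\<in>L k. dif k x r = 0" by blast
  obtain y where y: "\<And>s. y s \<in> carrier (mpoly_ring V)" "\<forall>t\<in>L n. x t = dif n y t"
    using dif_exact[of n x] x(1) c by (auto split: nat.splits)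
  then have "z = encode_fun n (dif n y)" using x(2) by (simp add: encode_fun_eq_iff)
  then show "z \<in> ?I" using y(1) by blast
qed

theorem graded_free_resolution_edge_ideal:
  "graded_free_resolution V (edge_ideal V E) (resolution :: (nat, 'v, 'k::field) free_complex)"
  unfolding graded_free_resolution_def
proof (intro conjI allI ballI impI)
  let ?F = "resolution :: (nat, 'v, 'k) free_complex"
  have gens: "gens ?F i = list_encode ` L (Suc i)" for i by (simp add: resolution_def)
  show "finite (gens ?F i)" for i using finite_L by (simp add: gens)
  show "mdeg ?F i b v = 0" if "v \<notin> V" for i b v
    using that by (simp add: resolution_def lookup_ldeg)
  show "aug ?F b \<in> carrier (mpoly_ring V)" "bd ?F i a b \<in> carrier (mpoly_ring V)" for i a b
    using M_carrier by (simp_all add: resolution_def)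
  show "homogeneous (\<lambda>v. mdeg ?F (Suc i) b v - mdeg ?F i a v) (bd ?F i a b)" for i a b
    using homogeneous_M by (simp add: resolution_def)
  have "ldeg [] = 0" by (intro poly_mapping_eqI) (simp add: lookup_ldeg)
  then show "homogeneous (mdeg ?F 0 b) (aug ?F b)" for b
    using homogeneous_M[of "list_decode b" "[]"] by (simp add: resolution_def)
  have fm: "free_module V (gens ?F i) =
      encode_fun (Suc i) ` {x. \<forall>t\<in>L (Suc i). x t \<in> carrier (mpoly_ring V)}" for i
    unfolding gens by (rule free_module_encode)
  have bd: "free_bd ?F i ` free_module V (gens ?F (Suc i)) =
      {encode_fun (Suc i) x | x. (\<forall>t\<in>L (Suc i). x t \<in> carrier (mpoly_ring V)) \<and>
        (\<forall>r\<in>L i. dif i x r = 0)}" for i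
    unfolding fm image_image free_bd_resolution dif_image by simp
  show "free_aug ?F ` free_module V (gens ?F 0) = edge_ideal V E"
  proof -
    let ?Y = "{y :: nat list \<Rightarrow> ('v, 'k) mpoly. \<forall>t\<in>L (Suc 0). y t \<in> carrier (mpoly_ring V)}"
    have enc: "encode_fun 0 x (list_encode []) = x []" for x :: "nat list \<Rightarrow> ('v, 'k) mpoly"
      by (simp add: encode_fun_def L_0 del: list_encode.simps)
    have "(\<lambda>y. dif 0 y []) ` ?Y = (\<lambda>z. z (list_encode [])) ` ((\<lambda>y. encode_fun 0 (dif 0 y)) ` ?Y)"
      unfolding image_image enc ..
    also have "\<dots> = {x [] | x :: nat list \<Rightarrow> ('v, 'k) mpoly.
        x [] \<in> carrier (mpoly_ring V) \<and> (\<forall>m\<in>Poly_Mapping.keys (x []). edge_monomial E m)}"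
      unfolding dif_image setcompr_eq_image image_image enc L_0 by simp
    also have "\<dots> = edge_ideal V E"
      unfolding edge_ideal_eq[OF graph]
    proof (intro subset_antisym subsetI)
      fix p :: "('v, 'k) mpoly"
      assume "p \<in> {p. p \<in> carrier (mpoly_ring V) \<and> (\<forall>m\<in>Poly_Mapping.keys p. edge_monomial E m)}"
      then show "p \<in> {x [] | x :: nat list \<Rightarrow> ('v, 'k) mpoly.
          x [] \<in> carrier (mpoly_ring V) \<and> (\<forall>m\<in>Poly_Mapping.keys (x []). edge_monomial E m)}"
        by (intro CollectI exI[of _ "\<lambda>_. p"]) simp
    qed auto
    finally show ?thesis unfolding fm image_image free_aug_resolution .
  qed
  show "{x \<in> free_module V (gens ?F 0). free_aug ?F x = 0} = free_bd ?F 0 ` free_module V (gens ?F 1)"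
    unfolding One_nat_def bd unfolding fm by (auto simp: free_aug_resolution L_0)
  show "{x \<in> free_module V (gens ?F (Suc i)). free_bd ?F i x = 0} =
      free_bd ?F (Suc i) ` free_module V (gens ?F (Suc (Suc i)))" for i
  proof -
    have "encode_fun (Suc i) z = 0 \<longleftrightarrow> (\<forall>t\<in>L (Suc i). z t = 0)" for z :: "nat list \<Rightarrow> ('v, 'k) mpoly"
      by (auto simp: encode_fun_def fun_eq_iff)
    then show ?thesis unfolding bd unfolding fm by (auto simp: free_bd_resolution)
  qed
qed

end

theorem exists_graded_free_resolution:
  assumes "graph_on V E"
  shows "\<exists>F :: (nat, 'v, 'k::field) free_complex. graded_free_resolution V (edge_ideal V E) F"
proof -
  have "E \<subseteq> Pow V" "finite V" using assms unfolding graph_on_def by fastforce+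
  then have "finite E" using finite_subset by blast
  then obtain N f where E: "E = f ` {..<N::nat}"
    using finite_imp_nat_seg_image_inj_on[OF \<open>finite E\<close>] unfolding lessThan_def by blast
  interpret edge_list V E f N using assms E by unfold_locales
  show ?thesis using graded_free_resolution_edge_ideal by (rule exI)
qed

section \<open>Betti numbers\<close>

text \<open>The definite description is met by a value common to all resolutions, provided that
  there is one.\<close>

lemma betti_eqI:
  fixes c :: nat
  assumes "graph_on V E"
    and "\<And>F :: (nat, 'v, 'k::field) free_complex.
      graded_free_resolution V (edge_ideal V E) F \<Longrightarrow> tor_dim F i \<alpha> = c"
  shows "betti V (edge_ideal V E :: ('v, 'k) mpoly set) i \<alpha> = c"
proof -
  obtain F :: "(nat, 'v, 'k) free_complex" where "graded_free_resolution V (edge_ideal V E) F"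
    using exists_graded_free_resolution[OF assms(1)] by blast
  then show ?thesis
    unfolding betti_def using assms(2) by (intro the_equality) (blast, metis)
qed

lemma betti_bip:
  assumes D: "shifted_skew_diagram D" and fin: "finite X" "finite Y"
    and sub: "X' \<subseteq> X" "Y' \<subseteq> Y" "X' <+> Y' \<noteq> {}"
  shows "betti (X <+> Y) (edge_ideal (X <+> Y) (bip_edges D X Y) :: (nat + nat, 'k::field) mpoly set)
      i (indicator (X' <+> Y')) =
    (if spherical D X' Y' \<and> int (rect D X' Y') = int (card (X' <+> Y')) - int i - 1 then 1 else 0)"
proof (rule betti_eqI)
  show graph: "graph_on (X <+> Y) (bip_edges D X Y)" using fin by (rule graph_on_bip)
  fix F :: "(nat, nat + nat, 'k) free_complex"
  assume "graded_free_resolution (X <+> Y) (edge_ideal (X <+> Y) (bip_edges D X Y)) F"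
  with graph interpret edge_resolution "X <+> Y" "bip_edges D X Y" F by unfold_locales
  interpret bip_homology X Y D strand_hom
    using shifted_skew_diagram_convex[OF D] fin by unfold_locales
  have W: "X' <+> Y' \<subseteq> X <+> Y" using sub by auto
  \<comment> \<open>If \<open>i + 1\<close> exceeds the number of vertices, the integer on the right
    is negative and no value of \<open>rect\<close> equals it, in agreement with the value 0 in
    \<open>tor_dim_eq_g\<close>.\<close>
  show "tor_dim F i (indicator (X' <+> Y')) =
    (if spherical D X' Y' \<and> int (rect D X' Y') = int (card (X' <+> Y')) - int i - 1 then 1 else 0)"
    unfolding tor_dim_eq_g[OF W sub(3)] g_bip[OF sub(1,2)] by (auto simp: algebra_simps)
qed

lemma betti_nonbip:
  assumes D: "shifted_skew_diagram D" and fin: "finite X" and sub: "X' \<subseteq> X" "X' \<noteq> {}"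
  shows "betti X (edge_ideal X (nonbip_edges D X) :: (nat, 'k::field) mpoly set) i (indicator X') =
    (if nonbip_no_empty_rectangles D X' \<and> int (rect D X' X') = int (card X') - int i - 1
     then card (staircase_cells D X' - excess_cells D X' X') else 0)"
proof (rule betti_eqI)
  have convex: "shifted_convex D" using D by (rule shifted_skew_diagram_convex)
  show graph: "graph_on X (nonbip_edges D X)" using fin convex by (rule graph_on_nonbip)
  fix F :: "(nat, nat, 'k) free_complex"
  assume "graded_free_resolution X (edge_ideal X (nonbip_edges D X)) F"
  with graph interpret edge_resolution X "nonbip_edges D X" F by unfold_locales
  interpret nonbip_homology X D strand_hom using convex fin by unfold_locales
  have "g m X' = (if nonbip_no_empty_rectangles D X' \<and> rect D X' X' = m
      then card (staircase_cells D X' - excess_cells D X' X') else 0)" for m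
    using g_nonbip[OF sub, of "{}" "{}" m]
    unfolding no_empty_def nonbip_no_empty_rectangles_def Un_empty_left Un_empty_right by simp
  then show "tor_dim F i (indicator X') =
    (if nonbip_no_empty_rectangles D X' \<and> int (rect D X' X') = int (card X') - int i - 1
     then card (staircase_cells D X' - excess_cells D X' X') else 0)"
    unfolding tor_dim_eq_g[OF sub] by (auto simp: algebra_simps)
qed

theorem corollary2p16:
  fixes D :: "(nat \<times> nat) set" and X Y :: "nat set"
  assumes "shifted_skew_diagram D"
    and "finite X" and "\<forall>x\<in>X. 0 < x"
    and "finite Y" and "\<forall>y\<in>Y. 0 < y"
  shows
    "(\<forall>i X' Y'. X' \<subseteq> X \<longrightarrow> Y' \<subseteq> Y \<longrightarrow> X' <+> Y' \<noteq> {} \<longrightarrow>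
        betti (X <+> Y)
          (edge_ideal (X <+> Y) (bip_edges D X Y) :: (nat + nat, 'k::field) mpoly set)
          i (indicator (X' <+> Y'))
        = (if spherical D X' Y' \<and> int (rect D X' Y') = int (card (X' <+> Y')) - int i - 1
           then 1 else 0))
     \<and>
     (\<forall>i X'. X' \<subseteq> X \<longrightarrow> X' \<noteq> {} \<longrightarrow>
        betti X (edge_ideal X (nonbip_edges D X) :: (nat, 'k::field) mpoly set)
          i (indicator X')
        = (if nonbip_no_empty_rectangles D X' \<and>
              int (rect D X' X') = int (card X') - int i - 1
           then card (staircase_cells D X' - excess_cells D X' X') else 0))"
  by (intro conjI allI impI betti_bip betti_nonbip assms(1,2,4))

end
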